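(* The following optimization problem can be solved in polynomial time: given a finite set $X$ of strings over an alphabet, find a schedule $\mathcal S$ of $X$ minimizing $\sum_{B\in\mathcal S}|\mathcal C(B)|$, where $|\mathcal C(B)|$ is the number of phrases in the run length encoding of the concatenation of the strings of batch $B$ in their batch order.
   Context: A batch of $X$ is an ordered subset of $X$ (a sequence of distinct elements), identified with the concatenation of its strings in order; a schedule of $X$ is a partition of $X$ into batches. Run length encoding parses a string into maximal runs of a single repeated character, each run encoded as a phrase $(\sigma,n)$ (character $\sigma$ repeated $n$ times); the number of phrases is the number of maximal runs. *)

theory Defs
  imports Main
begin

definition is_batch :: "'a list set \<Rightarrow> 'a list list \<Rightarrow> bool" where
  "is_batch X B \<longleftrightarrow> B \<noteq> [] \<and> distinct B \<and> set B \<subseteq> X"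

definition is_schedule :: "'a list set \<Rightarrow> 'a list list set \<Rightarrow> bool" where
  "is_schedule X S \<longleftrightarrow>
     (\<forall>B\<in>S. is_batch X B) \<and>
     (\<forall>B\<in>S. \<forall>B'\<in>S. B \<noteq> B' \<longrightarrow> set B \<inter> set B' = {}) \<and>
     (\<Union>B\<in>S. set B) = X"

definition rle_phrases :: "'a list \<Rightarrow> nat" where
  "rle_phrases w = length (remdups_adj w)"

definition batch_cost :: "'a list list \<Rightarrow> nat" where
  "batch_cost B = rle_phrases (concat B)"

definition schedule_cost :: "'a list list set \<Rightarrow> nat" where
  "schedule_cost S = (\<Sum>B\<in>S. batch_cost B)"

definition optimal_schedule :: "'a list set \<Rightarrow> 'a list list set \<Rightarrow> bool" where
  "optimal_schedule X S \<longleftrightarrow> is_schedule X S \<and>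
     (\<forall>S'. is_schedule X S' \<longrightarrow> schedule_cost S \<le> schedule_cost S')"

(* TM n_states n_symbols delta.  States 0..<n_states, start state 0, halting state 1.
   Tape symbols 0..<n_symbols, symbol 0 is the blank.
   delta q s = (new state, written symbol, head move in {-1,0,1}). *)
datatype tm = TM nat nat "nat \<Rightarrow> nat \<Rightarrow> nat \<times> nat \<times> int"

(* symbols used for input/output: 1,2 = binary digits, 3,4 = separators *)
definition wf_tm :: "tm \<Rightarrow> bool" where
  "wf_tm M = (case M of TM nq ns \<delta> \<Rightarrow>
     2 \<le> nq \<and> 5 \<le> ns \<and>
     (\<forall>q<nq. \<forall>s<ns. case \<delta> q s of (q', s', d) \<Rightarrow>
        q' < nq \<and> s' < ns \<and> d \<in> {-1, 0, 1}))"

type_synonym config = "nat \<times> (int \<Rightarrow> nat) \<times> int"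

definition tm_step :: "tm \<Rightarrow> config \<Rightarrow> config" where
  "tm_step M c = (case M of TM nq ns \<delta> \<Rightarrow> case c of (q, tape, h) \<Rightarrow>
     if q = 1 then c
     else (case \<delta> q (tape h) of (q', s', d) \<Rightarrow> (q', tape(h := s'), h + d)))"

definition tm_run :: "tm \<Rightarrow> nat \<Rightarrow> config \<Rightarrow> config" where
  "tm_run M t c = (tm_step M ^^ t) c"

definition init_config :: "nat list \<Rightarrow> config" where
  "init_config w = (0, (\<lambda>i. if 0 \<le> i \<and> i < int (length w) then w ! nat i else 0), 0)"

definition tape_output :: "(int \<Rightarrow> nat) \<Rightarrow> nat list \<Rightarrow> bool" where
  "tape_output tape w \<longleftrightarrow> (\<forall>i<length w. tape (int i) = w ! i) \<and> tape (int (length w)) = 0"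

fun enc_nat :: "nat \<Rightarrow> nat list" where
  "enc_nat n = (if n = 0 then [] else (n mod 2 + 1) # enc_nat (n div 2))"

definition enc_word :: "nat list \<Rightarrow> nat list" where
  "enc_word w = concat (map (\<lambda>c. enc_nat c @ [3]) w)"

definition enc_words :: "nat list list \<Rightarrow> nat list" where
  "enc_words ws = concat (map (\<lambda>w. enc_word w @ [4]) ws)"

(* An instance X (finite set of strings over the alphabet nat) is given as a
   duplicate-free list xs enumerating X, encoded by enc_words xs.  A solution is
   output as a list of batches, each batch a list of indices into xs, encoded by
   enc_words.  The machine must halt within poly(input length) steps on every
   instance, and the decoded output must be an optimal schedule of set xs. *)
definition solves_in_poly_time :: "tm \<Rightarrow> bool" where
  "solves_in_poly_time M \<longleftrightarrow>
     (\<exists>c k::nat. \<forall>xs :: nat list list. distinct xs \<longrightarrow>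
        (\<exists>t. t \<le> c * (length (enc_words xs) + 1) ^ k \<and>
           (case tm_run M t (init_config (enc_words xs)) of (q, tape, h) \<Rightarrow>
              q = 1 \<and>
              (\<exists>S :: nat list list.
                 tape_output tape (enc_words S) \<and>
                 (\<forall>b\<in>set S. \<forall>i\<in>set b. i < length xs) \<and>
                 optimal_schedule (set xs) ((\<lambda>b. map (\<lambda>i. xs ! i) b) ` set S)))))"

end

theory Submission
  imports Defs "HOL-Library.Multiset"
begin

text \<open>
  Concatenating batches never increases the number of phrases, so it suffices to order all words in one
  batch such that the last character of a word equals the first character of its successor as often
  as possible. Words are thus arcs of a directed multigraph on the characters, to be arranged in
  a cycle (with one additional arc matching nothing as a cutting point) with as few breaks as possible.
  Local search is exact: if an arrangement cannot be improved by cutting the cycle into two parts,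
  rotating both and joining them again, then every closed trail between two breaks is a connected component
  by itself and no other trail ends where some trail starts, which is the Eulerian lower bound on the number of trails.
  There are polynomially many such moves, and each improvement gains at least one merge.

  The local search is written in a language of queue registers whose loops run a fixed number \<open>N\<close> of
  times, \<open>N\<close> being the input length plus two; hence polynomial running time is automatic. The registers are
  the tracks of the tape of a single-tape machine, on which every instruction is one sweep.
\<close>

section \<open>Register programs on a Turing machine\<close>

text \<open>Building an Euler trail explicitly would need degrees, components and splicing as data
  structures of a machine program. The local search only copies, rotates and scores a queue, so the
  graph theory stays in the correctness proof. One clock has to serve all loops: with the sentinel
  an encoded arrangement is one symbol longer than the input, still below \<open>N\<close>, so a
  single loop can traverse it, and the number of words, which bounds the score, is below
  \<open>N\<close> as well. Loops cannot be left early; bodies that traverse a register therefore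
  change nothing once their work is done, while rotating loops merely meet the same candidates
  again. On the string side the obstacle is the empty word: as an arc it merges with nothing,
  whereas in a batch its neighbours may fuse across it. The score thus gives only an upper bound on
  the cost of the batch found, and a competing schedule is measured after its empty words have been
  moved next to the sentinel.\<close>

type_synonym store = "nat \<Rightarrow> nat list"

datatype prim = Push nat nat | Pop nat | Copy nat nat | Clear nat

text \<open>Valid registers contain no \<open>0\<close>, so \<open>CHd r 0\<close> is the emptiness
  test. \<open>CGe\<close> compares numbers kept in unary.\<close>

datatype cond = CHd nat nat | CEq nat nat | CGe nat nat

text \<open>
  The label of a loop is a counter register at the machine level, where \<open>Loop x c\<close> removes one
  symbol from register \<open>x\<close> before each execution of \<open>c\<close> and stops when \<open>x\<close> is empty. At the source
  level labels are \<open>()\<close> and a loop runs exactly \<open>N\<close> times for a fixed clock \<open>N\<close>, so that every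
  source program takes polynomially many steps.
\<close>

datatype 'l com = Prim prim | Seq "'l com" "'l com" | Ite cond "'l com" "'l com" | Loop 'l "'l com"

fun do_prim :: "prim \<Rightarrow> store \<Rightarrow> store" where
  "do_prim (Push r a) \<sigma> = \<sigma>(r := \<sigma> r @ [a])"
| "do_prim (Pop r) \<sigma> = \<sigma>(r := tl (\<sigma> r))"
| "do_prim (Copy i j) \<sigma> = \<sigma>(j := \<sigma> i)"
| "do_prim (Clear r) \<sigma> = \<sigma>(r := [])"

fun test :: "cond \<Rightarrow> store \<Rightarrow> bool" where
  "test (CHd r a) \<sigma> \<longleftrightarrow> (case \<sigma> r of [] \<Rightarrow> a = 0 | b # _ \<Rightarrow> b = a)"
| "test (CEq i j) \<sigma> \<longleftrightarrow> \<sigma> i = \<sigma> j"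
| "test (CGe i j) \<sigma> \<longleftrightarrow> length (\<sigma> j) \<le> length (\<sigma> i)"

inductive big :: "nat com \<Rightarrow> store \<Rightarrow> nat \<Rightarrow> store \<Rightarrow> bool" where
  big_Prim: "big (Prim p) \<sigma> 1 (do_prim p \<sigma>)"
| big_Seq: "big c1 \<sigma> n \<sigma>1 \<Longrightarrow> big c2 \<sigma>1 m \<sigma>2 \<Longrightarrow> big (Seq c1 c2) \<sigma> (n + m + 1) \<sigma>2"
| big_Ite: "big (if test b \<sigma> then c1 else c2) \<sigma> n \<sigma>' \<Longrightarrow> big (Ite b c1 c2) \<sigma> (n + 1) \<sigma>'"
| big_Loop_done: "\<sigma> x = [] \<Longrightarrow> big (Loop x c) \<sigma> 1 \<sigma>"
| big_Loop_step: "\<sigma> x \<noteq> [] \<Longrightarrow> big c (\<sigma>(x := tl (\<sigma> x))) n \<sigma>1 \<Longrightarrow> big (Loop x c) \<sigma>1 m \<sigma>2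
    \<Longrightarrow> big (Loop x c) \<sigma> (n + m + 2) \<sigma>2"

text \<open>
  Tape cell \<open>i \<ge> 0\<close> holds the column formed by the \<open>i\<close>-th symbols of all registers, with \<open>0\<close>
  beyond the end of a register. Between instructions the head rests on cell \<open>-1\<close>, which is
  recognisable because it and the cells beyond the longest register are the only blank ones.
  A control state consists of the continuation, the phase of the current instruction (0: start,
  1: sweep to the right, 2: sweep back) and a carried symbol; \<open>([], 1, 0)\<close> is initial and
  \<open>([], 0, 0)\<close> is halting. Instructions that may blank a cell write only on the way back, so that the
  end of the sweep is still found.
\<close>

type_synonym col = "nat \<Rightarrow> nat"
type_synonym ctl = "nat com list \<times> nat \<times> nat"
type_synonym aconf = "ctl \<times> (int \<Rightarrow> col) \<times> int"

abbreviation blank :: col where "blank \<equiv> (\<lambda>_. 0)"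

text \<open>Popping shifts a track by one cell to the left, so on the way back the old symbol of
  each cell is carried to its left neighbour. \<open>Push\<close> has already written at its turning
  point.\<close>

fun left_write :: "prim \<Rightarrow> nat \<Rightarrow> col \<Rightarrow> col \<times> nat" where
  "left_write (Push r a) cy f = (f, 0)"
| "left_write (Pop r) cy f = (f(r := cy), f r)"
| "left_write (Copy i j) cy f = (f(j := f i), 0)"
| "left_write (Clear r) cy f = (f(r := 0), 0)"

text \<open>A hit is a column that refutes the test. \<open>CHd\<close> has none because it is
  decided at cell 0 alone.\<close>

fun hit :: "cond \<Rightarrow> col \<Rightarrow> bool" where
  "hit (CHd r a) f = False"
| "hit (CEq i j) f \<longleftrightarrow> f i \<noteq> f j"
| "hit (CGe i j) f \<longleftrightarrow> f i = 0 \<and> f j \<noteq> 0"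

text \<open>The continuation acts as a stack, so no program position has to be stored on the tape. A
  loop that goes on pushes the decrement of its counter as an ordinary \<open>Pop\<close>.\<close>

fun delta :: "nat com \<Rightarrow> ctl \<Rightarrow> col \<Rightarrow> ctl \<times> col \<times> int" where
  "delta c0 ([], ph, cy) f = (if ph = 1 then (([c0], 0, 0), f, -1) else (([], 0, 0), f, 0))"
| "delta c0 (Prim p # K, ph, cy) f =
    (if ph = 0 then ((Prim p # K, 1, 0), f, 1)
     else if ph = 1 then
       (case p of
          Push r a \<Rightarrow> if f r \<noteq> 0 then ((Prim p # K, 1, 0), f, 1) else ((Prim p # K, 2, 0), f(r := a), -1)
        | _ \<Rightarrow> if f \<noteq> blank then ((Prim p # K, 1, 0), f, 1) else ((Prim p # K, 2, 0), f, -1))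
     else if f \<noteq> blank
       then ((Prim p # K, 2, snd (left_write p cy f)), fst (left_write p cy f), -1)
       else ((K, 0, 0), f, 0))"
| "delta c0 (Seq c1 c2 # K, ph, cy) f = ((c1 # c2 # K, 0, 0), f, 0)"
| "delta c0 (Ite b c1 c2 # K, ph, cy) f =
    (if ph = 0 then ((Ite b c1 c2 # K, 1, 0), f, 1)
     else if ph = 1 then
       (case b of
          CHd r a \<Rightarrow> (((if f r = a then c1 else c2) # K, 0, 0), f, -1)
        | _ \<Rightarrow> if f = blank then ((Ite b c1 c2 # K, 2, 1), f, -1)
               else if hit b f then ((Ite b c1 c2 # K, 2, 0), f, -1)
               else ((Ite b c1 c2 # K, 1, 0), f, 1))
     else if f \<noteq> blank then ((Ite b c1 c2 # K, 2, cy), f, -1)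
       else (((if cy = 1 then c1 else c2) # K, 0, 0), f, 0))"
| "delta c0 (Loop x c # K, ph, cy) f =
    (if ph = 0 then ((Loop x c # K, 1, 0), f, 1)
     else if f x = 0 then ((K, 0, 0), f, -1)
     else ((Prim (Pop x) # c # Loop x c # K, 0, 0), f, -1))"

text \<open>Generic in states and symbols, so that the machine on columns can be transported to
  numbered states and symbols by renaming.\<close>

definition gstep :: "('q \<Rightarrow> 'c \<Rightarrow> 'q \<times> 'c \<times> int) \<Rightarrow> 'q \<Rightarrow> 'q \<times> (int \<Rightarrow> 'c) \<times> int \<Rightarrow> 'q \<times> (int \<Rightarrow> 'c) \<times> int" where
  "gstep \<delta> halt = (\<lambda>(q, tp, h). if q = halt then (q, tp, h)
     else case \<delta> q (tp h) of (q', f, d) \<Rightarrow> (q', tp(h := f), h + d))"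

abbreviation astep :: "nat com \<Rightarrow> aconf \<Rightarrow> aconf" where
  "astep c0 \<equiv> gstep (delta c0) ([], 0, 0)"

definition tape_of :: "store \<Rightarrow> int \<Rightarrow> col" where
  "tape_of \<sigma> i r = (if 0 \<le> i \<and> nat i < length (\<sigma> r) then \<sigma> r ! nat i else 0)"

definition valid :: "store \<Rightarrow> bool" where
  "valid \<sigma> \<longleftrightarrow> (\<forall>r. set (\<sigma> r) \<subseteq> {1..4})"

section \<open>Simulating single instructions by sweeps\<close>

lemma astep_run: "q \<noteq> ([], 0, 0) \<Longrightarrow> delta c0 q (tp h) = (q', f, d) \<Longrightarrow>
    astep c0 (q, tp, h) = (q', tp(h := f), h + d)"
  by (simp add: gstep_def)

lemma astep_keep: "q \<noteq> ([], 0, 0) \<Longrightarrow> delta c0 q (tp h) = (q', tp h, d) \<Longrightarrow>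
    astep c0 (q, tp, h) = (q', tp, h + d)"
  by (simp add: gstep_def)

lemma funpow_trans: "(f ^^ m) a = b \<Longrightarrow> (f ^^ n) b = c \<Longrightarrow> (f ^^ (m + n)) a = c"
  by (subst add.commute) (simp add: funpow_add)

lemmas run_trans = funpow_trans[where f = "astep c0" for c0]

lemma run_step: "astep c0 a = b \<Longrightarrow> (astep c0 ^^ n) b = c \<Longrightarrow> (astep c0 ^^ Suc n) a = c"
  by (simp add: funpow_swap1)

lemma valid_nth: "valid \<sigma> \<Longrightarrow> i < length (\<sigma> r) \<Longrightarrow> \<sigma> r ! i \<noteq> 0"
  unfolding valid_def by (metis atLeastAtMost_iff not_one_le_zero nth_mem subsetD)

lemma tape_of_neg [simp]: "i < 0 \<Longrightarrow> tape_of \<sigma> i = blank"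
  by (auto simp: tape_of_def)

lemma tape_of_eq_0: "valid \<sigma> \<Longrightarrow> tape_of \<sigma> (int i) r = 0 \<longleftrightarrow> length (\<sigma> r) \<le> i"
  using valid_nth by (force simp: tape_of_def)

text \<open>No register of a valid store contains \<open>0\<close>, so the first blank cell lies
  exactly at the length of the longest register. That length is taken as a least upper bound because
  there are infinitely many registers.\<close>

lemma tape_extent:
  assumes "valid \<sigma>" "\<forall>r. length (\<sigma> r) \<le> M"
  obtains m where "m \<le> M" "tape_of \<sigma> (int m) = blank" "\<forall>i<m. tape_of \<sigma> (int i) \<noteq> blank"
    "\<forall>r. length (\<sigma> r) \<le> m"
proof -
  define m where "m = (LEAST m. \<forall>r. length (\<sigma> r) \<le> m)"
  have a: "\<forall>r. length (\<sigma> r) \<le> m" unfolding m_def by (rule LeastI[of "\<lambda>m. \<forall>r. length (\<sigma> r) \<le> m", OF assms(2)])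
  have b: "m \<le> M" unfolding m_def by (rule Least_le[of "\<lambda>m. \<forall>r. length (\<sigma> r) \<le> m", OF assms(2)])
  have c: "tape_of \<sigma> (int m) = blank" using a by (simp add: tape_of_def fun_eq_iff leD)
  have d: "\<forall>i<m. tape_of \<sigma> (int i) \<noteq> blank"
  proof (intro allI impI notI)
    fix i assume "i < m" "tape_of \<sigma> (int i) = blank"
    then have "\<forall>r. length (\<sigma> r) \<le> i" using tape_of_eq_0[OF assms(1)] by metis
    then have "m \<le> i" unfolding m_def by (rule Least_le[of "\<lambda>m. \<forall>r. length (\<sigma> r) \<le> m"])
    then show False using \<open>i < m\<close> by simp
  qed
  show ?thesis using that b c d a by blast
qed

lemma sweep_right:
  assumes "\<forall>i<n. delta c0 (K, 1, 0) (tp (int i)) = ((K, 1, 0), tp (int i), 1)"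
  shows "(astep c0 ^^ n) ((K, 1, 0), tp, 0) = ((K, 1, 0), tp, int n)"
  using assms
proof (induction n)
  case (Suc n)
  then have "(astep c0 ^^ n) ((K, 1, 0), tp, 0) = ((K, 1, 0), tp, int n)" by simp
  moreover have "astep c0 ((K, 1, 0), tp, int n) = ((K, 1, 0), tp, int (Suc n))"
    using Suc.prems by (subst astep_keep[of _ _ _ _ _ 1]) auto
  ultimately show ?case by simp
qed simp

lemma sweep_left:
  assumes "\<forall>i<n. delta c0 (K, 2, cy) (tp (int i)) = ((K, 2, cy), tp (int i), -1)"
  shows "(astep c0 ^^ n) ((K, 2, cy), tp, int n - 1) = ((K, 2, cy), tp, -1)"
  using assms
proof (induction n)
  case (Suc n)
  have "astep c0 ((K, 2, cy), tp, int (Suc n) - 1) = ((K, 2, cy), tp, int n - 1)"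
    using Suc.prems by (subst astep_keep[of _ _ _ _ _ "-1"]) auto
  then show ?case using Suc by (intro run_step) auto
qed simp

fun carry :: "prim \<Rightarrow> store \<Rightarrow> nat \<Rightarrow> nat" where
  "carry (Pop r) \<sigma> j = tape_of \<sigma> (int j) r"
| "carry _ _ _ = 0"

lemma left_write_tape:
  assumes "\<forall>r a. p \<noteq> Push r a"
  shows "left_write p (carry p \<sigma> (Suc j)) (tape_of \<sigma> (int j)) = (tape_of (do_prim p \<sigma>) (int j), carry p \<sigma> j)"
  using assms
  by (cases p) (auto simp: tape_of_def nth_tl nat_add_distrib[of 1] nat_int_add fun_eq_iff)

text \<open>Invariant of the writing sweep: cells to the right of the head already show the new
  store, all others the old one.\<close>

lemma sweep_left_write:
  assumes p: "\<forall>r a. p \<noteq> Push r a" and "n \<le> m" and ne: "\<forall>i<m. tape_of \<sigma> (int i) \<noteq> blank"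
  shows "(astep c0 ^^ n) ((Prim p # K, 2, carry p \<sigma> n),
      (\<lambda>i. if i \<ge> int n then tape_of (do_prim p \<sigma>) i else tape_of \<sigma> i), int n - 1) =
    ((Prim p # K, 2, carry p \<sigma> 0), tape_of (do_prim p \<sigma>), -1)"
  using \<open>n \<le> m\<close>
proof (induction n)
  case 0
  then show ?case by (auto simp: fun_eq_iff)
next
  case (Suc n)
  let ?tp = "\<lambda>n i. if i \<ge> int n then tape_of (do_prim p \<sigma>) i else tape_of \<sigma> i"
  have "delta c0 (Prim p # K, 2, carry p \<sigma> (Suc n)) (?tp (Suc n) (int n)) =
     ((Prim p # K, 2, carry p \<sigma> n), tape_of (do_prim p \<sigma>) (int n), -1)"
    using ne Suc.prems left_write_tape[OF p, of \<sigma> n] by simp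
  then have "astep c0 ((Prim p # K, 2, carry p \<sigma> (Suc n)), ?tp (Suc n), int n) =
     ((Prim p # K, 2, carry p \<sigma> n), (?tp (Suc n))(int n := tape_of (do_prim p \<sigma>) (int n)), int n + -1)"
    by (intro astep_run) auto
  also have "(?tp (Suc n))(int n := tape_of (do_prim p \<sigma>) (int n)) = ?tp n"
    by (auto simp: fun_eq_iff)
  finally show ?case using Suc by (intro run_step) auto
qed

lemma sim_prim:
  assumes valid: "valid \<sigma>" and len: "\<forall>r. length (\<sigma> r) \<le> M"
  shows "\<exists>t. t \<le> 2 * M + 5 \<and> (astep c0 ^^ t) ((Prim p # K, 0, 0), tape_of \<sigma>, -1) =
    ((K, 0, 0), tape_of (do_prim p \<sigma>), -1)"
proof -
  obtain m where m: "m \<le> M" "tape_of \<sigma> (int m) = blank" "\<forall>i<m. tape_of \<sigma> (int i) \<noteq> blank"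
    "\<forall>r. length (\<sigma> r) \<le> m"
    using tape_extent[OF valid len] by blast
  have s0: "astep c0 ((Prim p # K, 0, 0), tape_of \<sigma>, -1) = ((Prim p # K, 1, 0), tape_of \<sigma>, 0)"
    by (subst astep_keep[of _ _ _ _ _ 1]) auto
  have sl: "astep c0 ((Prim p # K, 2, cy), tape_of \<sigma>', -1) = ((K, 0, 0), tape_of \<sigma>', -1)" for cy \<sigma>'
    by (subst astep_keep[of _ _ _ _ _ 0]) auto
  show ?thesis
  proof (cases "\<exists>r a. p = Push r a")
    case False
    then have p: "\<forall>r a. p \<noteq> Push r a" by blast
    have r: "(astep c0 ^^ m) ((Prim p # K, 1, 0), tape_of \<sigma>, 0) = ((Prim p # K, 1, 0), tape_of \<sigma>, int m)"
      using m p by (intro sweep_right) (auto split: prim.splits)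
    have mid: "astep c0 ((Prim p # K, 1, 0), tape_of \<sigma>, int m) = ((Prim p # K, 2, 0), tape_of \<sigma>, int m - 1)"
      using m p by (subst astep_keep[of _ _ _ _ _ "-1"]) (auto split: prim.splits)
    \<comment> \<open>At the turning point the mixed tape is still the old one: without a push no
      register grows beyond \<open>m\<close>, so both stores are blank from there on.\<close>
    have tm: "(\<lambda>i. if i \<ge> int m then tape_of (do_prim p \<sigma>) i else tape_of \<sigma> i) = tape_of \<sigma>"
    proof -
      have "tape_of (do_prim p \<sigma>) i = tape_of \<sigma> i" if "i \<ge> int m" for i
      proof -
        have "\<forall>r. length (\<sigma> r) \<le> nat i" using m(4) that by (meson le_nat_iff le_trans of_nat_0_le_iff order_trans)
        moreover have "length (do_prim p \<sigma> r) \<le> nat i" for r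
          using calculation p by (cases p) (auto simp: le_diff_conv le_SucI)
        ultimately show ?thesis by (simp add: tape_of_def fun_eq_iff leD)
      qed
      then show ?thesis by auto
    qed
    have "carry p \<sigma> m = 0" using m(2) by (cases p) (auto simp: fun_eq_iff)
    then have l: "(astep c0 ^^ m) ((Prim p # K, 2, 0), tape_of \<sigma>, int m - 1) = 
        ((Prim p # K, 2, carry p \<sigma> 0), tape_of (do_prim p \<sigma>), -1)"
      using sweep_left_write[OF p le_refl m(3), of c0 K] unfolding tm by simp
    have "(astep c0 ^^ (Suc (m + Suc (m + 1)))) ((Prim p # K, 0, 0), tape_of \<sigma>, -1) = 
      ((K, 0, 0), tape_of (do_prim p \<sigma>), -1)"
      by (rule run_step[OF s0 run_trans[OF r run_step[OF mid run_trans[OF l]]]]) (simp add: sl)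
    then show ?thesis using m(1) by (intro exI[of _ "Suc (m + Suc (m + 1))"]) auto
  next
    case True
    then obtain r a where p: "p = Push r a" by blast
    \<comment> \<open>\<open>Push\<close> turns at the end of its own register, possibly before the
      longest one ends; on the way back this register alone keeps the cells nonblank.\<close>
    define n where "n = length (\<sigma> r)"
    have n: "n \<le> m" using m(4) n_def by simp
    have r: "(astep c0 ^^ n) ((Prim p # K, 1, 0), tape_of \<sigma>, 0) = ((Prim p # K, 1, 0), tape_of \<sigma>, int n)"
      using p tape_of_eq_0[OF valid] n_def by (intro sweep_right) auto
    have mid: "astep c0 ((Prim p # K, 1, 0), tape_of \<sigma>, int n) = 
       ((Prim p # K, 2, 0), tape_of (do_prim p \<sigma>), int n - 1)"
    proof -
      have "(tape_of \<sigma>)(int n := (tape_of \<sigma> (int n))(r := a)) = tape_of (do_prim p \<sigma>)"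
        by (auto simp: p tape_of_def fun_eq_iff n_def nth_append nat_eq_iff2)
      moreover have "tape_of \<sigma> (int n) r = 0" using tape_of_eq_0[OF valid] n_def by simp
      ultimately show ?thesis by (subst astep_run[of _ _ _ _ _ "(tape_of \<sigma> (int n))(r := a)" "-1"]) (auto simp: p)
    qed
    have l: "(astep c0 ^^ n) ((Prim p # K, 2, 0), tape_of (do_prim p \<sigma>), int n - 1) =
       ((Prim p # K, 2, 0), tape_of (do_prim p \<sigma>), -1)"
    proof (rule sweep_left, intro allI impI)
      fix i assume "i < n"
      then have "tape_of \<sigma> (int i) r \<noteq> 0" using tape_of_eq_0[OF valid] n_def by simp
      then have "tape_of (do_prim p \<sigma>) (int i) r \<noteq> 0"
        using \<open>i < n\<close> by (auto simp: p tape_of_def n_def nth_append)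
      then have "tape_of (do_prim p \<sigma>) (int i) \<noteq> blank" by (auto simp: fun_eq_iff)
      then show "delta c0 (Prim p # K, 2, 0) (tape_of (do_prim p \<sigma>) (int i)) =
         ((Prim p # K, 2, 0), tape_of (do_prim p \<sigma>) (int i), - 1)" by (simp add: p)
    qed
    have "(astep c0 ^^ (Suc (n + Suc (n + 1)))) ((Prim p # K, 0, 0), tape_of \<sigma>, -1) = 
      ((K, 0, 0), tape_of (do_prim p \<sigma>), -1)"
      by (rule run_step[OF s0 run_trans[OF r run_step[OF mid run_trans[OF l]]]]) (simp add: sl)
    then show ?thesis using m(1) n by (intro exI[of _ "Suc (n + Suc (n + 1))"]) auto
  qed
qed

lemma test_CHd_tape: "valid \<sigma> \<Longrightarrow> test (CHd r a) \<sigma> \<longleftrightarrow> tape_of \<sigma> 0 r = a"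
  by (auto simp: tape_of_def split: list.splits)

lemma test_hit:
  assumes "valid \<sigma>" "\<forall>r a. b \<noteq> CHd r a"
  shows "test b \<sigma> \<longleftrightarrow> (\<forall>i. \<not> hit b (tape_of \<sigma> (int i)))"
proof (cases b)
  case (CEq i j)
  have "\<sigma> i = \<sigma> j" if "\<forall>k. tape_of \<sigma> (int k) i = tape_of \<sigma> (int k) j"
  proof -
    have "length (\<sigma> i) \<le> k \<longleftrightarrow> length (\<sigma> j) \<le> k" for k
      using that tape_of_eq_0[OF assms(1)] by metis
    then have l: "length (\<sigma> i) = length (\<sigma> j)" by (metis le_antisym le_refl)
    show ?thesis
    proof (rule nth_equalityI[OF l])
      fix k assume "k < length (\<sigma> i)"
      then show "\<sigma> i ! k = \<sigma> j ! k" using that[rule_format, of k] l by (simp add: tape_of_def)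
    qed
  qed
  moreover have "tape_of \<sigma> k i = tape_of \<sigma> k j" if "\<sigma> i = \<sigma> j" for k using that by (simp add: tape_of_def)
  ultimately show ?thesis using CEq by auto
next
  case (CGe i j)
  then show ?thesis by (auto simp: tape_of_eq_0[OF assms(1)])
qed (use assms in auto)

lemma sim_test:
  assumes valid: "valid \<sigma>" and len: "\<forall>r. length (\<sigma> r) \<le> M"
  shows "\<exists>t. t \<le> 2 * M + 5 \<and> (astep c0 ^^ t) ((Ite b c1 c2 # K, 0, 0), tape_of \<sigma>, -1) =
    (((if test b \<sigma> then c1 else c2) # K, 0, 0), tape_of \<sigma>, -1)"
proof -
  let ?I = "Ite b c1 c2 # K"
  obtain m where m: "m \<le> M" "tape_of \<sigma> (int m) = blank" "\<forall>i<m. tape_of \<sigma> (int i) \<noteq> blank"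
    "\<forall>r. length (\<sigma> r) \<le> m"
    using tape_extent[OF valid len] by blast
  have s0: "astep c0 ((?I, 0, 0), tape_of \<sigma>, -1) = ((?I, 1, 0), tape_of \<sigma>, 0)"
    by (subst astep_keep[of _ _ _ _ _ 1]) auto
  show ?thesis
  proof (cases "\<exists>r a. b = CHd r a")
    case True
    then obtain r a where b: "b = CHd r a" by blast
    have "astep c0 ((?I, 1, 0), tape_of \<sigma>, 0) = (((if test b \<sigma> then c1 else c2) # K, 0, 0), tape_of \<sigma>, -1)"
      unfolding b test_CHd_tape[OF valid] by (subst astep_keep[of _ _ _ _ _ "-1"]) auto
    then have "(astep c0 ^^ Suc 1) ((?I, 0, 0), tape_of \<sigma>, -1) = 
       (((if test b \<sigma> then c1 else c2) # K, 0, 0), tape_of \<sigma>, -1)"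
      by (intro run_step[OF s0]) auto
    then show ?thesis by (intro exI[of _ "Suc 1"]) auto
  next
    case False
    then have b: "\<forall>r a. b \<noteq> CHd r a" by blast
    \<comment> \<open>The sweep turns at the first refuting cell or, if there is none, at the end of
      the store.\<close>
    define n where "n = (LEAST n. n = m \<or> hit b (tape_of \<sigma> (int n)))"
    have n: "n = m \<or> hit b (tape_of \<sigma> (int n))" unfolding n_def by (rule LeastI[of _ m]) simp
    have nm: "n \<le> m" unfolding n_def by (rule Least_le) simp
    have nh: "\<not> hit b (tape_of \<sigma> (int i))" if "i < n" for i
      using not_less_Least[OF that[unfolded n_def]] by simp
    have hb: "\<not> hit b blank" by (cases b) auto
    have r: "(astep c0 ^^ n) ((?I, 1, 0), tape_of \<sigma>, 0) = ((?I, 1, 0), tape_of \<sigma>, int n)"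
      using nh nm m(3) b by (intro sweep_right) (fastforce split: cond.splits)
    define cy where "cy = (if test b \<sigma> then 1 else 0 :: nat)"
    have beyond: "tape_of \<sigma> (int i) = blank" if "i \<ge> m" for i
      using m(4) that by (auto simp: tape_of_def fun_eq_iff) (meson le_trans not_less)
    have t: "test b \<sigma> \<longleftrightarrow> n = m"
    proof
      assume "n = m"
      then show "test b \<sigma>" using nh beyond hb unfolding test_hit[OF valid b] by (metis not_less)
    next
      assume "test b \<sigma>"
      then show "n = m" using n unfolding test_hit[OF valid b] by blast
    qed
    have mid: "astep c0 ((?I, 1, 0), tape_of \<sigma>, int n) = ((?I, 2, cy), tape_of \<sigma>, int n - 1)"
      using b m(2,3) n nm t by (subst astep_keep[of _ _ _ _ _ "-1"]) (auto simp: cy_def split: cond.splits)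
    have l: "(astep c0 ^^ n) ((?I, 2, cy), tape_of \<sigma>, int n - 1) = ((?I, 2, cy), tape_of \<sigma>, -1)"
      using nm m(3) by (intro sweep_left) auto
    have "astep c0 ((?I, 2, cy), tape_of \<sigma>, -1) = (((if test b \<sigma> then c1 else c2) # K, 0, 0), tape_of \<sigma>, -1)"
      by (subst astep_keep[of _ _ _ _ _ 0]) (auto simp: cy_def)
    then have "(astep c0 ^^ (Suc (n + Suc (n + 1)))) ((?I, 0, 0), tape_of \<sigma>, -1) = 
      (((if test b \<sigma> then c1 else c2) # K, 0, 0), tape_of \<sigma>, -1)"
      by (intro run_step[OF s0 run_trans[OF r run_step[OF mid run_trans[OF l]]]]) simp
    then show ?thesis using m(1) nm by (intro exI[of _ "Suc (n + Suc (n + 1))"]) auto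
  qed
qed

lemma sim_loop:
  assumes valid: "valid \<sigma>"
  shows "(astep c0 ^^ 2) ((Loop x c # K, 0, 0), tape_of \<sigma>, -1) =
    ((if \<sigma> x = [] then K else Prim (Pop x) # c # Loop x c # K, 0, 0), tape_of \<sigma>, -1)"
proof -
  have "astep c0 ((Loop x c # K, 0, 0), tape_of \<sigma>, -1) = ((Loop x c # K, 1, 0), tape_of \<sigma>, 0)"
    by (subst astep_keep[of _ _ _ _ _ 1]) auto
  moreover have "astep c0 ((Loop x c # K, 1, 0), tape_of \<sigma>, 0) = 
     ((if \<sigma> x = [] then K else Prim (Pop x) # c # Loop x c # K, 0, 0), tape_of \<sigma>, -1)"
    using tape_of_eq_0[OF valid, of 0 x] by (subst astep_keep[of _ _ _ _ _ "-1"]) auto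
  ultimately show ?thesis by (simp add: numeral_2_eq_2)
qed

lemma sim_seq: "astep c0 ((Seq c1 c2 # K, 0, 0), tp, h) = ((c1 # c2 # K, 0, 0), tp, h)"
  by (subst astep_keep[of _ _ _ _ _ 0]) auto

section \<open>Simulating whole programs\<close>

fun wf_prim :: "nat \<Rightarrow> prim \<Rightarrow> bool" where
  "wf_prim k (Push r a) \<longleftrightarrow> r < k \<and> 0 < a \<and> a < 5"
| "wf_prim k (Pop r) \<longleftrightarrow> r < k"
| "wf_prim k (Copy i j) \<longleftrightarrow> i < k \<and> j < k"
| "wf_prim k (Clear r) \<longleftrightarrow> r < k"

fun wf_cond :: "nat \<Rightarrow> cond \<Rightarrow> bool" where
  "wf_cond k (CHd r a) \<longleftrightarrow> r < k"
| "wf_cond k (CEq i j) \<longleftrightarrow> i < k \<and> j < k"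
| "wf_cond k (CGe i j) \<longleftrightarrow> i < k \<and> j < k"

fun wf_com :: "nat \<Rightarrow> nat com \<Rightarrow> bool" where
  "wf_com k (Prim p) \<longleftrightarrow> wf_prim k p"
| "wf_com k (Seq c1 c2) \<longleftrightarrow> wf_com k c1 \<and> wf_com k c2"
| "wf_com k (Ite b c1 c2) \<longleftrightarrow> wf_cond k b \<and> wf_com k c1 \<and> wf_com k c2"
| "wf_com k (Loop x c) \<longleftrightarrow> x < k \<and> wf_com k c"

lemma in_set_tl: "x \<in> set (tl xs) \<Longrightarrow> x \<in> set xs"
  by (cases xs) auto

lemma valid_do_prim: "valid \<sigma> \<Longrightarrow> wf_prim k p \<Longrightarrow> valid (do_prim p \<sigma>)"
  unfolding valid_def by (cases p) (auto dest: in_set_tl simp: subset_iff)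

lemma length_do_prim: "\<forall>r. length (\<sigma> r) \<le> M \<Longrightarrow> length (do_prim p \<sigma> r) \<le> M + 1"
  by (cases p) (auto simp: le_SucI le_diff_conv trans_le_add1)

text \<open>A counted step costs at most one sweep out and back and lengthens the longest register
  by at most one. The two extra steps counted per loop iteration pay for the emptiness check and the
  decrement.\<close>

lemma sim_big:
  "big c \<sigma> n \<sigma>' \<Longrightarrow> valid \<sigma> \<Longrightarrow> wf_com k c \<Longrightarrow> \<forall>r. length (\<sigma> r) \<le> M \<Longrightarrow>
   \<exists>t \<le> n * (2 * (M + n) + 5). (astep c0 ^^ t) ((c # K, 0, 0), tape_of \<sigma>, -1) = ((K, 0, 0), tape_of \<sigma>', -1)
     \<and> valid \<sigma>' \<and> (\<forall>r. length (\<sigma>' r) \<le> M + n)"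
proof (induction arbitrary: M K rule: big.induct)
  case (big_Prim p \<sigma>)
  obtain t where t: "t \<le> 2 * M + 5" "(astep c0 ^^ t) ((Prim p # K, 0, 0), tape_of \<sigma>, -1) =
    ((K, 0, 0), tape_of (do_prim p \<sigma>), -1)"
    using sim_prim[OF big_Prim(1,3)] by blast
  have "t \<le> 1 * (2 * (M + 1) + 5)" using t(1) by simp
  then show ?case
    using t(2) valid_do_prim[OF big_Prim(1)] length_do_prim[OF big_Prim(3), of p] big_Prim(2)
    by (intro exI[of _ t]) auto
next
  case (big_Seq c1 \<sigma> n \<sigma>1 c2 m \<sigma>2)
  obtain t1 where t1: "t1 \<le> n * (2 * (M + n) + 5)" 
    "(astep c0 ^^ t1) ((c1 # c2 # K, 0, 0), tape_of \<sigma>, -1) = ((c2 # K, 0, 0), tape_of \<sigma>1, -1)"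
    "valid \<sigma>1" "\<forall>r. length (\<sigma>1 r) \<le> M + n"
    using big_Seq.IH(1)[OF big_Seq.prems(1) _ big_Seq.prems(3)] big_Seq.prems(2) by (metis wf_com.simps(2))
  obtain t2 where t2: "t2 \<le> m * (2 * (M + n + m) + 5)" 
    "(astep c0 ^^ t2) ((c2 # K, 0, 0), tape_of \<sigma>1, -1) = ((K, 0, 0), tape_of \<sigma>2, -1)"
    "valid \<sigma>2" "\<forall>r. length (\<sigma>2 r) \<le> M + n + m" 
    using big_Seq.IH(2)[OF t1(3) _ t1(4)] big_Seq.prems(2) by (metis wf_com.simps(2))
  have "(astep c0 ^^ (Suc (t1 + t2))) ((Seq c1 c2 # K, 0, 0), tape_of \<sigma>, -1) = ((K, 0, 0), tape_of \<sigma>2, -1)"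
    by (intro run_step[OF sim_seq] run_trans[OF t1(2) t2(2)])
  moreover have "Suc (t1 + t2) \<le> (n + m + 1) * (2 * (M + (n + m + 1)) + 5)"
    using t1(1) t2(1) by (simp add: algebra_simps)
  moreover have "\<forall>r. length (\<sigma>2 r) \<le> M + (n + m + 1)" using t2(4) by (simp add: add.assoc le_SucI)
  ultimately show ?case using t2(3) by blast
next
  case (big_Ite b \<sigma> c1 c2 n \<sigma>')
  obtain t1 where t1: "t1 \<le> 2 * M + 5" "(astep c0 ^^ t1) ((Ite b c1 c2 # K, 0, 0), tape_of \<sigma>, -1) =
    (((if test b \<sigma> then c1 else c2) # K, 0, 0), tape_of \<sigma>, -1)"
    using sim_test[OF big_Ite.prems(1,3)] by blast
  have "wf_com k (if test b \<sigma> then c1 else c2)" using big_Ite.prems by simp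
  then obtain t2 where t2: "t2 \<le> n * (2 * (M + n) + 5)" 
    "(astep c0 ^^ t2) (((if test b \<sigma> then c1 else c2) # K, 0, 0), tape_of \<sigma>, -1) = ((K, 0, 0), tape_of \<sigma>', -1)"
    "valid \<sigma>'" "\<forall>r. length (\<sigma>' r) \<le> M + n" using big_Ite.IH[OF big_Ite.prems(1) _ big_Ite.prems(3)] by blast
  have "t1 + t2 \<le> (n + 1) * (2 * (M + (n + 1)) + 5)"
    using t1(1) t2(1) by (simp add: algebra_simps)
  moreover have "\<forall>r. length (\<sigma>' r) \<le> M + (n + 1)" using t2(4) by (simp add: le_SucI)
  ultimately show ?case using run_trans[OF t1(2) t2(2)] t2(3) by blast
next
  case (big_Loop_done \<sigma> x c)
  then show ?case using sim_loop[OF big_Loop_done(2), of c0 x c K]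
    by (intro exI[of _ 2]) (auto simp: le_SucI)
next
  case (big_Loop_step \<sigma> x c n \<sigma>1 m \<sigma>2)
  let ?K = "Loop x c # K"
  have s0: "(astep c0 ^^ 2) ((?K, 0, 0), tape_of \<sigma>, -1) = ((Prim (Pop x) # c # ?K, 0, 0), tape_of \<sigma>, -1)"
    using sim_loop[OF big_Loop_step(6), of c0 x c K] big_Loop_step(1) by simp
  obtain t0 where t0: "t0 \<le> 2 * M + 5" "(astep c0 ^^ t0) ((Prim (Pop x) # c # ?K, 0, 0), tape_of \<sigma>, -1) =
     ((c # ?K, 0, 0), tape_of (\<sigma>(x := tl (\<sigma> x))), -1)"
    using sim_prim[OF big_Loop_step(6,8), of c0 "Pop x" "c # ?K"] by auto
  have valid: "valid (\<sigma>(x := tl (\<sigma> x)))" using valid_do_prim[OF big_Loop_step(6), of k "Pop x"] big_Loop_step(7) by simp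
  have len: "\<forall>r. length ((\<sigma>(x := tl (\<sigma> x))) r) \<le> M" using big_Loop_step(8) by (auto simp: le_diff_conv le_SucI)
  obtain t1 where t1: "t1 \<le> n * (2 * (M + n) + 5)" 
    "(astep c0 ^^ t1) ((c # ?K, 0, 0), tape_of (\<sigma>(x := tl (\<sigma> x))), -1) = ((?K, 0, 0), tape_of \<sigma>1, -1)"
    "valid \<sigma>1" "\<forall>r. length (\<sigma>1 r) \<le> M + n"
    using big_Loop_step.IH(1)[OF valid _ len] big_Loop_step.prems(2) by (metis wf_com.simps(4))
  obtain t2 where t2: "t2 \<le> m * (2 * (M + n + m) + 5)" 
    "(astep c0 ^^ t2) ((?K, 0, 0), tape_of \<sigma>1, -1) = ((K, 0, 0), tape_of \<sigma>2, -1)"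
    "valid \<sigma>2" "\<forall>r. length (\<sigma>2 r) \<le> M + n + m"
    using big_Loop_step.IH(2)[OF t1(3) big_Loop_step.prems(2) t1(4)] by blast
  have "(astep c0 ^^ (2 + (t0 + (t1 + t2)))) ((?K, 0, 0), tape_of \<sigma>, -1) = ((K, 0, 0), tape_of \<sigma>2, -1)"
    by (intro run_trans[OF s0] run_trans[OF t0(2)] run_trans[OF t1(2) t2(2)])
  moreover have "2 + (t0 + (t1 + t2)) \<le> (n + m + 2) * (2 * (M + (n + m + 2)) + 5)"
    using t0(1) t1(1) t2(1) by (simp add: algebra_simps)
  moreover have "\<forall>r. length (\<sigma>2 r) \<le> M + (n + m + 2)" using t2(4) by (simp add: add.assoc le_SucI)
  ultimately show ?case using t2(3) by blast
qed

text \<open>The format \<open>tm\<close> fixes the numbers of the start and halting states and of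
  the five input and output symbols. The list \<open>ps\<close> holds the elements with prescribed
  numbers; the others are numbered arbitrarily behind them.\<close>

lemma finite_coding:
  assumes "finite A" "distinct ps" "set ps \<subseteq> A"
  shows "\<exists>f. bij_betw f A {..<card A} \<and> (\<forall>i<length ps. f (ps ! i) = i)"
proof -
  obtain rs where rs: "set rs = A - set ps" "distinct rs"
    using finite_distinct_list[of "A - set ps"] assms(1) by auto
  define qs where "qs = ps @ rs"
  have d: "distinct qs" and s: "set qs = A" using rs assms by (auto simp: qs_def)
  have b: "bij_betw ((!) qs) {..<length qs} A" using bij_betw_nth[OF d, of "{..<length qs}" A] s by simp
  have l: "length qs = card A" using d s distinct_card by metis
  have "inv_into {..<length qs} ((!) qs) (ps ! i) = i" if "i < length ps" for i
  proof -
    have "ps ! i = qs ! i" using that by (simp add: qs_def nth_append)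
    moreover have "i < length qs" using that by (simp add: qs_def)
    ultimately show ?thesis using b by (simp add: bij_betw_def inv_into_f_eq)
  qed
  then show ?thesis using bij_betw_inv_into[OF b] l by auto
qed

text \<open>Renaming by numberings of \<open>Q\<close> and \<open>C\<close> commutes with steps as
  long as the run stays inside these sets, which \<open>closed\<close> ensures. The list
  \<open>cs\<close> says which abstract symbol represents each of the tape symbols \<open>0\<close>
  to \<open>4\<close>.\<close>

lemma tm_of_finite_machine:
  fixes \<delta> :: "'q \<Rightarrow> 'c \<Rightarrow> 'q \<times> 'c \<times> int"
  assumes fin: "finite Q" "finite C" and st: "start \<in> Q" "halt \<in> Q" "start \<noteq> halt"
    and cs: "distinct cs" "set cs \<subseteq> C" "length cs = 5"
    and closed: "\<And>q f q' f' d. q \<in> Q \<Longrightarrow> f \<in> C \<Longrightarrow> \<delta> q f = (q', f', d) \<Longrightarrow> q' \<in> Q \<and> f' \<in> C \<and> d \<in> {-1, 0, 1}"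
  shows "\<exists>M cc. wf_tm M \<and> (\<forall>i<5. cc (cs ! i) = i) \<and>
    (\<forall>w t tp h. set w \<subseteq> {..<5} \<longrightarrow>
      (gstep \<delta> halt ^^ t) (start, (\<lambda>i. if 0 \<le> i \<and> i < int (length w) then cs ! (w ! nat i) else cs ! 0), 0) = (halt, tp, h) \<longrightarrow>
      tm_run M t (init_config w) = (1, cc \<circ> tp, h))"
proof -
  obtain cq where cq: "bij_betw cq Q {..<card Q}" "cq start = 0" "cq halt = 1"
  proof -
    have "distinct [start, halt]" "set [start, halt] \<subseteq> Q" using st by auto
    from finite_coding[OF fin(1) this] obtain f where f: "bij_betw f Q {..<card Q}" and e: "\<forall>i<2. f ([start, halt] ! i) = i" by auto
    have "f start = 0" "f halt = 1" using e[rule_format, of 0] e[rule_format, of 1] by auto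
    then show ?thesis using that f by blast
  qed
  obtain cc where cc: "bij_betw cc C {..<card C}" "\<forall>i<5. cc (cs ! i) = i"
    using finite_coding[OF fin(2) cs(1,2)] cs(3) by auto
  define dq where "dq = inv_into Q cq"
  define dc where "dc = inv_into C cc"
  have dq: "dq q \<in> Q" if "q < card Q" for q
    using that cq(1) unfolding dq_def by (metis bij_betw_def inv_into_into lessThan_iff)
  have dc: "dc q \<in> C" if "q < card C" for q
    using that cc(1) unfolding dc_def by (metis bij_betw_def inv_into_into lessThan_iff)
  have dcq: "dq (cq q) = q" if "q \<in> Q" for q using that cq(1) by (simp add: dq_def bij_betw_def)
  have dcc: "dc (cc q) = q" if "q \<in> C" for q using that cc(1) by (simp add: dc_def bij_betw_def)
  have cqr: "cq q < card Q" if "q \<in> Q" for q using that cq(1) bij_betwE by blast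
  have ccr: "cc q < card C" if "q \<in> C" for q using that cc(1) bij_betwE by blast
  have cq1: "cq q = 1 \<longleftrightarrow> q = halt" if "q \<in> Q" for q using that cq st by (metis bij_betw_def inj_on_eq_iff)
  define M where "M = TM (card Q) (card C) (\<lambda>q s. case \<delta> (dq q) (dc s) of (q', f, d) \<Rightarrow> (cq q', cc f, d))"
  have "wf_tm M"
  proof -
    have "card {start, halt} \<le> card Q" using fin st by (intro card_mono) auto
    moreover have "card (set cs) \<le> card C" using fin cs by (intro card_mono) auto
    moreover have "case case \<delta> (dq q) (dc s) of (q', f, d) \<Rightarrow> (cq q', cc f, d) of (q', s', d) \<Rightarrow>
        q' < card Q \<and> s' < card C \<and> d \<in> {-1, 0, 1}" if "q < card Q" "s < card C" for q s
      using closed[OF dq[OF that(1)] dc[OF that(2)]] cqr ccr by (cases "\<delta> (dq q) (dc s)") force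
    ultimately show ?thesis using st cs distinct_card[OF cs(1)] unfolding wf_tm_def M_def by simp
  qed
  moreover have step: "tm_run M t (cq q, cc \<circ> tp, h) = (cq q', cc \<circ> tp', h')"
    if "q \<in> Q" "\<forall>i. tp i \<in> C" "(gstep \<delta> halt ^^ t) (q, tp, h) = (q', tp', h')" for t q tp h q' tp' h'
    using that
  proof (induction t arbitrary: q tp h)
    case (Suc t)
    obtain q1 tp1 h1 where s1: "gstep \<delta> halt (q, tp, h) = (q1, tp1, h1)" by (metis prod.exhaust)
    have "q1 \<in> Q \<and> (\<forall>i. tp1 i \<in> C)"
      using s1 Suc.prems(1,2) closed[OF Suc.prems(1) Suc.prems(2)[rule_format, of h]]
      by (auto simp: gstep_def split: if_splits prod.splits)
    moreover have "tm_step M (cq q, cc \<circ> tp, h) = (cq q1, cc \<circ> tp1, h1)"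
      using s1 Suc.prems(1,2) closed[OF Suc.prems(1) Suc.prems(2)[rule_format, of h]] cq1
      by (auto simp: gstep_def tm_step_def M_def dcq dcc fun_eq_iff split: if_splits prod.splits)
    moreover have "(gstep \<delta> halt ^^ t) (q1, tp1, h1) = (q', tp', h')"
      using Suc.prems(3) s1 by (simp add: funpow_swap1)
    ultimately show ?case using Suc.IH[of q1 tp1 h1] by (simp add: tm_run_def funpow_swap1 comp_def)
  qed (simp add: tm_run_def)
  moreover have "init_config w = (cq start, cc \<circ> (\<lambda>i. if 0 \<le> i \<and> i < int (length w) then cs ! (w ! nat i) else cs ! 0), 0)"
    if "set w \<subseteq> {..<5}" for w
  proof -
    have "w ! nat i < 5" if "0 \<le> i" "i < int (length w)" for i
      using that \<open>set w \<subseteq> _\<close> by (metis lessThan_iff nat_less_iff nth_mem subsetD)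
    then show ?thesis using cq cc(2) by (auto simp: init_config_def fun_eq_iff)
  qed
  moreover have "(if 0 \<le> i \<and> i < int (length w) then cs ! (w ! nat i) else cs ! 0) \<in> C" if "set w \<subseteq> {..<5}" for w i
  proof -
    have "w ! nat i < 5" if "0 \<le> i" "i < int (length w)"
      using that \<open>set w \<subseteq> _\<close> by (metis lessThan_iff nat_less_iff nth_mem subsetD)
    moreover have "cs ! k \<in> C" if "k < 5" for k using that cs by (metis nth_mem subsetD)
    ultimately show ?thesis by auto
  qed
  ultimately show ?thesis using cc(2) st cq(3) by (intro exI[of _ M] exI[of _ cc]) fastforce
qed

text \<open>The continuations that can occur while \<open>c\<close> runs on top of \<open>K\<close>.
  They are finitely many because a loop always resumes with the stack on which it started.\<close>

fun conts :: "nat com \<Rightarrow> nat com list \<Rightarrow> nat com list set" where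
  "conts (Prim p) K = {Prim p # K}"
| "conts (Seq c1 c2) K = insert (Seq c1 c2 # K) (conts c1 (c2 # K) \<union> conts c2 K)"
| "conts (Ite b c1 c2) K = insert (Ite b c1 c2 # K) (conts c1 K \<union> conts c2 K)"
| "conts (Loop x c) K = {Loop x c # K, Prim (Pop x) # c # Loop x c # K} \<union> conts c (Loop x c # K)"

fun next_conts :: "nat com list \<Rightarrow> nat com list set" where
  "next_conts [] = {}"
| "next_conts (Prim p # K) = {K}"
| "next_conts (Seq c1 c2 # K) = {c1 # c2 # K}"
| "next_conts (Ite b c1 c2 # K) = {c1 # K, c2 # K}"
| "next_conts (Loop x c # K) = {K, Prim (Pop x) # c # Loop x c # K}"

lemma finite_conts: "finite (conts c K)"
  by (induction c arbitrary: K) auto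

lemma conts_self: "c # K \<in> conts c K"
  by (cases c) auto

lemma next_conts_closed: "L \<in> conts c K \<Longrightarrow> next_conts L \<subseteq> insert K (conts c K)"
proof (induction c arbitrary: K L)
  case (Seq c1 c2)
  then show ?case using conts_self[of c1 "c2 # K"] conts_self[of c2 K] by fastforce
next
  case (Ite b c1 c2)
  then show ?case using conts_self[of c1 K] conts_self[of c2 K] by fastforce
next
  case (Loop x c)
  then show ?case using conts_self[of c "Loop x c # K"] by fastforce
qed auto

lemma conts_wf: "L \<in> conts c K \<Longrightarrow> wf_com k c \<Longrightarrow> \<forall>d\<in>set K. wf_com k d \<Longrightarrow> d \<in> set L \<Longrightarrow> wf_com k d"
  by (induction c arbitrary: K L) fastforce+

definition cols :: "nat \<Rightarrow> col set" where
  "cols k = {f. (\<forall>r. f r < 5) \<and> (\<forall>r\<ge>k. f r = 0)}"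

lemma finite_cols: "finite (cols k)"
proof -
  have "finite {f. \<forall>r. (r \<in> {..<k} \<longrightarrow> f r \<in> {..<5::nat}) \<and> (r \<notin> {..<k} \<longrightarrow> f r = 0)}"
    by (intro finite_set_of_finite_funs) auto
  then show ?thesis by (rule finite_subset[rotated]) (auto simp: cols_def)
qed

definition ctls :: "nat com \<Rightarrow> ctl set" where
  "ctls c = insert [] (conts c []) \<times> {..<3} \<times> {..<5}"

lemma delta_closed:
  assumes wf: "wf_com k c0" and q: "q \<in> ctls c0" and f: "f \<in> cols k" and d: "delta c0 q f = (q', f', d)"
  shows "q' \<in> ctls c0 \<and> f' \<in> cols k \<and> d \<in> {-1, 0, 1}"
proof -
  obtain L ph cy where qq: "q = (L, ph, cy)" by (metis prod.exhaust)
  have L: "L \<in> insert [] (conts c0 [])" and cy: "cy < 5" using q by (auto simp: qq ctls_def)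
  show ?thesis
  proof (cases L)
    case Nil
    then show ?thesis using d f conts_self[of c0 "[]"] by (auto simp: qq ctls_def split: if_splits)
  next
    case (Cons c K)
    then have Lc: "c # K \<in> conts c0 []" using L by simp
    have nx: "next_conts (c # K) \<subseteq> insert [] (conts c0 [])" using next_conts_closed[OF Lc] .
    have wc: "wf_com k c" using conts_wf[OF Lc wf] by simp
    have f5: "f r < 5" for r using f by (simp add: cols_def)
    show ?thesis
    proof (cases c)
      case (Prim p)
      have "(fst (left_write p cy f)) \<in> cols k" "snd (left_write p cy f) < 5"
        using f cy wc Prim by (cases p; auto simp: cols_def)+
      moreover have "f(r := a) \<in> cols k" if "p = Push r a" for r a
        using f wc Prim that by (auto simp: cols_def)
      ultimately show ?thesis using d Cons Lc nx Prim f
        by (auto simp: qq ctls_def split: if_splits prim.splits)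
    next
      case (Ite b c1 c2)
      then show ?thesis using d Cons Lc nx f cy by (cases b) (auto simp: qq ctls_def split: if_splits)
    next
      case (Seq c1 c2)
      then show ?thesis using d Cons Lc nx f cy by (auto simp: qq ctls_def)
    next
      case (Loop x c)
      then show ?thesis using d Cons Lc nx f cy by (auto simp: qq ctls_def split: if_splits)
    qed
  qed
qed

definition input_store :: "nat list \<Rightarrow> store" where
  "input_store w = (\<lambda>_. [])(0 := w)"

text \<open>All registers but \<open>0\<close> must end up empty: only then is each column the one
  that represents an output symbol, so that the tape can be read off literally. The extra step loads
  the program and moves the head to cell -1.\<close>

lemma tm_of_com:
  assumes wf: "wf_com k c" and k: "0 < k"
  shows "\<exists>M. wf_tm M \<and> (\<forall>w n \<sigma>. set w \<subseteq> {1..4} \<longrightarrow> big c (input_store w) n \<sigma> \<longrightarrow> (\<forall>r. r \<noteq> 0 \<longrightarrow> \<sigma> r = []) \<longrightarrow>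
    (\<exists>t tp h. t \<le> 1 + n * (2 * (length w + n) + 5) \<and> tm_run M t (init_config w) = (1, tp, h) \<and> tape_output tp (\<sigma> 0)))"
proof -
  define cs where "cs = map (\<lambda>i. blank(0 := i)) [0..<5::nat]"
  have nth: "cs ! i = blank(0 := i)" if "i < 5" for i using that by (simp add: cs_def del: upt_Suc upt.simps)
  have "\<exists>M cc. wf_tm M \<and> (\<forall>i<5. cc (cs ! i) = i) \<and>
    (\<forall>w t tp h. set w \<subseteq> {..<5} \<longrightarrow>
      (astep c ^^ t) (([], 1, 0), (\<lambda>i. if 0 \<le> i \<and> i < int (length w) then cs ! (w ! nat i) else cs ! 0), 0) = (([], 0, 0), tp, h) \<longrightarrow>
      tm_run M t (init_config w) = (1, cc \<circ> tp, h))"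
  proof (rule tm_of_finite_machine)
    show "finite (ctls c)" by (simp add: ctls_def finite_conts)
    show "finite (cols k)" by (rule finite_cols)
    show "distinct cs" by (auto simp: cs_def distinct_map inj_on_def fun_eq_iff simp del: upt_Suc upt.simps)
    show "set cs \<subseteq> cols k" using k by (auto simp: cs_def cols_def)
    show "length cs = 5" by (simp add: cs_def)
    show "([], 1, 0) \<in> ctls c" "([], 0, 0) \<in> ctls c" by (auto simp: ctls_def)
    show "([], 1, 0) \<noteq> ([] :: nat com list, 0 :: nat, 0 :: nat)" by simp
    show "q' \<in> ctls c \<and> f' \<in> cols k \<and> d \<in> {-1, 0, 1}"
      if "q \<in> ctls c" "f \<in> cols k" "delta c q f = (q', f', d)" for q f q' f' d
      using delta_closed[OF wf that] .
  qed
  then obtain M cc where M: "wf_tm M" and cc: "\<forall>i<5. cc (cs ! i) = i" and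
    sim: "\<And>w t tp h. set w \<subseteq> {..<5} \<Longrightarrow>
      (astep c ^^ t) (([], 1, 0), (\<lambda>i. if 0 \<le> i \<and> i < int (length w) then cs ! (w ! nat i) else cs ! 0), 0) = (([], 0, 0), tp, h) \<Longrightarrow>
      tm_run M t (init_config w) = (1, cc \<circ> tp, h)" by blast
  have "\<exists>t tp h. t \<le> 1 + n * (2 * (length w + n) + 5) \<and> tm_run M t (init_config w) = (1, tp, h) \<and> tape_output tp (\<sigma> 0)"
    if w: "set w \<subseteq> {1..4}" and b: "big c (input_store w) n \<sigma>" and e: "\<forall>r. r \<noteq> 0 \<longrightarrow> \<sigma> r = []" for w n \<sigma>
  proof -
    have w5: "set w \<subseteq> {..<5}" using w by fastforce
    have valid: "valid (input_store w)" using w by (auto simp: valid_def input_store_def)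
    have len: "\<forall>r. length (input_store w r) \<le> length w" by (auto simp: input_store_def)
    obtain t where t: "t \<le> n * (2 * (length w + n) + 5)"
      "(astep c ^^ t) (([c], 0, 0), tape_of (input_store w), -1) = (([], 0, 0), tape_of \<sigma>, -1)" "valid \<sigma>"
      using sim_big[OF b valid wf len] by blast
    have i: "(\<lambda>i. if 0 \<le> i \<and> i < int (length w) then cs ! (w ! nat i) else cs ! 0) = tape_of (input_store w)"
    proof (rule ext)
      fix i
      show "(if 0 \<le> i \<and> i < int (length w) then cs ! (w ! nat i) else cs ! 0) = tape_of (input_store w) i"
      proof (cases "0 \<le> i \<and> i < int (length w)")
        case True
        then have "w ! nat i < 5" using w5 by (metis lessThan_iff nat_less_iff nth_mem subsetD)
        then show ?thesis using True by (auto simp: nth tape_of_def input_store_def fun_eq_iff)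
      qed (auto simp: nth tape_of_def input_store_def fun_eq_iff)
    qed
    have s0: "astep c (([], 1, 0), tape_of (input_store w), 0) = (([c], 0, 0), tape_of (input_store w), -1)"
      by (subst astep_keep[of _ _ _ _ _ "-1"]) auto
    have run: "tm_run M (Suc t) (init_config w) = (1, cc \<circ> tape_of \<sigma>, -1)"
      using sim[OF w5, unfolded i, OF run_step[OF s0 t(2)]] .
    have "tape_output (cc \<circ> tape_of \<sigma>) (\<sigma> 0)"
    proof -
      have c: "tape_of \<sigma> (int i) = cs ! (if i < length (\<sigma> 0) then \<sigma> 0 ! i else 0)" 
        if "(if i < length (\<sigma> 0) then \<sigma> 0 ! i else 0) < 5" for i
      proof (rule ext)
        fix r
        show "tape_of \<sigma> (int i) r = (cs ! (if i < length (\<sigma> 0) then \<sigma> 0 ! i else 0)) r"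
          using e nth[OF that] by (cases "r = 0") (auto simp: tape_of_def)
      qed
      have sy: "\<sigma> 0 ! i < 5" if "i < length (\<sigma> 0)" for i
        using t(3) nth_mem[OF that] by (force simp: valid_def)
      show ?thesis unfolding tape_output_def using c[of "length (\<sigma> 0)"] c sy cc by auto
    qed
    then show ?thesis using run t(1) by (intro exI[of _ "Suc t"]) auto
  qed
  then show ?thesis using M by blast
qed

section \<open>Loop programs run in polynomial time\<close>

fun exec :: "nat \<Rightarrow> unit com \<Rightarrow> store \<Rightarrow> store" where
  "exec N (Prim p) \<sigma> = do_prim p \<sigma>"
| "exec N (Seq c1 c2) \<sigma> = exec N c2 (exec N c1 \<sigma>)"
| "exec N (Ite b c1 c2) \<sigma> = (if test b \<sigma> then exec N c1 \<sigma> else exec N c2 \<sigma>)"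
| "exec N (Loop u c) \<sigma> = (exec N c ^^ N) \<sigma>"

text \<open>\<open>B\<close> is the first free register and becomes the loop counter, so the
  counters of the body start at \<open>Suc B\<close>. Loops that are not nested share a counter,
  which is refilled from the clock each time.\<close>

fun compile :: "nat \<Rightarrow> unit com \<Rightarrow> nat com" where
  "compile B (Prim p) = Prim p"
| "compile B (Seq c1 c2) = Seq (compile B c1) (compile B c2)"
| "compile B (Ite b c1 c2) = Ite b (compile B c1) (compile B c2)"
| "compile B (Loop u c) = Seq (Prim (Copy 1 B)) (Loop B (compile (Suc B) c))"

fun depth :: "unit com \<Rightarrow> nat" where
  "depth (Prim p) = 0"
| "depth (Seq c1 c2) = depth c1 + depth c2"
| "depth (Ite b c1 c2) = depth c1 + depth c2"
| "depth (Loop u c) = Suc (depth c)"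

fun target :: "prim \<Rightarrow> nat" where
  "target (Push r a) = r"
| "target (Pop r) = r"
| "target (Copy i j) = j"
| "target (Clear r) = r"

fun wf_src :: "nat \<Rightarrow> unit com \<Rightarrow> bool" where
  "wf_src k (Prim p) \<longleftrightarrow> wf_prim k p \<and> target p \<noteq> 1"
| "wf_src k (Seq c1 c2) \<longleftrightarrow> wf_src k c1 \<and> wf_src k c2"
| "wf_src k (Ite b c1 c2) \<longleftrightarrow> wf_cond k b \<and> wf_src k c1 \<and> wf_src k c2"
| "wf_src k (Loop u c) \<longleftrightarrow> wf_src k c"

text \<open>In a loop, \<open>2\<close> per iteration is what \<open>big\<close> charges, and
  \<open>3\<close> pays for the final check, for copying the clock and for the sequencing of the
  two.\<close>

fun cost :: "nat \<Rightarrow> unit com \<Rightarrow> nat" where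
  "cost N (Prim p) = 1"
| "cost N (Seq c1 c2) = cost N c1 + cost N c2 + 1"
| "cost N (Ite b c1 c2) = cost N c1 + cost N c2 + 1"
| "cost N (Loop u c) = N * (cost N c + 2) + 3"

section \<open>Compiled programs agree with the source semantics\<close>

lemma wf_prim_mono: "wf_prim k p \<Longrightarrow> k \<le> k' \<Longrightarrow> wf_prim k' p"
  by (cases p) auto

lemma wf_cond_mono: "wf_cond k b \<Longrightarrow> k \<le> k' \<Longrightarrow> wf_cond k' b"
  by (cases b) auto

lemma wf_src_mono: "wf_src k c \<Longrightarrow> k \<le> k' \<Longrightarrow> wf_src k' c"
  by (induction c) (auto intro: wf_prim_mono wf_cond_mono)

lemma wf_compile: "wf_src B c \<Longrightarrow> 1 < B \<Longrightarrow> B + depth c \<le> k \<Longrightarrow> wf_com k (compile B c)"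
proof (induction c arbitrary: B)
  case (Prim p)
  then show ?case by (auto intro: wf_prim_mono)
next
  case (Ite b c1 c2)
  then show ?case by (auto intro: wf_cond_mono)
next
  case (Loop u c)
  then show ?case using wf_src_mono[of B c "Suc B"] by auto
qed auto

lemma do_prim_other: "r \<noteq> target p \<Longrightarrow> do_prim p \<sigma> r = \<sigma> r"
  by (cases p) auto

lemma target_less: "wf_prim k p \<Longrightarrow> target p < k"
  by (cases p) auto

lemma exec_unused: "wf_src B c \<Longrightarrow> r \<ge> B \<or> r = 1 \<Longrightarrow> exec N c \<sigma> r = \<sigma> r"
proof (induction c arbitrary: \<sigma>)
  case (Prim p)
  then show ?case using target_less do_prim_other by (metis exec.simps(1) leD wf_src.simps(1))
next
  case (Loop u c)
  then have "(exec N c ^^ n) \<sigma> r = \<sigma> r" for n by (induction n) auto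
  then show ?case by simp
qed auto

text \<open>The compiled run and the source run differ in the counter registers. These lie from
  \<open>B\<close> on, where a source program has no access, so agreement below \<open>B\<close>
  persists.\<close>

lemma exec_local:
  "wf_src B c \<Longrightarrow> \<forall>r<B. \<sigma> r = \<tau> r \<Longrightarrow> \<forall>r<B. exec N c \<sigma> r = exec N c \<tau> r"
proof (induction c arbitrary: \<sigma> \<tau>)
  case (Prim p)
  then show ?case by (cases p) auto
next
  case (Seq c1 c2)
  then show ?case by simp
next
  case (Ite b c1 c2)
  then have "test b \<sigma> = test b \<tau>" by (cases b) auto
  then show ?case using Ite by simp
next
  case (Loop u c)
  have "\<forall>r<B. (exec N c ^^ n) \<sigma> r = (exec N c ^^ n) \<tau> r" for n
    using Loop.prems(2) by (induction n) (use Loop in auto)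
  then show ?case by simp
qed

lemma funpow_exec_local:
  "wf_src B c \<Longrightarrow> \<forall>r<B. \<sigma> r = \<tau> r \<Longrightarrow> \<forall>r<B. (exec N c ^^ n) \<sigma> r = (exec N c ^^ n) \<tau> r"
  by (induction n) (auto simp: exec_local)

lemma compile_correct:
  "wf_src B c \<Longrightarrow> 1 < B \<Longrightarrow> length (\<sigma> 1) = N \<Longrightarrow>
   \<exists>n \<sigma>'. big (compile B c) \<sigma> n \<sigma>' \<and> (\<forall>r<B. \<sigma>' r = exec N c \<sigma> r) \<and> n \<le> cost N c"
proof (induction c arbitrary: B \<sigma>)
  case (Prim p)
  show ?case using big_Prim[of p \<sigma>] by (intro exI[of _ 1] exI[of _ "do_prim p \<sigma>"]) simp
next
  case (Seq c1 c2)
  obtain n1 \<sigma>1 where 1: "big (compile B c1) \<sigma> n1 \<sigma>1" "\<forall>r<B. \<sigma>1 r = exec N c1 \<sigma> r" "n1 \<le> cost N c1"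
    using Seq.IH(1)[of B \<sigma>] Seq.prems by auto
  have "length (\<sigma>1 1) = N" using 1(2) Seq.prems exec_unused[of B c1 1] by simp
  then obtain n2 \<sigma>2 where 2: "big (compile B c2) \<sigma>1 n2 \<sigma>2" "\<forall>r<B. \<sigma>2 r = exec N c2 \<sigma>1 r" "n2 \<le> cost N c2"
    using Seq.IH(2)[of B \<sigma>1] Seq.prems by auto
  have "\<forall>r<B. \<sigma>2 r = exec N c2 (exec N c1 \<sigma>) r" using 2(2) exec_local[OF _ 1(2)] Seq.prems(1) by simp
  then show ?case using big_Seq[OF 1(1) 2(1)] 1(3) 2(3) by fastforce
next
  case (Ite b c1 c2)
  obtain n \<sigma>' where "big (compile B (if test b \<sigma> then c1 else c2)) \<sigma> n \<sigma>'"
    "\<forall>r<B. \<sigma>' r = exec N (if test b \<sigma> then c1 else c2) \<sigma> r" "n \<le> cost N (if test b \<sigma> then c1 else c2)"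
  proof (cases "test b \<sigma>")
    case True
    then show ?thesis using Ite.IH(1)[of B \<sigma>] Ite.prems that by auto
  next
    case False
    then show ?thesis using Ite.IH(2)[of B \<sigma>] Ite.prems that by auto
  qed
  then show ?case using big_Ite[of b \<sigma> "compile B c1" "compile B c2" n \<sigma>']
    by (intro exI[of _ "n + 1"] exI[of _ \<sigma>']) (auto split: if_splits)
next
  case (Loop u c)
  have wf: "wf_src B c" using Loop.prems by simp
  have wfS: "wf_src (Suc B) c" using wf_src_mono[OF wf] by simp
  \<comment> \<open>Generalised from a full counter to one with \<open>m\<close> symbols left, so
    that one iteration can hand over to the rest.\<close>
  have it: "\<exists>n \<sigma>'. big (Loop B (compile (Suc B) c)) \<sigma> n \<sigma>' \<and> (\<forall>r<B. \<sigma>' r = (exec N c ^^ m) \<sigma> r) \<and> n \<le> m * (cost N c + 2) + 1"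
    if "length (\<sigma> B) = m" "length (\<sigma> 1) = N" for m \<sigma>
    using that
  proof (induction m arbitrary: \<sigma>)
    case 0
    then show ?case by (auto intro!: exI big_Loop_done)
  next
    case (Suc m)
    define \<tau> where "\<tau> = \<sigma>(B := tl (\<sigma> B))"
    have "length (\<tau> 1) = N" using Suc.prems Loop.prems(2) by (simp add: \<tau>_def)
    then obtain n1 \<sigma>1 where 1: "big (compile (Suc B) c) \<tau> n1 \<sigma>1" "\<forall>r<Suc B. \<sigma>1 r = exec N c \<tau> r" "n1 \<le> cost N c"
      using Loop.IH[OF wfS, of \<tau>] Loop.prems(2) by auto
    have "\<sigma>1 B = \<tau> B" "\<sigma>1 1 = \<tau> 1" using 1(2) exec_unused[OF wf] Loop.prems(2) by auto
    then have "length (\<sigma>1 B) = m" "length (\<sigma>1 1) = N" using Suc.prems Loop.prems(2) by (auto simp: \<tau>_def)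
    then obtain n2 \<sigma>2 where 2: "big (Loop B (compile (Suc B) c)) \<sigma>1 n2 \<sigma>2" 
      "\<forall>r<B. \<sigma>2 r = (exec N c ^^ m) \<sigma>1 r" "n2 \<le> m * (cost N c + 2) + 1"
      using Suc.IH by blast
    have "\<forall>r<B. \<sigma>1 r = exec N c \<sigma> r"
      using 1(2) exec_local[OF wf, of \<tau> \<sigma> N] by (simp add: \<tau>_def)
    then have "\<forall>r<B. (exec N c ^^ m) \<sigma>1 r = (exec N c ^^ m) (exec N c \<sigma>) r"
      by (rule funpow_exec_local[OF wf])
    then have "\<forall>r<B. \<sigma>2 r = (exec N c ^^ Suc m) \<sigma> r" using 2(2) by (simp add: funpow_swap1)
    moreover have "\<sigma> B \<noteq> []" using Suc.prems by auto
    ultimately show ?case using big_Loop_step[OF _ 1(1)[unfolded \<tau>_def] 2(1)] 1(3) 2(3)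
      by (intro exI[of _ "n1 + n2 + 2"] exI[of _ \<sigma>2]) auto
  qed
  let ?\<sigma> = "\<sigma>(B := \<sigma> 1)"
  obtain n \<sigma>' where n: "big (Loop B (compile (Suc B) c)) ?\<sigma> n \<sigma>'" "\<forall>r<B. \<sigma>' r = (exec N c ^^ N) ?\<sigma> r" "n \<le> N * (cost N c + 2) + 1"
    using it[of ?\<sigma> N] Loop.prems by auto
  have "\<forall>r<B. \<sigma>' r = (exec N c ^^ N) \<sigma> r" using n(2) funpow_exec_local[OF wf, of ?\<sigma> \<sigma>] by simp
  moreover have "big (compile B (Loop u c)) \<sigma> (1 + n + 1) \<sigma>'"
    using big_Seq[OF big_Prim[of "Copy 1 B" \<sigma>]] n(1) by simp
  ultimately show ?case using n(3) by (intro exI[of _ "1 + n + 1"] exI[of _ \<sigma>']) auto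
qed

lemma cost_poly: "\<exists>A d. \<forall>N. cost N c \<le> A * (N + 1) ^ d"
proof (induction c)
  case (Prim p)
  show ?case by (rule exI[of _ 1], rule exI[of _ 0]) simp
next
  case (Seq c1 c2)
  then obtain A1 d1 A2 d2 where 1: "\<And>N. cost N c1 \<le> A1 * (N + 1) ^ d1" "\<And>N. cost N c2 \<le> A2 * (N + 1) ^ d2" by blast
  have "cost N (Seq c1 c2) \<le> (A1 + A2 + 1) * (N + 1) ^ (d1 + d2)" for N
  proof -
    have "A1 * (N + 1) ^ d1 \<le> A1 * (N + 1) ^ (d1 + d2)" "A2 * (N + 1) ^ d2 \<le> A2 * (N + 1) ^ (d1 + d2)"
      "1 \<le> (N + 1) ^ (d1 + d2)" by (auto intro: power_increasing)
    then show ?thesis using 1[of N] unfolding add_mult_distrib cost.simps by linarith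
  qed
  then show ?case by blast
next
  case (Ite b c1 c2)
  then obtain A1 d1 A2 d2 where 1: "\<And>N. cost N c1 \<le> A1 * (N + 1) ^ d1" "\<And>N. cost N c2 \<le> A2 * (N + 1) ^ d2" by blast
  have "cost N (Ite b c1 c2) \<le> (A1 + A2 + 1) * (N + 1) ^ (d1 + d2)" for N
  proof -
    have "A1 * (N + 1) ^ d1 \<le> A1 * (N + 1) ^ (d1 + d2)" "A2 * (N + 1) ^ d2 \<le> A2 * (N + 1) ^ (d1 + d2)"
      "1 \<le> (N + 1) ^ (d1 + d2)" by (auto intro: power_increasing)
    then show ?thesis using 1[of N] unfolding add_mult_distrib cost.simps by linarith
  qed
  then show ?case by blast
next
  case (Loop u c)
  then obtain A d where 1: "\<And>N. cost N c \<le> A * (N + 1) ^ d" by blast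
  have "cost N (Loop u c) \<le> (A + 5) * (N + 1) ^ Suc d" for N
  proof -
    have "1 \<le> (N + 1) ^ d" by simp
    then have "cost N c + 2 \<le> (A + 2) * (N + 1) ^ d" using 1[of N] unfolding add_mult_distrib by linarith
    then have "N * (cost N c + 2) \<le> (N + 1) * ((A + 2) * (N + 1) ^ d)" by (intro mult_le_mono) auto
    moreover have "3 * 1 \<le> 3 * (N + 1) ^ Suc d" by (intro mult_le_mono one_le_power) auto
    ultimately show ?thesis by (simp add: algebra_simps)
  qed
  then show ?case by blast
qed

lemma big_unused: "big c \<sigma> n \<sigma>' \<Longrightarrow> wf_com k c \<Longrightarrow> r \<ge> k \<Longrightarrow> \<sigma>' r = \<sigma> r"
proof (induction rule: big.induct)
  case (big_Prim p \<sigma>)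
  then show ?case using target_less[of k p] do_prim_other[of r p \<sigma>] by auto
qed (auto split: if_splits)

text \<open>Leaves only the output track, as is required for reading the final tape. Copying
  \<open>0\<close> to itself stands for an idle instruction.\<close>

fun clear_all :: "nat list \<Rightarrow> nat com" where
  "clear_all [] = Prim (Copy 0 0)"
| "clear_all (r # rs) = Seq (Prim (Clear r)) (clear_all rs)"

lemma big_clear_all: "big (clear_all rs) \<sigma> (2 * length rs + 1) (\<lambda>r. if r \<in> set rs then [] else \<sigma> r)"
proof (induction rs arbitrary: \<sigma>)
  case Nil
  have "\<sigma>(0 := \<sigma> 0) = \<sigma>" by simp
  then show ?case using big_Prim[of "Copy 0 0" \<sigma>] by simp
next
  case (Cons a rs)
  have "(\<lambda>r. if r \<in> set rs then [] else do_prim (Clear a) \<sigma> r) = (\<lambda>r. if r \<in> set (a # rs) then [] else \<sigma> r)" by auto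
  then show ?case using big_Seq[OF big_Prim[of "Clear a" \<sigma>] Cons.IH[of "do_prim (Clear a) \<sigma>"]] by simp
qed

lemma wf_clear_all: "0 < k \<Longrightarrow> \<forall>r\<in>set rs. r < k \<Longrightarrow> wf_com k (clear_all rs)"
  by (induction rs) auto

text \<open>Register 1 is the clock: its length is the number of iterations of every source-level loop.\<close>

definition start_store :: "nat list \<Rightarrow> store" where
  "start_store w = (\<lambda>_. [])(0 := w, 1 := w @ [1, 1])"

theorem poly_time_tm_of_program:
  assumes wf: "wf_src B c" and B: "1 < B"
  shows "\<exists>M. wf_tm M \<and> (\<exists>A d. \<forall>w. set w \<subseteq> {1..4} \<longrightarrow> (\<exists>t tp h. t \<le> A * (length w + 1) ^ d \<and>
     tm_run M t (init_config w) = (1, tp, h) \<and> tape_output tp (exec (length w + 2) c (start_store w) 0)))"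
proof -
  define k where "k = B + depth c"
  define pre :: "nat com" where "pre = Seq (Prim (Copy 0 1)) (Seq (Prim (Push 1 1)) (Prim (Push 1 1)))"
  define c' where "c' = Seq pre (Seq (compile B c) (clear_all [1..<k]))"
  have wfc: "wf_com k (compile B c)" using wf_compile[OF wf B, of k] by (simp add: k_def)
  have wf': "wf_com k c'" using wfc B wf_clear_all[of k "[1..<k]"] by (auto simp: c'_def pre_def k_def)
  have k0: "0 < k" using B by (simp add: k_def)
  obtain M where M: "wf_tm M" and sim: "\<And>w n \<sigma>. set w \<subseteq> {1..4} \<Longrightarrow> big c' (input_store w) n \<sigma> \<Longrightarrow> (\<forall>r. r \<noteq> 0 \<longrightarrow> \<sigma> r = []) \<Longrightarrow>
    (\<exists>t tp h. t \<le> 1 + n * (2 * (length w + n) + 5) \<and> tm_run M t (init_config w) = (1, tp, h) \<and> tape_output tp (\<sigma> 0))"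
    using tm_of_com[OF wf' k0] by blast
  obtain A d where A: "\<And>N. cost N c \<le> A * (N + 1) ^ d" using cost_poly by blast
  \<comment> \<open>\<open>3 ^ d\<close> comes from
    \<open>length w + 3 \<le> 3 * (length w + 1)\<close>; the summand \<open>2 * k + 8\<close>
    covers the set-up and the final clearing.\<close>
  define A' where "A' = A * 3 ^ d + 2 * k + 8"
  have "\<exists>t tp h. t \<le> (10 * A' * A') * (length w + 1) ^ (2 * d + 1) \<and>
     tm_run M t (init_config w) = (1, tp, h) \<and> tape_output tp (exec (length w + 2) c (start_store w) 0)"
    if w: "set w \<subseteq> {1..4}" for w
  proof -
    have pre: "big pre (input_store w) 5 (start_store w)"
    proof -
      have "do_prim (Push 1 1) (do_prim (Push 1 1) (do_prim (Copy 0 1) (input_store w))) = start_store w"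
        by (auto simp: input_store_def start_store_def)
      moreover have "1 + (1 + 1 + 1) + 1 = (5 :: nat)" by simp
      ultimately show ?thesis unfolding pre_def
        using big_Seq[OF big_Prim[of "Copy 0 1" "input_store w"] big_Seq[OF big_Prim big_Prim], of "Push 1 1" "Push 1 1"] by metis
    qed
    have "length (start_store w 1) = length w + 2" by (simp add: start_store_def)
    then obtain n \<sigma> where n: "big (compile B c) (start_store w) n \<sigma>" 
      "\<forall>r<B. \<sigma> r = exec (length w + 2) c (start_store w) r" "n \<le> cost (length w + 2) c"
      using compile_correct[OF wf B] by blast
    define \<sigma>' where "\<sigma>' = (\<lambda>r. if r \<in> set [1..<k] then [] else \<sigma> r)"
    define m where "m = 5 + (n + (2 * length [1..<k] + 1) + 1) + 1"
    have big: "big c' (input_store w) m \<sigma>'"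
      unfolding c'_def m_def \<sigma>'_def by (intro big_Seq[OF pre] big_Seq[OF n(1)] big_clear_all)
    have "\<forall>r. r \<noteq> 0 \<longrightarrow> \<sigma>' r = []"
    proof (intro allI impI)
      fix r :: nat assume "r \<noteq> 0"
      moreover have "\<sigma> r = start_store w r" if "r \<ge> k" using big_unused[OF n(1) wfc that] .
      ultimately show "\<sigma>' r = []" using B by (auto simp: \<sigma>'_def start_store_def k_def)
    qed
    from sim[OF w big this] obtain t tp h where t: "t \<le> 1 + m * (2 * (length w + m) + 5)"
      "tm_run M t (init_config w) = (1, tp, h)" "tape_output tp (\<sigma>' 0)" by blast
    have "\<sigma>' 0 = exec (length w + 2) c (start_store w) 0" using n(2) B by (simp add: \<sigma>'_def)
    moreover have "t \<le> (10 * A' * A') * (length w + 1) ^ (2 * d + 1)"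
    proof -
      define L where "L = length w + 1"
      define P where "P = A' * L ^ d"
      have L1: "1 \<le> L" by (simp add: L_def)
      have "n \<le> A * (length w + 3) ^ d" using n(3) A[of "length w + 2"] by (simp add: numeral_3_eq_3)
      also have "(length w + 3) ^ d \<le> (3 * L) ^ d" by (intro power_mono) (auto simp: L_def)
      finally have n': "n \<le> A * 3 ^ d * L ^ d" by (simp add: power_mult_distrib)
      have Ld: "1 \<le> L ^ d" using L1 by simp
      have "m \<le> n + (2 * k + 8)" by (simp add: m_def)
      also have "2 * k + 8 \<le> (2 * k + 8) * L ^ d" using Ld by simp
      finally have mP: "m \<le> P" using n' by (simp add: P_def A'_def add_mult_distrib)
      have P1: "1 \<le> P" using Ld by (simp add: P_def A'_def)
      have LP: "L \<le> L * P" "P \<le> L * P" "1 \<le> L * P" using L1 P1 by auto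
      have "t \<le> 1 + P * (2 * (L + P) + 5)"
        using t(1) mult_le_mono[OF mP, of "2 * (length w + m) + 5" "2 * (L + P) + 5"] mP by (simp add: L_def)
      \<comment> \<open>Each of \<open>L\<close>, \<open>P\<close> and \<open>1\<close> is at most
        \<open>L * P\<close>, hence \<open>9 = 2 + 2 + 5\<close>; the leading \<open>1\<close> makes
        the factor \<open>10\<close>.\<close>
      also have "\<dots> \<le> P * (L * P) + P * (9 * (L * P))"
      proof (intro add_mono mult_le_mono2)
        show "1 \<le> P * (L * P)" using L1 P1 by simp
        have "L \<le> x \<Longrightarrow> P \<le> x \<Longrightarrow> 1 \<le> x \<Longrightarrow> 2 * (L + P) + 5 \<le> 9 * x" for x by simp
        then show "2 * (L + P) + 5 \<le> 9 * (L * P)" using LP by blast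
      qed
      also have "\<dots> = 10 * A' * A' * L ^ (2 * d + 1)" by (simp add: P_def power_add power2_eq_square mult_2)
      finally show ?thesis by (simp add: L_def)
    qed
    ultimately show ?thesis using t by (intro exI[of _ t] exI[of _ tp] exI[of _ h]) simp
  qed
  then show ?thesis using M by blast
qed

section \<open>Locally optimal cyclic arrangements\<close>

definition junctions :: "'b list \<Rightarrow> ('b \<times> 'b) list" where
  "junctions xs = zip xs (rotate1 xs)"

definition steps :: "'b list \<Rightarrow> ('b \<times> 'b) list" where
  "steps xs = zip xs (tl xs)"

definition cnt :: "('b \<Rightarrow> bool) \<Rightarrow> 'b list \<Rightarrow> nat" where
  "cnt P xs = length (filter P xs)"

lemma cnt_simps [simp]: "cnt P [] = 0" "cnt P (x # xs) = of_bool (P x) + cnt P xs" "cnt P (xs @ ys) = cnt P xs + cnt P ys"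
  by (auto simp: cnt_def)

lemma cnt_mset: "mset xs = mset ys \<Longrightarrow> cnt P xs = cnt P ys"
  unfolding cnt_def by (metis mset_filter size_mset)

lemma cnt_pos: "x \<in> set xs \<Longrightarrow> P x \<Longrightarrow> 0 < cnt P xs"
  by (auto simp: cnt_def filter_empty_conv)

lemma cnt_0: "cnt P xs = 0 \<longleftrightarrow> (\<forall>x\<in>set xs. \<not> P x)"
  by (auto simp: cnt_def filter_empty_conv)

lemma cnt_mono: "(\<And>x. x \<in> set xs \<Longrightarrow> P x \<Longrightarrow> Q x) \<Longrightarrow> cnt P xs \<le> cnt Q xs"
  by (induction xs) (auto simp: of_bool_def)

lemma cnt_cong: "(\<And>x. x \<in> set xs \<Longrightarrow> P x = Q x) \<Longrightarrow> cnt P xs = cnt Q xs"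
  unfolding cnt_def by (metis filter_cong)

lemma cnt_map: "cnt P (map f xs) = cnt (\<lambda>x. P (f x)) xs"
  by (simp add: cnt_def filter_map comp_def)

lemma cnt_disjoint:
  "(\<And>x. x \<in> set xs \<Longrightarrow> R x \<longleftrightarrow> P x \<or> Q x) \<Longrightarrow> (\<And>x. x \<in> set xs \<Longrightarrow> \<not> (P x \<and> Q x)) \<Longrightarrow>
   cnt P xs + cnt Q xs = cnt R xs"
  by (induction xs) (auto simp: of_bool_def)

lemma steps_append: "xs \<noteq> [] \<Longrightarrow> ys \<noteq> [] \<Longrightarrow> steps (xs @ ys) = steps xs @ (last xs, hd ys) # steps ys"
proof (induction xs)
  case (Cons x xs)
  then show ?case by (cases xs; cases ys) (auto simp: steps_def)
qed simp

lemma junctions_steps: "xs \<noteq> [] \<Longrightarrow> junctions xs = steps xs @ [(last xs, hd xs)]"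
proof -
  assume "xs \<noteq> []"
  then have "steps (xs @ [hd xs]) = steps xs @ [(last xs, hd xs)]"
    using steps_append[of xs "[hd xs]"] by (simp add: steps_def)
  moreover have "steps (xs @ [hd xs]) = junctions xs"
    using \<open>xs \<noteq> []\<close> by (cases xs) (auto simp: steps_def junctions_def zip_append1 simp flip: append_Cons)
  ultimately show ?thesis by simp
qed

lemma junctions_append: "xs \<noteq> [] \<Longrightarrow> ys \<noteq> [] \<Longrightarrow>
    junctions (xs @ ys) = steps xs @ (last xs, hd ys) # steps ys @ [(last ys, hd xs)]"
  by (simp add: junctions_steps steps_append)

text \<open>Cutting a cycle at another place only changes which junction is the wrap-around.\<close>

lemma mset_junctions_swap: "mset (junctions (xs @ ys)) = mset (junctions (ys @ xs))"
  by (cases "xs = []"; cases "ys = []") (auto simp: junctions_append)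

lemma mset_junctions_rotate: "mset (junctions (rotate n xs)) = mset (junctions xs)"
  unfolding rotate_drop_take by (metis append_take_drop_id mset_junctions_swap)

lemma fst_junctions: "map fst (junctions xs) = xs"
  by (simp add: junctions_def)

lemma snd_junctions: "map snd (junctions xs) = rotate1 xs"
  by (simp add: junctions_def)

text \<open>A list is read as a cyclic arrangement of arcs, the arc \<open>y\<close> leading from vertex \<open>s y\<close> to \<open>e y\<close>.\<close>

definition score :: "('b \<Rightarrow> 'v) \<Rightarrow> ('b \<Rightarrow> 'v) \<Rightarrow> 'b list \<Rightarrow> nat" where
  "score s e xs = cnt (\<lambda>(a, b). e a = s b) (junctions xs)"

text \<open>A break is charged to the vertex where the arc after it starts, so that breaks can be
  counted vertex by vertex.\<close>

definition breaks_in :: "('b \<Rightarrow> 'v) \<Rightarrow> ('b \<Rightarrow> 'v) \<Rightarrow> 'v set \<Rightarrow> 'b list \<Rightarrow> nat" where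
  "breaks_in s e V xs = cnt (\<lambda>(a, b). e a \<noteq> s b \<and> s b \<in> V) (junctions xs)"

lemma score_rotate: "score s e (rotate n xs) = score s e xs"
  unfolding score_def by (rule cnt_mset[OF mset_junctions_rotate])

lemma breaks_in_rotate: "breaks_in s e V (rotate n xs) = breaks_in s e V xs"
  unfolding breaks_in_def by (rule cnt_mset[OF mset_junctions_rotate])

lemma set_junctions: "(a, b) \<in> set (junctions xs) \<Longrightarrow> a \<in> set xs \<and> b \<in> set xs"
  by (auto simp: junctions_def dest: set_zip_leftD set_zip_rightD)

lemma score_breaks: "score s e xs + breaks_in s e (s ` set xs) xs = length xs"
proof -
  have "score s e xs + breaks_in s e (s ` set xs) xs = cnt (\<lambda>_. True) (junctions xs)"
    unfolding score_def breaks_in_def by (rule cnt_disjoint) (auto dest: set_junctions)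
  then show ?thesis by (simp add: cnt_def junctions_def)
qed

lemma breaks_in_sum:
  assumes "finite V"
  shows "breaks_in s e V xs = (\<Sum>v\<in>V. breaks_in s e {v} xs)"
  using assms
proof (induction V rule: finite_induct)
  case empty
  then show ?case by (simp add: breaks_in_def cnt_0)
next
  case (insert v V)
  have "breaks_in s e {v} xs + breaks_in s e V xs = breaks_in s e (insert v V) xs"
    unfolding breaks_in_def using insert.hyps by (intro cnt_disjoint) auto
  then show ?case using insert by simp
qed

lemma breaks_in_mono: "V \<subseteq> W \<Longrightarrow> breaks_in s e V xs \<le> breaks_in s e W xs"
  unfolding breaks_in_def by (rule cnt_mono) auto

text \<open>An arc leaving \<open>v\<close> comes either after a break or after an arc ending in
  \<open>v\<close>. Together with \<open>good_le_in\<close> this is the Eulerian lower bound,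
  out-degree minus in-degree, on the breaks at \<open>v\<close>.\<close>

lemma breaks_at: 
  "breaks_in s e {v} xs + cnt (\<lambda>(a, b). e a = v \<and> s b = v) (junctions xs) = cnt (\<lambda>b. s b = v) xs"
proof -
  have "breaks_in s e {v} xs + cnt (\<lambda>(a, b). e a = v \<and> s b = v) (junctions xs) = cnt (\<lambda>p. s (snd p) = v) (junctions xs)"
    unfolding breaks_in_def by (rule cnt_disjoint) auto
  also have "\<dots> = cnt (\<lambda>b. s b = v) (rotate1 xs)" by (simp add: cnt_map flip: snd_junctions)
  also have "\<dots> = cnt (\<lambda>b. s b = v) xs" by (rule cnt_mset) (cases xs; simp)
  finally show ?thesis .
qed

lemma good_le_in: "cnt (\<lambda>(a, b). e a = v \<and> s b = v) (junctions xs) \<le> cnt (\<lambda>a. e a = v) xs"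
proof -
  have "cnt (\<lambda>(a, b). e a = v \<and> s b = v) (junctions xs) \<le> cnt (\<lambda>p. e (fst p) = v) (junctions xs)"
    by (rule cnt_mono) auto
  also have "\<dots> = cnt (\<lambda>a. e a = v) (map fst (junctions xs))" by (simp add: cnt_map)
  finally show ?thesis by (simp add: fst_junctions)
qed

text \<open>The case of equality: if no arc into \<open>v\<close> is followed by a break, the lower
  bound at \<open>v\<close> is attained.\<close>

lemma good_eq_in:
  assumes "\<And>a b. (a, b) \<in> set (junctions xs) \<Longrightarrow> e a = v \<Longrightarrow> s b = v"
  shows "cnt (\<lambda>(a, b). e a = v \<and> s b = v) (junctions xs) = cnt (\<lambda>a. e a = v) xs"
proof -
  have "cnt (\<lambda>(a, b). e a = v \<and> s b = v) (junctions xs) = cnt (\<lambda>p. e (fst p) = v) (junctions xs)"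
    using assms by (intro cnt_cong) auto
  also have "\<dots> = cnt (\<lambda>a. e a = v) (map fst (junctions xs))" by (simp add: cnt_map)
  finally show ?thesis by (simp add: fst_junctions)
qed

section \<open>Cutting and rotating cyclic arrangements\<close>

lemma steps_split:
  assumes "(a, b) \<in> set (steps xs)"
  obtains xs1 xs2 where "xs = xs1 @ xs2" "xs1 \<noteq> []" "xs2 \<noteq> []" "last xs1 = a" "hd xs2 = b"
proof -
  obtain i where i: "i < length (tl xs)" "a = xs ! i" "b = tl xs ! i"
    using assms by (auto simp: steps_def set_zip)
  have "last (take (Suc i) xs) = a" "hd (drop (Suc i) xs) = b"
    using i by (auto simp: take_Suc_conv_app_nth hd_drop_conv_nth nth_tl)
  then show ?thesis using that[of "take (Suc i) xs" "drop (Suc i) xs"] i by (cases xs) auto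
qed

lemma junctions_split:
  assumes "(a, b) \<in> set (junctions xs)"
  obtains r where "rotate r xs \<noteq> []" "last (rotate r xs) = a" "hd (rotate r xs) = b"
proof -
  have ne: "xs \<noteq> []" using assms by (auto simp: junctions_def)
  show ?thesis
  proof (cases "(a, b) = (last xs, hd xs)")
    case True
    then show ?thesis using that[of 0] ne by simp
  next
    case False
    then have "(a, b) \<in> set (steps xs)" using assms ne by (auto simp: junctions_steps)
    then obtain xs1 xs2 where x: "xs = xs1 @ xs2" "xs1 \<noteq> []" "xs2 \<noteq> []" "last xs1 = a" "hd xs2 = b"
      by (rule steps_split)
    then show ?thesis using that[of "length xs1"] by (simp add: rotate_append)
  qed
qed

text \<open>A walk once around the cycle, starting at \<open>y\<close>, has to enter
  \<open>P\<close> somewhere. The list is rotated to start at \<open>y\<close> so that the entry is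
  not the wrap-around junction.\<close>

lemma junctions_switch:
  assumes "x \<in> set xs" "P x" "y \<in> set xs" "\<not> P y"
  obtains a b where "(a, b) \<in> set (junctions xs)" "\<not> P a" "P b"
proof -
  obtain xs1 xs2 where xs: "xs = xs1 @ y # xs2" using split_list[OF assms(3)] by blast
  define Y where "Y = y # xs2 @ xs1"
  have jY: "set (junctions Y) = set (junctions xs)"
    using mset_junctions_swap[of xs1 "y # xs2"] unfolding xs Y_def by (metis append_Cons set_mset_mset)
  define A B where "A = takeWhile (\<lambda>z. \<not> P z) Y" and "B = dropWhile (\<lambda>z. \<not> P z) Y"
  have AB: "Y = A @ B" by (simp add: A_def B_def)
  have A: "A \<noteq> []" using assms(4) by (simp add: A_def Y_def)
  have "x \<in> set Y" using assms(1) by (auto simp: xs Y_def)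
  then have B: "B \<noteq> []" using assms(2) by (auto simp: B_def dropWhile_eq_Nil_conv)
  have "P (hd B)" using hd_dropWhile[of "\<lambda>z. \<not> P z" Y] B by (simp add: B_def)
  moreover have "\<not> P (last A)" using A set_takeWhileD[of "last A" "\<lambda>z. \<not> P z" Y] by (simp add: A_def)
  moreover have "(last A, hd B) \<in> set (junctions xs)" using junctions_append[OF A B] unfolding jY[symmetric] AB by simp
  ultimately show ?thesis using that by blast
qed

lemma steps_rotate_closed:
  assumes "T \<noteq> []" "\<forall>(a, b)\<in>set (junctions T). e a = s b" "c \<in> set T"
  obtains p T' where "rotate p T = c # T'" "\<forall>(a, b)\<in>set (junctions (c # T')). e a = s b"
proof -
  obtain T1 T2 where T: "T = T1 @ c # T2" using split_list[OF assms(3)] by blast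
  then have r: "rotate (length T1) T = c # T2 @ T1" by (simp add: rotate_append)
  moreover have "set (junctions (c # T2 @ T1)) = set (junctions T)"
    using mset_junctions_rotate[of "length T1" T] r by (metis set_mset_mset)
  ultimately show ?thesis using that assms(2) by simp
qed

definition locally_optimal :: "('b \<Rightarrow> 'v) \<Rightarrow> ('b \<Rightarrow> 'v) \<Rightarrow> 'b list \<Rightarrow> bool" where
  "locally_optimal s e ys \<longleftrightarrow> (\<forall>r T E p q. rotate r ys = T @ E \<longrightarrow> T \<noteq> [] \<longrightarrow> E \<noteq> [] \<longrightarrow>
     score s e (rotate p T @ rotate q E) \<le> score s e ys)"

text \<open>If \<open>T\<close> ends where it starts but has an inner break, rotating
  \<open>T\<close> to that break gains the junction from its last to its first arc. Nothing is lost,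
  as the junctions with \<open>E\<close> were breaks already.\<close>

lemma closed_trail_of_breaks:
  assumes lo: "locally_optimal s e ys" and r: "rotate r ys = T @ E" "T \<noteq> []" "E \<noteq> []"
    and cl: "e (last T) = s (hd T)" and brk: "e (last T) \<noteq> s (hd E)" "e (last E) \<noteq> s (hd T)"
  shows "\<forall>(a, b)\<in>set (junctions T). e a = s b"
proof (rule ccontr)
  let ?g = "\<lambda>(a, b). e a = s b"
  assume "\<not> ?thesis"
  then obtain a b where ab: "(a, b) \<in> set (junctions T)" "e a \<noteq> s b" by auto
  then have "(a, b) \<in> set (steps T)" using cl r by (auto simp: junctions_steps)
  then obtain T1 T2 where T: "T = T1 @ T2" "T1 \<noteq> []" "T2 \<noteq> []" and l: "last T1 = a" "hd T2 = b"
    by (rule steps_split)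
  have "score s e ys = score s e (T @ E)" using score_rotate r by metis
  also have "\<dots> = cnt ?g (steps T1) + cnt ?g (steps T2) + cnt ?g (steps E)"
    using brk ab l T r by (simp add: score_def junctions_append steps_append)
  also have "\<dots> < score s e ((T2 @ T1) @ E)"
    using T cl r by (simp add: score_def junctions_append steps_append del: append_assoc)
  also have "T2 @ T1 = rotate (length T1) T" using T by (simp add: rotate_append)
  finally show False using lo r unfolding locally_optimal_def by (metis leD rotate0 id_apply)
qed

text \<open>Otherwise the closed trail could be spliced into \<open>E\<close>: opened at
  \<open>c\<close> and put next to \<open>d\<close>, it keeps all its inner junctions and gains one,
  while \<open>E\<close> keeps its cyclic score.\<close>

lemma closed_trail_isolated:
  assumes lo: "locally_optimal s e ys" and r: "rotate r ys = T @ E" "T \<noteq> []" "E \<noteq> []"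
    and cl: "\<forall>(a, b)\<in>set (junctions T). e a = s b" and brk: "e (last T) \<noteq> s (hd E)" "e (last E) \<noteq> s (hd T)"
    and c: "c \<in> set T" and d: "d \<in> set E"
  shows "e d \<noteq> s c" "e c \<noteq> s d"
proof -
  let ?g = "\<lambda>(a, b). e a = s b"
  have all: "cnt ?g ps = length ps" if "\<forall>(a, b)\<in>set ps. e a = s b" for ps
    unfolding cnt_def using that by (subst filter_True) auto
  have sl: "length (steps xs) = length xs - 1" for xs :: "'a list" by (simp add: steps_def)
  have "cnt ?g (steps T) = length T - 1" using all[of "steps T"] cl r by (simp add: junctions_steps sl)
  then have old: "score s e ys = length T - 1 + cnt ?g (steps E)"
    using brk r score_rotate[of s e r ys] by (simp add: score_def junctions_append)
  have eE: "cnt ?g (steps E) \<le> score s e E" using r by (simp add: score_def junctions_steps)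
  show "e d \<noteq> s c"
  proof
    assume dc: "e d = s c"
    obtain p T' where p: "rotate p T = c # T'" "\<forall>(a, b)\<in>set (junctions (c # T')). e a = s b"
      using steps_rotate_closed[OF r(2) cl c] .
    obtain E1 E2 where E: "E = E1 @ d # E2" using split_list[OF d] by blast
    define E' where "E' = E2 @ E1 @ [d]"
    have E': "rotate (Suc (length E1)) E = E'" using rotate_append[of "E1 @ [d]" E2] by (simp add: E E'_def)
    have E'ne: "E' \<noteq> []" "last E' = d" by (auto simp: E'_def)
    have sc: "score s e E' = score s e E" using score_rotate E' by metis
    have lc: "e (last (c # T')) = s c" using p(2) by (simp add: junctions_steps)
    have len: "length (c # T') = length T" using p(1) by (metis length_rotate)
    have "cnt ?g (steps (c # T')) = length T - 1"
      using all[of "steps (c # T')"] p(2) len by (simp add: junctions_steps sl)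
    then have "score s e ((c # T') @ E') = length T - 1 + of_bool (e (last (c # T')) = s (hd E')) + cnt ?g (steps E') + of_bool (e d = s c)"
      using E'ne by (simp add: score_def junctions_append del: append_Cons)
    \<comment> \<open>The opened trail ends where \<open>d\<close> ends, so its junction to the head
      of \<open>E'\<close> takes the place of the closing junction of \<open>E'\<close>. The
      junction from \<open>d\<close> to \<open>c\<close> is the gain.\<close>
    also have "\<dots> = length T - 1 + score s e E' + 1"
      using E'ne dc lc by (simp add: score_def junctions_steps)
    finally have "score s e ys < score s e (rotate p T @ rotate (Suc (length E1)) E)"
      using old eE sc p(1) E' by simp
    then show False using lo r unfolding locally_optimal_def by (metis leD)
  qed
  show "e c \<noteq> s d"
  proof
    assume cd: "e c = s d"
    obtain p T' where p: "rotate p T = c # T'" "\<forall>(a, b)\<in>set (junctions (c # T')). e a = s b"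
      using steps_rotate_closed[OF r(2) cl c] .
    have T'': "rotate (Suc p) T = T' @ [c]" using p(1) by simp
    have jT: "\<forall>(a, b)\<in>set (junctions (T' @ [c])). e a = s b"
      using p(2) mset_junctions_swap[of "[c]" T'] by (metis append_Cons append_Nil set_mset_mset)
    obtain E1 E2 where E: "E = E1 @ d # E2" using split_list[OF d] by blast
    define E' where "E' = d # E2 @ E1"
    have E': "rotate (length E1) E = E'" using rotate_append[of E1 "d # E2"] by (simp add: E E'_def)
    have E'ne: "E' \<noteq> []" "hd E' = d" by (auto simp: E'_def)
    have sc: "score s e E' = score s e E" using score_rotate E' by metis
    have lc: "e c = s (hd (T' @ [c]))" using jT by (simp add: junctions_steps)
    have len: "length (T' @ [c]) = length T" using T'' by (metis length_rotate)
    have "cnt ?g (steps (T' @ [c])) = length T - 1"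
      using all[of "steps (T' @ [c])"] jT len by (simp add: junctions_steps sl)
    then have "score s e ((T' @ [c]) @ E') = length T - 1 + of_bool (e c = s d) + cnt ?g (steps E') + of_bool (e (last E') = s (hd (T' @ [c])))"
      using E'ne by (simp add: score_def junctions_append del: append_assoc)
    \<comment> \<open>Mirror image: the opened trail starts where \<open>d\<close> starts, so the
      last arc of \<open>E'\<close> meets it exactly if it met \<open>d\<close>.\<close>
    also have "\<dots> = length T - 1 + score s e E' + 1"
      using E'ne cd lc by (simp add: score_def junctions_steps)
    finally have "score s e ys < score s e (rotate (Suc p) T @ rotate (length E1) E)"
      using old eE sc T'' E' by simp
    then show False using lo r unfolding locally_optimal_def by (metis leD)
  qed
qed

text \<open>
  The breaks are compared on each weakly connected component of the arc graph separately. Either the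
  number of breaks before arcs leaving a vertex \<open>v\<close> is the excess of the out-degree over the in-degree
  of \<open>v\<close>, a lower bound for every arrangement, or the component is covered by a single closed trail,
  where one break is unavoidable as soon as there are other arcs.
\<close>

theorem locally_optimal_imp_optimal:
  assumes lo: "locally_optimal s e ys" and zs: "mset zs = mset ys"
  shows "score s e zs \<le> score s e ys"
proof -
  have sz: "set zs = set ys" using zs by (metis set_mset_mset)
  have lz: "length zs = length ys" using zs by (metis size_mset)
  define V where "V = s ` set ys"
  have fV: "finite V" by (simp add: V_def)
  define inv where "inv U \<longleftrightarrow> (\<forall>y\<in>set ys. s y \<in> U \<longleftrightarrow> e y \<in> U)" for U
  \<comment> \<open>\<open>K v = K w\<close> iff \<open>v\<close> and \<open>w\<close> lie in the same component\<close>
  define K where "K v = {U. inv U \<and> v \<in> U}" for v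
  have Kse: "K (s y) = K (e y)" if "y \<in> set ys" for y using that by (auto simp: K_def inv_def)
  let ?b = "\<lambda>xs v. breaks_in s e {v} xs"
  have cls: "(\<Sum>v | v \<in> V \<and> K v = k. ?b ys v) \<le> (\<Sum>v | v \<in> V \<and> K v = k. ?b zs v)" for k
  proof (cases "\<forall>v. v \<in> V \<and> K v = k \<longrightarrow> ?b ys v \<le> ?b zs v")
    case True
    then show ?thesis by (intro sum_mono) auto
  next
    case False
    define C where "C = {v. v \<in> V \<and> K v = k}"
    have fC: "finite C" using fV by (simp add: C_def)
    obtain v where v: "v \<in> V" "K v = k" and lt: "?b zs v < ?b ys v" using False by (auto simp: not_le)
    then have "0 < ?b ys v" by simp
    then obtain a b where ab: "(a, b) \<in> set (junctions ys)" "e a \<noteq> s b" "s b = v"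
      unfolding breaks_in_def by (auto simp: cnt_0 simp flip: neq0_conv)
    \<comment> \<open>Otherwise \<open>ys\<close> would attain the lower bound at \<open>v\<close>,
      contradicting \<open>lt\<close>.\<close>
    have "\<exists>a' b'. (a', b') \<in> set (junctions ys) \<and> e a' = v \<and> s b' \<noteq> v"
    proof (rule ccontr)
      assume "\<not> ?thesis"
      then have "cnt (\<lambda>(a, b). e a = v \<and> s b = v) (junctions ys) = cnt (\<lambda>a. e a = v) ys"
        by (intro good_eq_in) auto
      moreover have "cnt (\<lambda>a. e a = v) ys = cnt (\<lambda>a. e a = v) zs" "cnt (\<lambda>a. s a = v) ys = cnt (\<lambda>a. s a = v) zs"
        using cnt_mset zs by metis+
      ultimately show False
        using breaks_at[of s e v ys] breaks_at[of s e v zs] good_le_in[of e v s zs] lt by linarith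
    qed
    then obtain a' b' where ab': "(a', b') \<in> set (junctions ys)" "e a' = v" "s b' \<noteq> v" by blast
    obtain r where r: "rotate r ys \<noteq> []" "last (rotate r ys) = a" "hd (rotate r ys) = b"
      using junctions_split[OF ab(1)] by blast
    have "(a', b') \<in> set (junctions (rotate r ys))"
      using ab'(1) mset_junctions_rotate[of r ys] by (metis set_mset_mset)
    \<comment> \<open>After the rotation the break before \<open>b\<close> is the wrap-around. As
      \<open>s b' \<noteq> v = s b\<close>, the break after \<open>a'\<close> is an inner one; the
      two cut out a trail from \<open>b\<close> to \<open>a'\<close> that starts and ends at
      \<open>v\<close>.\<close>
    then have "(a', b') \<in> set (steps (rotate r ys))" using junctions_steps[OF r(1)] r ab ab' by auto
    then obtain T E where TE: "rotate r ys = T @ E" "T \<noteq> []" "E \<noteq> []" "last T = a'" "hd E = b'"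
      by (rule steps_split)
    have hT: "hd T = b" "last E = a" using r TE by auto
    have cl: "\<forall>(a, b)\<in>set (junctions T). e a = s b"
      using closed_trail_of_breaks[OF lo TE(1-3)] hT TE(4,5) ab ab' by simp
    have iso: "e d \<noteq> s c" "e c \<noteq> s d" if "c \<in> set T" "d \<in> set E" for c d
      using closed_trail_isolated[OF lo TE(1-3) cl _ _ that] hT TE(4,5) ab ab' by auto
    have sety: "set ys = set T \<union> set E" using TE(1) by (metis set_append set_rotate)
    define W where "W = s ` set T"
    have eW: "e c \<in> W" if "c \<in> set T" for c
    proof -
      have "c \<in> set (map fst (junctions T))" using that by (simp add: fst_junctions)
      then obtain x where "(c, x) \<in> set (junctions T)" by auto
      then show ?thesis using cl set_junctions[of c x T] by (auto simp: W_def)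
    qed
    have We: "\<exists>c'\<in>set T. e c' = s c" if "c \<in> set T" for c
    proof -
      have "c \<in> set (map snd (junctions T))" using that by (simp add: snd_junctions)
      then obtain x where "(x, c) \<in> set (junctions T)" by auto
      then show ?thesis using cl set_junctions[of x c T] by auto
    qed
    have sE: "s d \<notin> W" if "d \<in> set E" for d using We iso(2) that by (fastforce simp: W_def)
    have eE: "e d \<notin> W" if "d \<in> set E" for d using iso(1) that by (fastforce simp: W_def)
    have "s c \<in> W" if "c \<in> set T" for c using that by (simp add: W_def)
    then have invW: "inv W" using eW sE eE sety by (auto simp: inv_def)
    have bT: "b \<in> set T" "b' \<in> set E" using hT TE by auto
    have vW: "v \<in> W" using bT ab by (auto simp: W_def)
    \<comment> \<open>\<open>W\<close> is an invariant set containing \<open>v\<close>, so it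
      contains the whole component of \<open>v\<close>.\<close>
    have "C \<subseteq> W" using vW invW v by (auto simp: C_def K_def)
    then have "breaks_in s e C ys \<le> breaks_in s e W (T @ E)"
      using breaks_in_mono breaks_in_rotate TE(1) by metis
    also have "\<dots> \<le> 1"
    proof -
      have "cnt (\<lambda>(a, b). e a \<noteq> s b \<and> s b \<in> W) (steps T) = 0"
        using cl by (auto simp: cnt_0 junctions_steps[OF TE(2)])
      moreover have "cnt (\<lambda>(a, b). e a \<noteq> s b \<and> s b \<in> W) (steps E) = 0"
        using sE set_junctions[of _ _ E] by (auto simp: cnt_0 junctions_steps[OF TE(3)])
      moreover have "s (hd E) \<notin> W" using sE TE(3) by simp
      ultimately show ?thesis unfolding breaks_in_def by (simp add: junctions_append[OF TE(2,3)])
    qed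
    \<comment> \<open>Arcs lie both inside and outside the component, so \<open>zs\<close> has to
      enter it somewhere. Since an arc never changes the component, the entering junction is a
      break.\<close>
    also have "1 \<le> breaks_in s e C zs"
    proof -
      have "K (s b) = k" using ab v by simp
      moreover have "K (s b') \<noteq> k" using sE[OF bT(2)] vW invW v by (auto simp: K_def)
      ultimately obtain x y where xy: "(x, y) \<in> set (junctions zs)" "K (s x) \<noteq> k" "K (s y) = k"
        using junctions_switch[of b zs "\<lambda>y. K (s y) = k" b'] bT sz sety by auto
      have "x \<in> set ys" "y \<in> set ys" using set_junctions[OF xy(1)] sz by auto
      then have "e x \<noteq> s y" "s y \<in> C" using Kse xy by (auto simp: C_def V_def)
      then show ?thesis unfolding breaks_in_def using cnt_pos[OF xy(1), of "\<lambda>(a, b). e a \<noteq> s b \<and> s b \<in> C"] by simp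
    qed
    finally show ?thesis using breaks_in_sum[OF fC, of s e] by (simp add: C_def)
  qed
  \<comment> \<open>Single vertices need not compare favourably; only the totals over components do,
    hence the grouping by \<open>K\<close>.\<close>
  have "breaks_in s e V ys = (\<Sum>k\<in>K ` V. \<Sum>v | v \<in> V \<and> K v = k. ?b ys v)"
    unfolding breaks_in_sum[OF fV] by (rule sum.image_gen[OF fV])
  also have "\<dots> \<le> (\<Sum>k\<in>K ` V. \<Sum>v | v \<in> V \<and> K v = k. ?b zs v)"
    by (intro sum_mono cls)
  also have "\<dots> = breaks_in s e V zs" 
    unfolding breaks_in_sum[OF fV] by (rule sum.image_gen[OF fV, symmetric])
  finally show ?thesis
    using score_breaks[of s e ys] score_breaks[of s e zs] by (simp add: V_def sz lz)
qed

section \<open>Encodings and basic programs\<close>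

declare enc_nat.simps [simp del]

lemma enc_nat_0 [simp]: "enc_nat 0 = []"
  by (simp add: enc_nat.simps)

lemma enc_nat_pos: "n > 0 \<Longrightarrow> enc_nat n = (n mod 2 + 1) # enc_nat (n div 2)"
  by (subst enc_nat.simps) simp

lemma enc_nat_symbols: "set (enc_nat n) \<subseteq> {1, 2}"
proof (induction n rule: less_induct)
  case (less n)
  then show ?case by (cases "n = 0") (auto simp: enc_nat_pos)
qed

lemma enc_nat_inj: "enc_nat m = enc_nat n \<Longrightarrow> m = n"
proof (induction m arbitrary: n rule: less_induct)
  case (less m)
  show ?case
  proof (cases "m = 0 \<or> n = 0")
    case True
    then show ?thesis using less.prems by (cases "m = 0"; cases "n = 0") (auto simp: enc_nat_pos)
  next
    case False
    then have "m mod 2 = n mod 2" "enc_nat (m div 2) = enc_nat (n div 2)"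
      using less.prems by (auto simp: enc_nat_pos)
    moreover have "m div 2 < m" using False by simp
    ultimately show ?thesis using less.IH by (metis div_mult_mod_eq)
  qed
qed

lemma length_enc_nat: "length (enc_nat n) \<le> n"
proof (induction n rule: less_induct)
  case (less n)
  show ?case
  proof (cases "n = 0")
    case False
    then have "length (enc_nat (n div 2)) \<le> n div 2" using less by simp
    moreover have "n div 2 < n" using False by simp
    ultimately show ?thesis using False by (simp add: enc_nat_pos)
  qed simp
qed

lemma enc_word_simps [simp]: "enc_word [] = []" "enc_word (c # w) = enc_nat c @ 3 # enc_word w"
  "enc_word (v @ w) = enc_word v @ enc_word w"
  by (auto simp: enc_word_def)

lemma enc_words_simps [simp]: "enc_words [] = []" "enc_words (w # ws) = enc_word w @ 4 # enc_words ws"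
  "enc_words (vs @ ws) = enc_words vs @ enc_words ws"
  by (auto simp: enc_words_def)

lemma enc_word_symbols: "set (enc_word w) \<subseteq> {1..3}"
  using enc_nat_symbols by (induction w) fastforce+

lemma enc_words_symbols: "set (enc_words ws) \<subseteq> {1..4}"
  using enc_word_symbols by (induction ws) fastforce+

lemma enc_word_Nil_iff [simp]: "enc_word w = [] \<longleftrightarrow> w = []"
  by (cases w) auto

lemma enc_words_Nil_iff [simp]: "enc_words ws = [] \<longleftrightarrow> ws = []"
  by (cases ws) auto

lemma append_sep_inj: "u @ a # x = v @ a # y \<Longrightarrow> a \<notin> set u \<Longrightarrow> a \<notin> set v \<Longrightarrow> u = v \<and> x = y"
proof (induction u arbitrary: v)
  case Nil
  then show ?case by (cases v) auto
next
  case (Cons b u)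
  then show ?case by (cases v) auto
qed

lemma enc_word_inj: "enc_word v = enc_word w \<Longrightarrow> v = w"
proof (induction v arbitrary: w)
  case Nil
  then show ?case by (metis enc_word_Nil_iff)
next
  case (Cons c v)
  then obtain d w' where w: "w = d # w'" by (metis enc_word_Nil_iff list.exhaust)
  have "3 \<notin> set (enc_nat x)" for x using enc_nat_symbols[of x] by auto
  then have "enc_nat c = enc_nat d \<and> enc_word v = enc_word w'"
    using Cons.prems append_sep_inj[of "enc_nat c" 3 "enc_word v" "enc_nat d" "enc_word w'"] by (simp add: w)
  then show ?case using Cons.IH enc_nat_inj w by blast
qed

lemma length_le_enc_words: "length ws \<le> length (enc_words ws)"
  by (induction ws) auto

lemma length_enc_words_mset: "mset vs = mset ws \<Longrightarrow> length (enc_words vs) = length (enc_words ws)"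
proof -
  have "length (enc_words xs) = (\<Sum>w\<in>#mset xs. length (enc_word w) + 1)" for xs
    by (induction xs) auto
  then show "mset vs = mset ws \<Longrightarrow> ?thesis" by simp
qed

text \<open>Pads a loop to exactly \<open>N\<close> iterations: it suffices to know the result after
  \<open>k\<close> iterations and that the body is idle from then on.\<close>

lemma funpow_fixpoint: "(f ^^ k) a = b \<Longrightarrow> f b = b \<Longrightarrow> k \<le> n \<Longrightarrow> (f ^^ n) a = b"
proof -
  assume a: "(f ^^ k) a = b" "f b = b" "k \<le> n"
  have "(f ^^ m) b = b" for m by (induction m) (auto simp: a(2))
  moreover have "n = (n - k) + k" using a(3) by simp
  ultimately show ?thesis using a(1) by (metis comp_apply funpow_add)
qed

notation Seq (infixr ";;" 60)

definition skip :: "unit com" where "skip = Prim (Copy 0 0)"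
abbreviation push :: "nat \<Rightarrow> nat \<Rightarrow> unit com" where "push r a \<equiv> Prim (Push r a)"
abbreviation pop :: "nat \<Rightarrow> unit com" where "pop r \<equiv> Prim (Pop r)"
abbreviation copy :: "nat \<Rightarrow> nat \<Rightarrow> unit com" where "copy i j \<equiv> Prim (Copy i j)"
abbreviation clear :: "nat \<Rightarrow> unit com" where "clear r \<equiv> Prim (Clear r)"
abbreviation repeat :: "unit com \<Rightarrow> unit com" where "repeat c \<equiv> Loop () c"

lemma exec_skip [simp]: "exec N skip \<sigma> = \<sigma>"
  by (simp add: skip_def)

lemma wf_skip [simp]: "wf_src k skip \<longleftrightarrow> 0 < k"
  by (simp add: skip_def)

text \<open>Register 0 holds input and output, register 1 the clock.\<close>

abbreviation (input) "rIN \<equiv> (2::nat)"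
abbreviation (input) "rBEST \<equiv> (3::nat)"
abbreviation (input) "rCUR \<equiv> (4::nat)"
abbreviation (input) "rT \<equiv> (5::nat)"
abbreviation (input) "rE \<equiv> (6::nat)"
abbreviation (input) "rT' \<equiv> (7::nat)"
abbreviation (input) "rE' \<equiv> (8::nat)"
abbreviation (input) "rW \<equiv> (9::nat)"
abbreviation (input) "rSB \<equiv> (10::nat)"
abbreviation (input) "rSC \<equiv> (11::nat)"
abbreviation (input) "rFL \<equiv> (12::nat)"
abbreviation (input) "rP \<equiv> (13::nat)"
abbreviation (input) "rC \<equiv> (14::nat)"
abbreviation (input) "rFI \<equiv> (15::nat)"
abbreviation (input) "rV \<equiv> (16::nat)"
abbreviation (input) "rITEM \<equiv> (17::nat)"
abbreviation (input) "rA \<equiv> (18::nat)"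
abbreviation (input) "rI \<equiv> (19::nat)"
abbreviation (input) "rX \<equiv> (20::nat)"
abbreviation (input) "rFD \<equiv> (21::nat)"
abbreviation (input) "rJ \<equiv> (22::nat)"
abbreviation (input) "rCY \<equiv> (23::nat)"

section \<open>Moving encoded words between queues\<close>

definition move_sym :: "nat \<Rightarrow> nat \<Rightarrow> unit com" where
  "move_sym i j = Ite (CHd i 1) (pop i ;; push j 1) (Ite (CHd i 2) (pop i ;; push j 2)
     (Ite (CHd i 3) (pop i ;; push j 3) (Ite (CHd i 4) (pop i ;; push j 4) skip)))"

lemma exec_move_sym_Nil: "\<sigma> i = [] \<Longrightarrow> exec N (move_sym i j) \<sigma> = \<sigma>"
  by (simp add: move_sym_def)

lemma exec_move_sym:
  assumes "\<sigma> i = a # u" "a \<in> {1..4}"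
  shows "exec N (move_sym i j) \<sigma> = (if i = j then \<sigma>(i := u @ [a]) else \<sigma>(i := u, j := \<sigma> j @ [a]))"
proof -
  have "a = 1 \<or> a = 2 \<or> a = 3 \<or> a = 4" using assms(2) by auto
  then show ?thesis using assms(1) by (elim disjE) (simp_all add: move_sym_def)
qed

text \<open>The flag \<open>rFL\<close> is raised when the separator \<open>4\<close> is about to be
  moved and makes the remaining iterations idle. With \<open>i = j\<close> the queue is rotated by
  one word.\<close>

definition move_item :: "nat \<Rightarrow> nat \<Rightarrow> unit com" where
  "move_item i j = repeat (Ite (CHd rFL 0) (Ite (CHd i 4) (push rFL 1 ;; move_sym i j) (move_sym i j)) skip) ;; clear rFL"

lemma exec_move_item_Nil:
  assumes "\<sigma> i = []" "\<sigma> rFL = []"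
  shows "exec N (move_item i j) \<sigma> = \<sigma>"
proof -
  let ?c = "Ite (CHd rFL 0) (Ite (CHd i 4) (push rFL 1 ;; move_sym i j) (move_sym i j)) skip"
  have "exec N ?c \<sigma> = \<sigma>" using assms by (simp add: exec_move_sym_Nil)
  then have "(exec N ?c ^^ N) \<sigma> = \<sigma>" by (rule funpow_fixpoint[where k = 0, rotated]) auto
  then show ?thesis using assms by (simp add: move_item_def fun_upd_idem del: exec.simps(3))
qed

lemma exec_move_item:
  assumes ij: "i \<noteq> rFL" "j \<noteq> rFL" and s: "\<sigma> i = u @ 4 # v" "\<sigma> rFL = []" "set u \<subseteq> {1..3}" "length u < N"
  shows "exec N (move_item i j) \<sigma> = (if i = j then \<sigma>(i := v @ u @ [4]) else \<sigma>(i := v, j := \<sigma> j @ u @ [4]))"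
proof -
  let ?c = "Ite (CHd rFL 0) (Ite (CHd i 4) (push rFL 1 ;; move_sym i j) (move_sym i j)) skip"
  let ?r = "\<lambda>\<sigma> u v. (if i = j then \<sigma>(i := v @ u @ [4]) else \<sigma>(i := v, j := \<sigma> j @ u @ [4]))(rFL := [1])"
  have it: "(exec N ?c ^^ Suc (length u)) \<sigma> = ?r \<sigma> u v"
    using s(1-3)
  proof (induction u arbitrary: \<sigma> v)
    case Nil
    then show ?case using ij by (auto simp: exec_move_sym fun_upd_twist)
  next
    case (Cons a u)
    show ?case
    proof (cases "i = j")
      case True
      have "exec N ?c \<sigma> = \<sigma>(i := u @ 4 # v @ [a])"
        using Cons.prems ij True by (auto simp: exec_move_sym)
      then have "(exec N ?c ^^ Suc (length (a # u))) \<sigma> = (exec N ?c ^^ Suc (length u)) (\<sigma>(i := u @ 4 # v @ [a]))"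
        by (simp only: length_Cons funpow_Suc_right comp_apply)
      also have "\<dots> = ?r (\<sigma>(i := u @ 4 # v @ [a])) u (v @ [a])"
        using Cons.prems ij by (intro Cons.IH) auto
      also have "\<dots> = ?r \<sigma> (a # u) v" using True by simp
      finally show ?thesis .
    next
      case False
      have "exec N ?c \<sigma> = \<sigma>(i := u @ 4 # v, j := \<sigma> j @ [a])"
        using Cons.prems ij False by (auto simp: exec_move_sym)
      then have "(exec N ?c ^^ Suc (length (a # u))) \<sigma> = (exec N ?c ^^ Suc (length u)) (\<sigma>(i := u @ 4 # v, j := \<sigma> j @ [a]))"
        by (simp only: length_Cons funpow_Suc_right comp_apply)
      also have "\<dots> = ?r (\<sigma>(i := u @ 4 # v, j := \<sigma> j @ [a])) u v"
        using Cons.prems ij False by (intro Cons.IH) auto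
      also have "\<dots> = ?r \<sigma> (a # u) v" using False by (auto simp: fun_eq_iff)
      finally show ?thesis .
    qed
  qed
  have fx: "exec N ?c (?r \<sigma> u v) = ?r \<sigma> u v" by simp
  have "(exec N ?c ^^ N) \<sigma> = ?r \<sigma> u v" by (rule funpow_fixpoint[OF it fx]) (use s(4) in simp)
  then show ?thesis using ij s(2) by (auto simp: move_item_def fun_eq_iff simp del: exec.simps(3))
qed

lemma exec_move_first:
  assumes "i \<noteq> rFL" "j \<noteq> rFL" "i \<noteq> j" "\<sigma> rFL = []" "\<sigma> i = enc_words (w # ws)" "length (\<sigma> i) \<le> N"
  shows "exec N (move_item i j) \<sigma> = \<sigma>(i := enc_words ws, j := \<sigma> j @ enc_word w @ [4])"
  using exec_move_item[of i j \<sigma> "enc_word w" "enc_words ws" N] assms enc_word_symbols[of w] by simp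

lemma exec_rotate_item:
  assumes "i \<noteq> rFL" "\<sigma> rFL = []" "\<sigma> i = enc_words ws" "length (\<sigma> i) \<le> N"
  shows "exec N (move_item i i) \<sigma> = \<sigma>(i := enc_words (rotate1 ws))"
proof (cases ws)
  case Nil
  then show ?thesis using assms by (simp add: exec_move_item_Nil fun_upd_idem)
next
  case (Cons w vs)
  then show ?thesis using exec_move_item[of i i \<sigma> "enc_word w" "enc_words vs" N] assms enc_word_symbols[of w] by simp
qed

definition append_reg :: "nat \<Rightarrow> nat \<Rightarrow> unit com" where
  "append_reg i j = copy i rV ;; repeat (move_sym rV j)"

lemma exec_append_reg:
  assumes "i \<noteq> rV" "j \<noteq> rV" "\<sigma> rV = []" "set (\<sigma> i) \<subseteq> {1..4}" "length (\<sigma> i) \<le> N"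
  shows "exec N (append_reg i j) \<sigma> = \<sigma>(j := \<sigma> j @ \<sigma> i)"
proof -
  have it: "(exec N (move_sym rV j) ^^ length u) \<sigma> = \<sigma>(rV := [], j := \<sigma> j @ u)"
    if "\<sigma> rV = u" "set u \<subseteq> {1..4}" for \<sigma> u
    using that
  proof (induction u arbitrary: \<sigma>)
    case Nil
    then show ?case by (auto simp: fun_upd_idem)
  next
    case (Cons a u)
    have "exec N (move_sym rV j) \<sigma> = \<sigma>(rV := u, j := \<sigma> j @ [a])"
      using Cons.prems assms(2) by (subst exec_move_sym[of \<sigma> rV a u]) auto
    then have "(exec N (move_sym rV j) ^^ length (a # u)) \<sigma> = (exec N (move_sym rV j) ^^ length u) (\<sigma>(rV := u, j := \<sigma> j @ [a]))"
      by (simp add: funpow_swap1)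
    also have "\<dots> = (\<sigma>(rV := u, j := \<sigma> j @ [a]))(rV := [], j := (\<sigma>(rV := u, j := \<sigma> j @ [a])) j @ u)"
      using Cons.prems assms(2) by (intro Cons.IH) auto
    finally show ?case using assms(2) by (simp add: fun_eq_iff)
  qed
  have "(exec N (move_sym rV j) ^^ N) (\<sigma>(rV := \<sigma> i)) = \<sigma>(rV := [], j := \<sigma> j @ \<sigma> i)"
  proof (rule funpow_fixpoint)
    show "(exec N (move_sym rV j) ^^ length (\<sigma> i)) (\<sigma>(rV := \<sigma> i)) = \<sigma>(rV := [], j := \<sigma> j @ \<sigma> i)"
      using it[of "\<sigma>(rV := \<sigma> i)" "\<sigma> i"] assms by simp
    show "exec N (move_sym rV j) (\<sigma>(rV := [], j := \<sigma> j @ \<sigma> i)) = \<sigma>(rV := [], j := \<sigma> j @ \<sigma> i)"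
      using assms by (simp add: exec_move_sym_Nil)
  qed (use assms in auto)
  then show ?thesis using assms(3) by (simp add: append_reg_def fun_upd_idem)
qed

text \<open>The values at the empty word make it an arc that never merges with any neighbour.\<close>

definition src :: "nat list \<Rightarrow> nat" where
  "src w = (if w = [] then 0 else hd w + 2)"

definition tgt :: "nat list \<Rightarrow> nat" where
  "tgt w = (if w = [] then 1 else last w + 2)"

text \<open>As \<open>enc_nat 0\<close> is empty, the terminator \<open>3\<close> is kept to tell
  the character \<open>0\<close> from the absence of a character.\<close>

definition last_code :: "nat list \<Rightarrow> nat list" where
  "last_code w = (if w = [] then [] else enc_nat (last w) @ [3])"

text \<open>
  One step of a pass over an encoded list of words in \<open>rV\<close>: \<open>rP\<close> holds the code of the last character
  read so far (empty after an empty word), \<open>rC\<close> the bits of the current character, and \<open>rFI\<close> is nonempty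
  once the first character of the current word has been compared with \<open>rP\<close>.
\<close>

definition scan_sym :: "unit com" where
  "scan_sym = Ite (CHd rV 1) (push rC 1) (Ite (CHd rV 2) (push rC 2)
     (Ite (CHd rV 3) (push rC 3 ;; Ite (CHd rFI 0) (Ite (CEq rC rP) (push rSC 1) skip ;; push rFI 1) skip ;; copy rC rP ;; clear rC)
     (Ite (CHd rV 4) (Ite (CHd rFI 0) (clear rP) skip ;; clear rFI) skip))) ;; pop rV"

section \<open>Correctness of a scoring pass\<close>

lemma scan_bits:
  "set u \<subseteq> {1, 2} \<Longrightarrow> \<sigma> rV = u @ v \<Longrightarrow> (exec N scan_sym ^^ length u) \<sigma> = \<sigma>(rV := v, rC := \<sigma> rC @ u)"
proof (induction u arbitrary: \<sigma>)
  case (Cons a u)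
  let ?\<sigma> = "\<sigma>(rV := u @ v, rC := \<sigma> rC @ [a])"
  have "exec N scan_sym \<sigma> = ?\<sigma>"
    using Cons.prems by (auto simp: scan_sym_def fun_eq_iff)
  then have "(exec N scan_sym ^^ length (a # u)) \<sigma> = (exec N scan_sym ^^ length u) ?\<sigma>"
    by (simp add: funpow_swap1)
  also have "\<dots> = ?\<sigma>(rV := v, rC := ?\<sigma> rC @ u)" using Cons.prems by (intro Cons.IH) auto
  finally show ?case by (simp add: fun_eq_iff)
qed (auto simp: fun_upd_idem)

lemma scan_char:
  assumes "\<sigma> rV = enc_nat c @ 3 # v" "\<sigma> rC = []" "0 \<notin> set (\<sigma> rFI)"
  shows "(exec N scan_sym ^^ (length (enc_nat c) + 1)) \<sigma> =
    (if \<sigma> rFI = [] then \<sigma>(rV := v, rP := enc_nat c @ [3], rFI := [1], 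
        rSC := \<sigma> rSC @ (if \<sigma> rP = enc_nat c @ [3] then [1] else []))
     else \<sigma>(rV := v, rP := enc_nat c @ [3]))"
proof (rule funpow_trans)
  show "(exec N scan_sym ^^ length (enc_nat c)) \<sigma> = \<sigma>(rV := 3 # v, rC := enc_nat c)"
    using scan_bits[of "enc_nat c" \<sigma> "3 # v" N] enc_nat_symbols assms(1,2) by simp
  have "test (CHd rFI 0) \<sigma> = (\<sigma> rFI = [])" using assms(3) by (auto split: list.splits)
  then show "(exec N scan_sym ^^ 1) (\<sigma>(rV := 3 # v, rC := enc_nat c)) = (if \<sigma> rFI = [] then \<sigma>(rV := v, rP := enc_nat c @ [3], rFI := [1], 
        rSC := \<sigma> rSC @ (if \<sigma> rP = enc_nat c @ [3] then [1] else []))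
     else \<sigma>(rV := v, rP := enc_nat c @ [3]))"
    using assms(2) by (cases "\<sigma> rFI") (auto simp: scan_sym_def fun_eq_iff)
qed

lemma scan_chars:
  "\<sigma> rV = enc_word w @ v \<Longrightarrow> \<sigma> rC = [] \<Longrightarrow> \<sigma> rFI = [1] \<Longrightarrow>
   (exec N scan_sym ^^ length (enc_word w)) \<sigma> = \<sigma>(rV := v, rP := if w = [] then \<sigma> rP else last_code w)"
proof (induction w arbitrary: \<sigma>)
  case Nil
  then show ?case by (simp add: fun_upd_idem)
next
  case (Cons c w)
  let ?\<sigma> = "\<sigma>(rV := enc_word w @ v, rP := enc_nat c @ [3])"
  have "(exec N scan_sym ^^ (length (enc_nat c) + 1)) \<sigma> = ?\<sigma>"
    using scan_char[of \<sigma> c "enc_word w @ v" N] Cons.prems by simp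
  moreover have "(exec N scan_sym ^^ length (enc_word w)) ?\<sigma> = ?\<sigma>(rV := v, rP := if w = [] then ?\<sigma> rP else last_code w)"
    using Cons.prems by (intro Cons.IH) auto
  ultimately have "(exec N scan_sym ^^ (length (enc_nat c) + 1 + length (enc_word w))) \<sigma> = 
     ?\<sigma>(rV := v, rP := if w = [] then ?\<sigma> rP else last_code w)" by (rule funpow_trans)
  then show ?case by (auto simp: last_code_def fun_upd_twist)
qed

lemma last_code_eq: "last_code p = enc_nat c @ [3] \<longleftrightarrow> p \<noteq> [] \<and> last p = c"
  using enc_nat_inj by (auto simp: last_code_def)

lemma scan_word:
  assumes "\<sigma> rV = enc_word w @ 4 # v" "\<sigma> rC = []" "\<sigma> rFI = []" "\<sigma> rP = last_code p"
  shows "(exec N scan_sym ^^ (length (enc_word w) + 1)) \<sigma> =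
    \<sigma>(rV := v, rP := last_code w, rSC := \<sigma> rSC @ replicate (of_bool (tgt p = src w)) 1)"
proof (cases w)
  case Nil
  then show ?thesis using assms by (auto simp: scan_sym_def src_def tgt_def last_code_def fun_eq_iff)
next
  case (Cons c w')
  let ?s = "\<sigma> rSC @ replicate (of_bool (tgt p = src w)) 1"
  have g: "(\<sigma> rP = enc_nat c @ [3]) \<longleftrightarrow> tgt p = src w"
    using assms(4) by (simp add: last_code_eq src_def tgt_def Cons)
  have 1: "(exec N scan_sym ^^ (length (enc_nat c) + 1)) \<sigma> =
      \<sigma>(rV := enc_word w' @ 4 # v, rP := enc_nat c @ [3], rFI := [1], rSC := ?s)"
    using scan_char[of \<sigma> c "enc_word w' @ 4 # v" N] assms g by (simp add: Cons)
  let ?\<sigma> = "\<sigma>(rV := enc_word w' @ 4 # v, rP := enc_nat c @ [3], rFI := [1], rSC := ?s)"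
  have 2: "(exec N scan_sym ^^ length (enc_word w')) ?\<sigma> = ?\<sigma>(rV := 4 # v, rP := if w' = [] then ?\<sigma> rP else last_code w')"
    using assms by (intro scan_chars) auto
  have 3: "(exec N scan_sym ^^ 1) (?\<sigma>(rV := 4 # v, rP := if w' = [] then ?\<sigma> rP else last_code w')) = 
     \<sigma>(rV := v, rP := last_code w, rSC := ?s)"
    using assms by (auto simp: scan_sym_def fun_eq_iff last_code_def Cons)
  show ?thesis using funpow_trans[OF funpow_trans[OF 1 2] 3] by (simp add: Cons)
qed

lemma scan_words:
  "\<sigma> rV = enc_words ws \<Longrightarrow> \<sigma> rC = [] \<Longrightarrow> \<sigma> rFI = [] \<Longrightarrow> \<sigma> rP = last_code p \<Longrightarrow>
   (exec N scan_sym ^^ length (enc_words ws)) \<sigma> =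
    \<sigma>(rV := [], rP := last_code (last (p # ws)), 
      rSC := \<sigma> rSC @ replicate (cnt (\<lambda>(a, b). tgt a = src b) (steps (p # ws))) 1)"
proof (induction ws arbitrary: \<sigma> p)
  case Nil
  then show ?case by (auto simp: steps_def fun_eq_iff)
next
  case (Cons w ws)
  let ?\<sigma> = "\<sigma>(rV := enc_words ws, rP := last_code w, rSC := \<sigma> rSC @ replicate (of_bool (tgt p = src w)) 1)"
  have 1: "(exec N scan_sym ^^ (length (enc_word w) + 1)) \<sigma> = ?\<sigma>"
    using Cons.prems by (intro scan_word) auto
  have 2: "(exec N scan_sym ^^ length (enc_words ws)) ?\<sigma> = ?\<sigma>(rV := [], rP := last_code (last (w # ws)), 
      rSC := ?\<sigma> rSC @ replicate (cnt (\<lambda>(a, b). tgt a = src b) (steps (w # ws))) 1)"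
    using Cons.prems by (intro Cons.IH) auto
  have "steps (p # w # ws) = (p, w) # steps (w # ws)" by (simp add: steps_def)
  then show ?case using funpow_trans[OF 1 2] by (simp add: fun_eq_iff replicate_add)
qed

definition scan :: "unit com" where
  "scan = copy rW rV ;; repeat scan_sym"

lemma exec_scan:
  assumes "\<sigma> rW = enc_words ws" "length (\<sigma> rW) \<le> N" "\<sigma> rV = []" "\<sigma> rC = []" "\<sigma> rFI = []" "\<sigma> rP = last_code p"
  shows "exec N scan \<sigma> = \<sigma>(rP := last_code (last (p # ws)), 
      rSC := \<sigma> rSC @ replicate (cnt (\<lambda>(a, b). tgt a = src b) (steps (p # ws))) 1)" (is "_ = ?r")
proof -
  have "(exec N scan_sym ^^ N) (\<sigma>(rV := \<sigma> rW)) = ?r(rV := [])"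
  proof (rule funpow_fixpoint)
    show "(exec N scan_sym ^^ length (\<sigma> rW)) (\<sigma>(rV := \<sigma> rW)) = ?r(rV := [])"
      using scan_words[of "\<sigma>(rV := \<sigma> rW)" ws p N] assms by (simp add: fun_eq_iff)
    show "exec N scan_sym (?r(rV := [])) = ?r(rV := [])" by (simp add: scan_sym_def fun_eq_iff)
  qed (use assms in auto)
  then show ?thesis using assms(3) by (auto simp: scan_def fun_eq_iff)
qed

text \<open>The first pass only serves to bring the last character of the last word into \<open>rP\<close>.\<close>

definition score_prog :: "unit com" where
  "score_prog = scan ;; clear rSC ;; scan ;; clear rP"

lemma exec_score_prog:
  assumes "\<sigma> rW = enc_words ws" "ws \<noteq> []" "length (\<sigma> rW) \<le> N" "\<sigma> rV = []" "\<sigma> rC = []" "\<sigma> rFI = []" "\<sigma> rP = []"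
  shows "exec N score_prog \<sigma> = \<sigma>(rSC := replicate (score src tgt ws) 1)"
proof -
  let ?n = "\<lambda>p. cnt (\<lambda>(a, b). tgt a = src b) (steps (p # ws))"
  let ?s = "\<sigma>(rP := last_code (last ws), rSC := \<sigma> rSC @ replicate (?n []) 1)"
  have 1: "exec N scan \<sigma> = ?s"
    using exec_scan[of \<sigma> ws N "[]"] assms by (simp add: last_code_def)
  have 2: "exec N scan (?s(rSC := [])) = \<sigma>(rP := last_code (last ws), rSC := replicate (?n (last ws)) 1)"
    using exec_scan[of "?s(rSC := [])" ws N "last ws"] assms by (simp add: fun_eq_iff)
  \<comment> \<open>With the last word as predecessor, the linear steps begin with the wrap-around
    junction and so run through all cyclic junctions.\<close>
  have "?n (last ws) = score src tgt ws"
    using assms(2) unfolding score_def junctions_steps[OF assms(2)] by (cases ws) (auto simp: steps_def)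
  then have "exec N score_prog \<sigma> = \<sigma>(rP := last_code (last ws), rSC := replicate (score src tgt ws) 1, rP := [])"
    using 2 unfolding score_prog_def exec.simps(2) 1 by simp
  then show ?thesis using assms(7) by (simp add: fun_eq_iff)
qed

section \<open>The local search\<close>

text \<open>Scores are unary, so \<open>CGe\<close> compares them by length; only a strictly better
  candidate replaces the best arrangement.\<close>

definition try_prog :: "unit com" where
  "try_prog = copy rT' rW ;; append_reg rE' rW ;; score_prog ;;
     Ite (CGe rSB rSC) skip (copy rSC rSB ;; copy rW rBEST)"

definition try_rotations_E :: "unit com" where
  "try_rotations_E = copy rE rE' ;; repeat (move_item rE' rE' ;; try_prog)"

definition try_rotations_T :: "unit com" where
  "try_rotations_T = copy rT rT' ;; repeat (move_item rT' rT' ;; try_rotations_E)"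

text \<open>A word is moved before the first try, so \<open>rT\<close> is never empty when tried.
  When \<open>rE\<close> is exhausted, the split stays at the whole list.\<close>

definition try_splits :: "unit com" where
  "try_splits = clear rT ;; copy rCUR rE ;; repeat (move_item rE rT ;; try_rotations_T)"

text \<open>All moves of a round start from the copy in \<open>rCUR\<close>, so the neighbourhood
  stays fixed when \<open>rBEST\<close> is replaced in the meantime.\<close>

definition improve :: "unit com" where
  "improve = copy rBEST rCUR ;; repeat (move_item rCUR rCUR ;; try_splits)"

lemma mset_rotate1 [simp]: "mset (rotate1 xs) = mset xs"
  by (cases xs) auto

lemma mset_rotate [simp]: "mset (rotate n xs) = mset xs"
  by (induction n) auto

text \<open>The loops rotate before they try and so see the rotations \<open>1\<close> to
  \<open>N\<close>; the identity reappears as the rotation by the full length.\<close>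

lemma rotate_period:
  assumes "length xs \<le> N" "1 \<le> N"
  shows "\<exists>k\<in>{1..N}. rotate k xs = rotate q xs"
proof (cases "xs = [] \<or> q mod length xs = 0")
  case True
  then have "rotate q xs = xs" by (metis rotate_conv_mod rotate0 id_apply rotate_is_Nil_conv)
  moreover have "rotate (length xs) xs = xs" by simp
  moreover have "xs = [] \<or> length xs \<in> {1..N}" using assms by (cases xs) auto
  moreover have "1 \<in> {1..N}" using assms by simp
  ultimately show ?thesis by (metis rotate_is_Nil_conv)
next
  case False
  then have "q mod length xs < length xs" by simp
  then have "q mod length xs \<le> N" using assms(1) by linarith
  then show ?thesis using False assms rotate_conv_mod[of q xs] by (intro bexI[of _ "q mod length xs"]) auto
qed

abbreviation sco :: "nat list list \<Rightarrow> nat" where "sco \<equiv> score src tgt"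

locale instance_clock =
  fixes N :: nat and xs :: "nat list list"
  assumes N: "length (enc_words xs) + 2 \<le> N"
begin

text \<open>The additional empty word is the sentinel. Scratch registers are empty between calls;
  the registers of the search loops are tracked separately.\<close>

definition inv :: "store \<Rightarrow> nat list list \<Rightarrow> bool" where
  "inv \<sigma> ys \<longleftrightarrow> \<sigma> rIN = enc_words xs \<and> \<sigma> rBEST = enc_words ys \<and> mset ys = mset ([] # xs) \<and>
     \<sigma> rSB = replicate (sco ys) 1 \<and> \<sigma> rFL = [] \<and> \<sigma> rP = [] \<and> \<sigma> rC = [] \<and> \<sigma> rFI = [] \<and> \<sigma> rV = []"

lemma inv_upd: "inv \<sigma> ys \<Longrightarrow> r \<notin> {rIN, rBEST, rSB, rFL, rP, rC, rFI, rV} \<Longrightarrow> inv (\<sigma>(r := u)) ys"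
  by (simp add: inv_def)

lemma part_bounds:
  assumes "mset (t @ e) = mset ([] # xs)"
  shows "length (enc_words t) + length (enc_words e) < N" "length t + length e < N"
proof -
  have "length (enc_words (t @ e)) = length (enc_words ([] # xs))"
    by (rule length_enc_words_mset[OF assms])
  then show "length (enc_words t) + length (enc_words e) < N" using N by simp
  then show "length t + length e < N" using length_le_enc_words[of t] length_le_enc_words[of e] by simp
qed

text \<open>Common induction for the four nested search loops: \<open>P k\<close> describes the loop
  registers after \<open>k\<close> iterations, \<open>Q k\<close> the candidates covered by
  iteration \<open>k\<close>.\<close>

lemma loop_search:
  assumes step: "\<And>k \<sigma> ys. P k \<sigma> \<Longrightarrow> inv \<sigma> ys \<Longrightarrow> \<exists>ys'. inv (f \<sigma>) ys' \<and> P (Suc k) (f \<sigma>) \<and> sco ys \<le> sco ys' \<and>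
      (\<forall>z. Q (Suc k) z \<longrightarrow> sco z \<le> sco ys')"
    and "P 0 \<sigma>" "inv \<sigma> ys"
  shows "\<exists>ys'. inv ((f ^^ n) \<sigma>) ys' \<and> P n ((f ^^ n) \<sigma>) \<and> sco ys \<le> sco ys' \<and>
      (\<forall>k\<in>{1..n}. \<forall>z. Q k z \<longrightarrow> sco z \<le> sco ys')"
proof (induction n)
  case 0
  then show ?case using assms by auto
next
  case (Suc n)
  then obtain ys1 where 1: "inv ((f ^^ n) \<sigma>) ys1" "P n ((f ^^ n) \<sigma>)" "sco ys \<le> sco ys1"
      "\<forall>k\<in>{1..n}. \<forall>z. Q k z \<longrightarrow> sco z \<le> sco ys1" by blast
  obtain ys2 where 2: "inv ((f ^^ Suc n) \<sigma>) ys2" "P (Suc n) ((f ^^ Suc n) \<sigma>)" "sco ys1 \<le> sco ys2"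
      "\<forall>z. Q (Suc n) z \<longrightarrow> sco z \<le> sco ys2" using step[OF 1(2,1)] by auto
  have "\<forall>k\<in>{1..Suc n}. \<forall>z. Q k z \<longrightarrow> sco z \<le> sco ys2"
    using 1(4) 2(3,4) by (auto simp: le_Suc_eq) (meson le_trans atLeastAtMost_iff)
  then show ?case using 1(3) 2 le_trans by blast
qed

lemma exec_try_prog:
  assumes i: "inv \<sigma> ys" and t: "\<sigma> rT' = enc_words t" "\<sigma> rE' = enc_words e" "t \<noteq> []" "mset (t @ e) = mset ([] # xs)"
  shows "\<exists>ys'. inv (exec N try_prog \<sigma>) ys' \<and> sco ys \<le> sco ys' \<and> sco (t @ e) \<le> sco ys' \<and>
    (\<forall>r. r \<notin> {rW, rSC, rSB, rBEST} \<longrightarrow> exec N try_prog \<sigma> r = \<sigma> r)"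
proof -
  define \<sigma>1 where "\<sigma>1 = \<sigma>(rW := enc_words (t @ e))"
  define \<sigma>2 where "\<sigma>2 = \<sigma>1(rSC := replicate (sco (t @ e)) 1)"
  note b = part_bounds[OF t(4)]
  have 1: "exec N (append_reg rE' rW) (\<sigma>(rW := \<sigma> rT')) = \<sigma>1"
    using i t b enc_words_symbols[of e] by (subst exec_append_reg) (auto simp: inv_def \<sigma>1_def)
  have 2: "exec N score_prog \<sigma>1 = \<sigma>2"
    using i t b by (subst exec_score_prog[of _ "t @ e"]) (auto simp: inv_def \<sigma>1_def \<sigma>2_def)
  have sb: "\<sigma>2 rSB = replicate (sco ys) 1" "\<sigma>2 rSC = replicate (sco (t @ e)) 1"
    using i by (auto simp: \<sigma>1_def \<sigma>2_def inv_def)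
  have ex: "exec N try_prog \<sigma> = exec N (Ite (CGe rSB rSC) skip (copy rSC rSB ;; copy rW rBEST)) \<sigma>2"
    unfolding try_prog_def exec.simps(1,2) do_prim.simps 1 2 ..
  show ?thesis
  proof (cases "sco (t @ e) \<le> sco ys")
    case True
    then have ex: "exec N try_prog \<sigma> = \<sigma>2" unfolding ex using sb by simp
    then show ?thesis unfolding ex using i True by (intro exI[of _ ys]) (auto simp: \<sigma>1_def \<sigma>2_def inv_upd)
  next
    case False
    then have ex: "exec N try_prog \<sigma> = \<sigma>2(rSB := \<sigma>2 rSC, rBEST := \<sigma>2 rW)" unfolding ex using sb by simp
    then show ?thesis unfolding ex using i False t(4)
      by (intro exI[of _ "t @ e"]) (auto simp: \<sigma>1_def \<sigma>2_def inv_def)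
  qed
qed

lemma exec_try_rotations_E:
  assumes i: "inv \<sigma> ys" and t: "\<sigma> rT' = enc_words t" "\<sigma> rE = enc_words e" "t \<noteq> []" "mset (t @ e) = mset ([] # xs)"
  shows "\<exists>ys'. inv (exec N try_rotations_E \<sigma>) ys' \<and> sco ys \<le> sco ys' \<and> (\<forall>q. sco (t @ rotate q e) \<le> sco ys') \<and>
    (\<forall>r\<in>{rCUR, rT, rE, rT'}. exec N try_rotations_E \<sigma> r = \<sigma> r)"
proof -
  let ?f = "exec N (move_item rE' rE' ;; try_prog)"
  define P where "P k \<tau> \<longleftrightarrow> \<tau> rE' = enc_words (rotate k e) \<and> (\<forall>r\<in>{rCUR, rT, rE, rT'}. \<tau> r = \<sigma> r)" for k and \<tau> :: store
  have step: "\<exists>ys'. inv (?f \<tau>) ys' \<and> P (Suc k) (?f \<tau>) \<and> sco ys \<le> sco ys' \<and>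
      (\<forall>z. z = t @ rotate (Suc k) e \<longrightarrow> sco z \<le> sco ys')" if p: "P k \<tau>" and iv: "inv \<tau> ys" for k \<tau> ys
  proof -
    have m: "mset (t @ rotate (Suc k) e) = mset ([] # xs)" "mset (t @ rotate k e) = mset ([] # xs)" using t(4) by auto
    let ?\<tau> = "\<tau>(rE' := enc_words (rotate (Suc k) e))"
    have 1: "exec N (move_item rE' rE') \<tau> = ?\<tau>"
      using p iv part_bounds[OF m(2)] by (subst exec_rotate_item[of _ _ "rotate k e"]) (auto simp: P_def inv_def)
    have iv': "inv ?\<tau> ys" using iv by (simp add: inv_upd)
    obtain ys' where "inv (exec N try_prog ?\<tau>) ys'" "sco ys \<le> sco ys'" "sco (t @ rotate (Suc k) e) \<le> sco ys'"
      "\<And>r. r \<notin> {rW, rSC, rSB, rBEST} \<Longrightarrow> exec N try_prog ?\<tau> r = ?\<tau> r"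
      using exec_try_prog[OF iv', of t "rotate (Suc k) e"] p t m(1) by (auto simp: P_def)
    then show ?thesis using p unfolding exec.simps(2) 1 by (intro exI[of _ ys']) (auto simp: P_def)
  qed
  let ?\<sigma> = "\<sigma>(rE' := \<sigma> rE)"
  have "P 0 ?\<sigma>" using t by (simp add: P_def)
  moreover have "inv ?\<sigma> ys" using i by (simp add: inv_upd)
  ultimately have "\<exists>ys'. inv ((?f ^^ N) ?\<sigma>) ys' \<and> P N ((?f ^^ N) ?\<sigma>) \<and> sco ys \<le> sco ys' \<and>
      (\<forall>k\<in>{1..N}. \<forall>z. z = t @ rotate k e \<longrightarrow> sco z \<le> sco ys')"
    by (intro loop_search[where Q = "\<lambda>k z. z = t @ rotate k e"] step)
  then obtain ys' where ys': "inv ((?f ^^ N) ?\<sigma>) ys'" "P N ((?f ^^ N) ?\<sigma>)" "sco ys \<le> sco ys'" 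
     "\<forall>k\<in>{1..N}. sco (t @ rotate k e) \<le> sco ys'" by blast
  have ex: "exec N try_rotations_E \<sigma> = (?f ^^ N) ?\<sigma>" unfolding try_rotations_E_def by (simp del: exec.simps(3))
  have "length e \<le> N" "1 \<le> N" using part_bounds[OF t(4)] by auto
  then have "sco (t @ rotate q e) \<le> sco ys'" for q
    using rotate_period[of e N q] ys'(4) by metis
  then show ?thesis unfolding ex using ys' by (intro exI[of _ ys']) (auto simp: P_def)
qed

lemma exec_try_rotations_T:
  assumes i: "inv \<sigma> ys" and t: "\<sigma> rT = enc_words t" "\<sigma> rE = enc_words e" "t \<noteq> []" "mset (t @ e) = mset ([] # xs)"
  shows "\<exists>ys'. inv (exec N try_rotations_T \<sigma>) ys' \<and> sco ys \<le> sco ys' \<and> (\<forall>p q. sco (rotate p t @ rotate q e) \<le> sco ys') \<and>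
    (\<forall>r\<in>{rCUR, rT, rE}. exec N try_rotations_T \<sigma> r = \<sigma> r)"
proof -
  let ?f = "exec N (move_item rT' rT' ;; try_rotations_E)"
  define P where "P k \<tau> \<longleftrightarrow> \<tau> rT' = enc_words (rotate k t) \<and> (\<forall>r\<in>{rCUR, rT, rE}. \<tau> r = \<sigma> r)" for k and \<tau> :: store
  have step: "\<exists>ys'. inv (?f \<tau>) ys' \<and> P (Suc k) (?f \<tau>) \<and> sco ys \<le> sco ys' \<and>
      (\<forall>z. (\<exists>q. z = rotate (Suc k) t @ rotate q e) \<longrightarrow> sco z \<le> sco ys')" if p: "P k \<tau>" and iv: "inv \<tau> ys" for k \<tau> ys
  proof -
    have m: "mset (rotate (Suc k) t @ e) = mset ([] # xs)" "mset (rotate k t @ e) = mset ([] # xs)" using t(4) by auto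
    let ?\<tau> = "\<tau>(rT' := enc_words (rotate (Suc k) t))"
    have 1: "exec N (move_item rT' rT') \<tau> = ?\<tau>"
      using p iv part_bounds[OF m(2)] by (subst exec_rotate_item[of _ _ "rotate k t"]) (auto simp: P_def inv_def)
    have iv': "inv ?\<tau> ys" using iv by (simp add: inv_upd)
    have ne: "rotate (Suc k) t \<noteq> []" using t(3) by simp
    obtain ys' where "inv (exec N try_rotations_E ?\<tau>) ys'" "sco ys \<le> sco ys'" 
      "\<forall>q. sco (rotate (Suc k) t @ rotate q e) \<le> sco ys'"
      "\<forall>r\<in>{rCUR, rT, rE, rT'}. exec N try_rotations_E ?\<tau> r = ?\<tau> r"
      using exec_try_rotations_E[OF iv' _ _ ne m(1)] p t by (auto simp: P_def)
    then show ?thesis using p unfolding exec.simps(2) 1 by (intro exI[of _ ys']) (auto simp: P_def)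
  qed
  let ?\<sigma> = "\<sigma>(rT' := \<sigma> rT)"
  have "P 0 ?\<sigma>" using t by (simp add: P_def)
  moreover have "inv ?\<sigma> ys" using i by (simp add: inv_upd)
  ultimately have "\<exists>ys'. inv ((?f ^^ N) ?\<sigma>) ys' \<and> P N ((?f ^^ N) ?\<sigma>) \<and> sco ys \<le> sco ys' \<and>
      (\<forall>k\<in>{1..N}. \<forall>z. (\<exists>q. z = rotate k t @ rotate q e) \<longrightarrow> sco z \<le> sco ys')"
    by (intro loop_search[where Q = "\<lambda>k z. \<exists>q. z = rotate k t @ rotate q e"] step)
  then obtain ys' where ys': "inv ((?f ^^ N) ?\<sigma>) ys'" "P N ((?f ^^ N) ?\<sigma>)" "sco ys \<le> sco ys'" 
     "\<forall>k\<in>{1..N}. \<forall>q. sco (rotate k t @ rotate q e) \<le> sco ys'" by blast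
  have ex: "exec N try_rotations_T \<sigma> = (?f ^^ N) ?\<sigma>" unfolding try_rotations_T_def by (simp del: exec.simps(3))
  have "length t \<le> N" "1 \<le> N" using part_bounds[OF t(4)] by auto
  then have "sco (rotate p t @ rotate q e) \<le> sco ys'" for p q
    using rotate_period[of t N p] ys'(4) by metis
  then show ?thesis unfolding ex using ys' by (intro exI[of _ ys']) (auto simp: P_def)
qed

lemma exec_try_splits:
  assumes i: "inv \<sigma> ys" and c: "\<sigma> rCUR = enc_words cs" "mset cs = mset ([] # xs)"
  shows "\<exists>ys'. inv (exec N try_splits \<sigma>) ys' \<and> sco ys \<le> sco ys' \<and>
    (\<forall>t e p q. cs = t @ e \<longrightarrow> t \<noteq> [] \<longrightarrow> sco (rotate p t @ rotate q e) \<le> sco ys') \<and>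
    exec N try_splits \<sigma> rCUR = \<sigma> rCUR"
proof -
  let ?f = "exec N (move_item rE rT ;; try_rotations_T)"
  have cne: "cs \<noteq> []" using c(2) by auto
  define P where "P k \<tau> \<longleftrightarrow> \<tau> rT = enc_words (take k cs) \<and> \<tau> rE = enc_words (drop k cs) \<and> \<tau> rCUR = \<sigma> rCUR" for k and \<tau> :: store
  have step: "\<exists>ys'. inv (?f \<tau>) ys' \<and> P (Suc k) (?f \<tau>) \<and> sco ys \<le> sco ys' \<and>
      (\<forall>z. (\<exists>p q. z = rotate p (take (Suc k) cs) @ rotate q (drop (Suc k) cs)) \<longrightarrow> sco z \<le> sco ys')" 
    if p: "P k \<tau>" and iv: "inv \<tau> ys" for k \<tau> ys
  proof -
    have m: "mset (take (Suc k) cs @ drop (Suc k) cs) = mset ([] # xs)" "mset (take k cs @ drop k cs) = mset ([] # xs)"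
      unfolding append_take_drop_id by (rule c(2))+
    let ?\<tau> = "\<tau>(rE := enc_words (drop (Suc k) cs), rT := enc_words (take (Suc k) cs))"
    have 1: "exec N (move_item rE rT) \<tau> = ?\<tau>"
    proof (cases "drop k cs")
      case Nil
      then have "take (Suc k) cs = take k cs" "drop (Suc k) cs = []" by auto
      then show ?thesis using p iv Nil by (subst exec_move_item_Nil) (auto simp: P_def inv_def fun_eq_iff)
    next
      case (Cons w ws)
      then have d: "drop (Suc k) cs = ws" "take (Suc k) cs = take k cs @ [w]"
        by (auto simp: drop_Suc drop_tl take_Suc_conv_app_nth[of k cs] nth_via_drop) (metis Cons drop_all list.distinct(1) not_less nth_via_drop take_Suc_conv_app_nth)
      have l: "\<tau> rE = enc_words (w # ws)" using p Cons by (simp add: P_def)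
      have "exec N (move_item rE rT) \<tau> = \<tau>(rE := enc_words ws, rT := \<tau> rT @ enc_word w @ [4])"
        using p iv part_bounds[OF m(2)] l by (intro exec_move_first) (auto simp: P_def inv_def Cons)
      then show ?thesis using p d by (simp add: P_def)
    qed
    have iv': "inv ?\<tau> ys" using iv by (simp add: inv_upd)
    have ne: "take (Suc k) cs \<noteq> []" using cne by simp
    obtain ys' where "inv (exec N try_rotations_T ?\<tau>) ys'" "sco ys \<le> sco ys'" 
      "\<forall>p q. sco (rotate p (take (Suc k) cs) @ rotate q (drop (Suc k) cs)) \<le> sco ys'"
      "\<forall>r\<in>{rCUR, rT, rE}. exec N try_rotations_T ?\<tau> r = ?\<tau> r"
      using exec_try_rotations_T[OF iv' _ _ ne m(1)] by auto
    then show ?thesis using p unfolding exec.simps(2) 1 by (intro exI[of _ ys']) (auto simp: P_def)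
  qed
  let ?\<sigma> = "\<sigma>(rT := [], rE := \<sigma> rCUR)"
  have "P 0 ?\<sigma>" using c by (simp add: P_def)
  moreover have "inv ?\<sigma> ys" using i by (simp add: inv_upd)
  ultimately have "\<exists>ys'. inv ((?f ^^ N) ?\<sigma>) ys' \<and> P N ((?f ^^ N) ?\<sigma>) \<and> sco ys \<le> sco ys' \<and>
      (\<forall>k\<in>{1..N}. \<forall>z. (\<exists>p q. z = rotate p (take k cs) @ rotate q (drop k cs)) \<longrightarrow> sco z \<le> sco ys')"
    by (intro loop_search[where Q = "\<lambda>k z. \<exists>p q. z = rotate p (take k cs) @ rotate q (drop k cs)"] step)
  then obtain ys' where ys': "inv ((?f ^^ N) ?\<sigma>) ys'" "P N ((?f ^^ N) ?\<sigma>)" "sco ys \<le> sco ys'" 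
     "\<forall>k\<in>{1..N}. \<forall>p q. sco (rotate p (take k cs) @ rotate q (drop k cs)) \<le> sco ys'" by blast
  have ex: "exec N try_splits \<sigma> = (?f ^^ N) ?\<sigma>" unfolding try_splits_def by (simp del: exec.simps(3))
  have "sco (rotate p t @ rotate q e) \<le> sco ys'" if te: "cs = t @ e" "t \<noteq> []" for t e p q
  proof -
    have "length t \<in> {1..N}" using te part_bounds[of t e] c(2) by (cases t) auto
    then show ?thesis using ys'(4)[rule_format, of "length t" p q] te by simp
  qed
  then show ?thesis unfolding ex using ys' by (intro exI[of _ ys']) (auto simp: P_def)
qed

lemma exec_improve:
  assumes i: "inv \<sigma> ys"
  shows "\<exists>ys'. inv (exec N improve \<sigma>) ys' \<and> sco ys \<le> sco ys' \<and>
    (\<forall>r t e p q. rotate r ys = t @ e \<longrightarrow> t \<noteq> [] \<longrightarrow> sco (rotate p t @ rotate q e) \<le> sco ys')"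
proof -
  let ?f = "exec N (move_item rCUR rCUR ;; try_splits)"
  have ym: "mset ys = mset ([] # xs)" using i by (simp add: inv_def)
  define P where "P k \<tau> \<longleftrightarrow> \<tau> rCUR = enc_words (rotate k ys)" for k and \<tau> :: store
  define Q where "Q k z \<longleftrightarrow> (\<exists>t e p q. rotate k ys = t @ e \<and> t \<noteq> [] \<and> z = rotate p t @ rotate q e)" for k z
  have step: "\<exists>ys'. inv (?f \<tau>) ys' \<and> P (Suc k) (?f \<tau>) \<and> sco zs \<le> sco ys' \<and>
      (\<forall>z. Q (Suc k) z \<longrightarrow> sco z \<le> sco ys')" if p: "P k \<tau>" and iv: "inv \<tau> zs" for k \<tau> zs
  proof -
    have m: "mset (rotate (Suc k) ys) = mset ([] # xs)" "mset (rotate k ys @ []) = mset ([] # xs)" using ym by auto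
    let ?\<tau> = "\<tau>(rCUR := enc_words (rotate (Suc k) ys))"
    have 1: "exec N (move_item rCUR rCUR) \<tau> = ?\<tau>"
      using p iv part_bounds[OF m(2)] by (subst exec_rotate_item[of _ _ "rotate k ys"]) (auto simp: P_def inv_def)
    have iv': "inv ?\<tau> zs" using iv by (simp add: inv_upd)
    obtain ys' where "inv (exec N try_splits ?\<tau>) ys'" "sco zs \<le> sco ys'" 
      "\<forall>t e p q. rotate (Suc k) ys = t @ e \<longrightarrow> t \<noteq> [] \<longrightarrow> sco (rotate p t @ rotate q e) \<le> sco ys'"
      "exec N try_splits ?\<tau> rCUR = ?\<tau> rCUR"
      using exec_try_splits[OF iv' _ m(1)] by auto
    then show ?thesis using p unfolding exec.simps(2) 1 by (intro exI[of _ ys']) (auto simp: P_def Q_def simp del: rotate_Suc)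
  qed
  let ?\<sigma> = "\<sigma>(rCUR := \<sigma> rBEST)"
  have "P 0 ?\<sigma>" using i by (simp add: P_def inv_def)
  moreover have "inv ?\<sigma> ys" using i by (simp add: inv_upd)
  ultimately have "\<exists>ys'. inv ((?f ^^ N) ?\<sigma>) ys' \<and> P N ((?f ^^ N) ?\<sigma>) \<and> sco ys \<le> sco ys' \<and>
      (\<forall>k\<in>{1..N}. \<forall>z. Q k z \<longrightarrow> sco z \<le> sco ys')"
    by (intro loop_search[where Q = Q] step)
  then obtain ys' where ys': "inv ((?f ^^ N) ?\<sigma>) ys'" "sco ys \<le> sco ys'" 
     "\<forall>k\<in>{1..N}. \<forall>z. Q k z \<longrightarrow> sco z \<le> sco ys'" by blast
  have ex: "exec N improve \<sigma> = (?f ^^ N) ?\<sigma>" unfolding improve_def by (simp del: exec.simps(3))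
  have b: "length ys \<le> N" "1 \<le> N" using part_bounds[of ys "[]"] ym by auto
  have "sco (rotate p t @ rotate q e) \<le> sco ys'" if te: "rotate r ys = t @ e" "t \<noteq> []" for r t e p q
  proof -
    obtain k where "k \<in> {1..N}" "rotate k ys = t @ e" using rotate_period[OF b, of r] te by auto
    moreover have "Q k (rotate p t @ rotate q e)" unfolding Q_def using calculation te(2) by blast
    ultimately show ?thesis using ys'(3) by blast
  qed
  then show ?thesis unfolding ex using ys' by blast
qed

lemma exec_search:
  assumes i: "inv \<sigma> ys"
  shows "\<exists>ys'. inv (exec N (repeat improve) \<sigma>) ys' \<and> (\<forall>zs. mset zs = mset ys' \<longrightarrow> sco zs \<le> sco ys')"
proof -
  \<comment> \<open>Every round either certifies optimality or raises the score. The second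
    alternative fails at \<open>n = N\<close>, because a score is at most the number of
    words.\<close>
  have "\<exists>ys'. inv ((exec N improve ^^ n) \<sigma>) ys' \<and> ((\<forall>zs. mset zs = mset ys' \<longrightarrow> sco zs \<le> sco ys') \<or> n \<le> sco ys')" for n
  proof (induction n)
    case 0
    then show ?case using i by auto
  next
    case (Suc n)
    then obtain y1 where 1: "inv ((exec N improve ^^ n) \<sigma>) y1" "(\<forall>zs. mset zs = mset y1 \<longrightarrow> sco zs \<le> sco y1) \<or> n \<le> sco y1" by blast
    obtain y2 where 2: "inv ((exec N improve ^^ Suc n) \<sigma>) y2" "sco y1 \<le> sco y2"
      "\<forall>r t e p q. rotate r y1 = t @ e \<longrightarrow> t \<noteq> [] \<longrightarrow> sco (rotate p t @ rotate q e) \<le> sco y2"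
      using exec_improve[OF 1(1)] by auto
    have m: "mset y1 = mset y2" using 1(1) 2(1) by (simp add: inv_def)
    show ?case
    proof (cases "sco y1 = sco y2")
      case True
      \<comment> \<open>No candidate around \<open>y1\<close> beat it, so local optimality is known
        for \<open>y1\<close>; it carries over to \<open>y2\<close> as optimality of the common
        score.\<close>
      then have "locally_optimal src tgt y1" using 2(3) by (auto simp: locally_optimal_def)
      then have "\<forall>zs. mset zs = mset y2 \<longrightarrow> sco zs \<le> sco y2"
        using locally_optimal_imp_optimal True m by metis
      then show ?thesis using 2(1) by blast
    next
      case False
      then have "(\<forall>zs. mset zs = mset y2 \<longrightarrow> sco zs \<le> sco y2) \<or> Suc n \<le> sco y2"
        using 1(2) 2(2) m by (metis Suc_leI le_neq_implies_less le_trans not_less_eq_eq)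
      then show ?thesis using 2(1) by blast
    qed
  qed
  then obtain ys' where ys': "inv ((exec N improve ^^ N) \<sigma>) ys'" "(\<forall>zs. mset zs = mset ys' \<longrightarrow> sco zs \<le> sco ys') \<or> N \<le> sco ys'" by blast
  have "sco zs \<le> length zs" for zs :: "nat list list" using score_breaks[of src tgt zs] by simp
  moreover have "length ys' < N" using part_bounds[of ys' "[]"] ys'(1) by (simp add: inv_def)
  ultimately have "\<forall>zs. mset zs = mset ys' \<longrightarrow> sco zs \<le> sco ys'" using ys'(2) by (metis leD le_trans)
  then show ?thesis using ys'(1) by auto
qed

end

section \<open>The output\<close>

text \<open>Bits come least significant first, \<open>1\<close> standing for bit 0 and
  \<open>2\<close> for bit 1; \<open>rCY\<close> is nonempty while a carry is pending.\<close>

definition incr_step :: "unit com" where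
  "incr_step = Ite (CHd rJ 1) (Ite (CHd rCY 0) (push rI 1) (push rI 2 ;; clear rCY))
     (Ite (CHd rJ 2) (Ite (CHd rCY 0) (push rI 2) (push rI 1)) skip) ;; pop rJ"

definition incr :: "unit com" where
  "incr = copy rI rJ ;; clear rI ;; push rCY 1 ;; repeat incr_step ;; Ite (CHd rCY 0) skip (push rI 2) ;; clear rCY"

text \<open>\<open>rI\<close> counts in binary the input words already rejected, so at a match it is
  the index to be output; \<open>rFD\<close> then makes the search idle.\<close>

definition find_step :: "unit com" where
  "find_step = Ite (CHd rFD 0) (clear rX ;; move_item rA rX ;; Ite (CEq rX rITEM) (push rFD 1) incr) skip"

definition out_one :: "unit com" where
  "out_one = clear rITEM ;; move_item rBEST rITEM ;; copy rIN rA ;; clear rI ;; clear rFD ;; repeat find_step ;;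
     append_reg rI 0 ;; push 0 3"

text \<open>The single batch is closed by \<open>4\<close> only for nonempty instances: batches are
  nonempty, so the empty instance needs the empty list of batches.\<close>

definition output_prog :: "unit com" where
  "output_prog = clear 0 ;; clear rJ ;; clear rCY ;; repeat (Ite (CHd rBEST 0) skip out_one) ;; Ite (CHd rIN 0) skip (push 0 4)"

text \<open>An empty word is encoded by a lone \<open>4\<close> and thus recognisable at the head of
  the queue. The sentinel and an empty word of the instance are interchangeable, so the first one
  found is removed.\<close>

definition to_front :: "unit com" where
  "to_front = repeat (Ite (CHd rBEST 4) skip (move_item rBEST rBEST)) ;; pop rBEST"

text \<open>
  An additional empty word serves as a sentinel: cut at the sentinel, a cyclic arrangement of the words
  becomes a linear one with the same number of merges.
\<close>

definition init_prog :: "unit com" where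
  "init_prog = copy 0 rIN ;; copy 0 rBEST ;; push rBEST 4 ;; copy rBEST rW ;; score_prog ;; copy rSC rSB"

definition solver :: "unit com" where
  "solver = init_prog ;; repeat improve ;; to_front ;; output_prog"

lemma wf_solver: "wf_src 24 solver"
  by (simp add: solver_def init_prog_def to_front_def output_prog_def out_one_def find_step_def incr_def incr_step_def
    improve_def try_splits_def try_rotations_T_def try_rotations_E_def try_prog_def score_prog_def scan_def scan_sym_def
    append_reg_def move_item_def move_sym_def)

lemma incr_copy:
  "set u \<subseteq> {1, 2} \<Longrightarrow> \<sigma> rJ = u \<Longrightarrow> \<sigma> rCY = [] \<Longrightarrow> (exec N incr_step ^^ length u) \<sigma> = \<sigma>(rJ := [], rI := \<sigma> rI @ u)"
proof (induction u arbitrary: \<sigma>)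
  case Nil
  then show ?case by (simp add: fun_eq_iff)
next
  case (Cons a u)
  let ?\<sigma> = "\<sigma>(rJ := u, rI := \<sigma> rI @ [a])"
  have "exec N incr_step \<sigma> = ?\<sigma>" using Cons.prems by (auto simp: incr_step_def fun_eq_iff)
  then have "(exec N incr_step ^^ length (a # u)) \<sigma> = (exec N incr_step ^^ length u) ?\<sigma>" by (simp add: funpow_swap1)
  also have "\<dots> = ?\<sigma>(rJ := [], rI := ?\<sigma> rI @ u)" using Cons.prems by (intro Cons.IH) auto
  finally show ?case by (simp add: fun_eq_iff)
qed

text \<open>The carry runs through leading one bits and is absorbed at the first zero bit, after
  which digits are only copied. If it survives all digits, the top bit is still missing and is
  appended later.\<close>

lemma incr_carry:
  "\<sigma> rJ = enc_nat n \<Longrightarrow> \<sigma> rCY = [1] \<Longrightarrow>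
   \<exists>u cy. (exec N incr_step ^^ length (enc_nat n)) \<sigma> = \<sigma>(rJ := [], rI := \<sigma> rI @ u, rCY := cy) \<and>
     (cy = [] \<and> u = enc_nat (Suc n) \<or> cy = [1] \<and> u @ [2] = enc_nat (Suc n))"
proof (induction n arbitrary: \<sigma> rule: less_induct)
  case (less n)
  show ?case
  proof (cases "n = 0")
    case True
    then show ?thesis using less.prems
      by (intro exI[of _ "[]"] exI[of _ "[1]"]) (auto simp: fun_eq_iff enc_nat_pos)
  next
    case False
    then have e: "enc_nat n = (n mod 2 + 1) # enc_nat (n div 2)" by (simp add: enc_nat_pos)
    show ?thesis
    proof (cases "even n")
      case True
      then have n: "enc_nat n = 1 # enc_nat (n div 2)" "enc_nat (Suc n) = 2 # enc_nat (n div 2)"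
        using e by (auto simp: enc_nat_pos[of "Suc n"] even_iff_mod_2_eq_zero mod_Suc)
      let ?\<sigma> = "\<sigma>(rJ := enc_nat (n div 2), rI := \<sigma> rI @ [2], rCY := [])"
      have "exec N incr_step \<sigma> = ?\<sigma>" using less.prems n by (auto simp: incr_step_def fun_eq_iff)
      then have "(exec N incr_step ^^ length (enc_nat n)) \<sigma> = (exec N incr_step ^^ length (enc_nat (n div 2))) ?\<sigma>"
        by (simp add: funpow_swap1 n)
      also have "\<dots> = ?\<sigma>(rJ := [], rI := ?\<sigma> rI @ enc_nat (n div 2))"
        using enc_nat_symbols by (intro incr_copy) auto
      finally show ?thesis using n
        by (intro exI[of _ "2 # enc_nat (n div 2)"] exI[of _ "[]"]) (auto simp: fun_eq_iff)
    next
      case odd: False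
      have "Suc n div 2 = Suc (n div 2)" using odd by presburger
      then have n: "enc_nat n = 2 # enc_nat (n div 2)" "enc_nat (Suc n) = 1 # enc_nat (Suc (n div 2))"
        using e odd by (auto simp: enc_nat_pos[of "Suc n"] odd_iff_mod_2_eq_one mod_Suc)
      let ?\<sigma> = "\<sigma>(rJ := enc_nat (n div 2), rI := \<sigma> rI @ [1])"
      have s: "exec N incr_step \<sigma> = ?\<sigma>" using less.prems n by (auto simp: incr_step_def fun_eq_iff)
      obtain u cy where u: "(exec N incr_step ^^ length (enc_nat (n div 2))) ?\<sigma> = ?\<sigma>(rJ := [], rI := ?\<sigma> rI @ u, rCY := cy)"
        "cy = [] \<and> u = enc_nat (Suc (n div 2)) \<or> cy = [1] \<and> u @ [2] = enc_nat (Suc (n div 2))"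
      proof -
        have "n div 2 < n" "?\<sigma> rJ = enc_nat (n div 2)" "?\<sigma> rCY = [1]" using less.prems False by auto
        from less.IH[OF this] show ?thesis using that by blast
      qed
      have "(exec N incr_step ^^ length (enc_nat n)) \<sigma> = (exec N incr_step ^^ length (enc_nat (n div 2))) ?\<sigma>"
        using s by (simp add: funpow_swap1 n)
      then have "(exec N incr_step ^^ length (enc_nat n)) \<sigma> = \<sigma>(rJ := [], rI := \<sigma> rI @ 1 # u, rCY := cy)"
        unfolding u(1) by (simp add: fun_eq_iff)
      then show ?thesis using u(2) n by (intro exI[of _ "1 # u"] exI[of _ cy]) auto
    qed
  qed
qed

lemma exec_incr:
  assumes "\<sigma> rI = enc_nat n" "n \<le> N" "\<sigma> rJ = []" "\<sigma> rCY = []"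
  shows "exec N incr \<sigma> = \<sigma>(rI := enc_nat (Suc n))"
proof -
  let ?\<sigma> = "\<sigma>(rJ := \<sigma> rI, rI := [], rCY := [1])"
  have 0: "exec N (repeat incr_step ;; Ite (CHd rCY 0) skip (push rI 2) ;; clear rCY) ?\<sigma> = exec N incr \<sigma>"
    using assms by (simp add: incr_def)
  obtain u cy where u: "(exec N incr_step ^^ length (enc_nat n)) ?\<sigma> = ?\<sigma>(rJ := [], rI := ?\<sigma> rI @ u, rCY := cy)"
    "cy = [] \<and> u = enc_nat (Suc n) \<or> cy = [1] \<and> u @ [2] = enc_nat (Suc n)"
    using incr_carry[of ?\<sigma> n N] assms by auto
  have "(exec N incr_step ^^ N) ?\<sigma> = ?\<sigma>(rJ := [], rI := ?\<sigma> rI @ u, rCY := cy)"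
  proof (rule funpow_fixpoint[OF u(1)])
    show "length (enc_nat n) \<le> N" using length_enc_nat[of n] assms(2) by simp
  qed (simp add: incr_step_def fun_eq_iff)
  then show ?thesis unfolding 0[symmetric] exec.simps(2,4) using u(2) assms by (auto simp: fun_eq_iff)
qed

lemma test_empty: "0 \<notin> set (\<sigma> r) \<Longrightarrow> test (CHd r 0) \<sigma> \<longleftrightarrow> \<sigma> r = []"
  by (auto split: list.splits)

lemma enc_words_nz: "0 \<notin> set (enc_words ws)"
  using enc_words_symbols[of ws] by auto

section \<open>From words to indices\<close>

context instance_clock
begin

definition idx :: "nat list \<Rightarrow> nat" where
  "idx w = (LEAST i. i < length xs \<and> xs ! i = w)"

lemma idx:
  assumes "w \<in> set xs"
  shows "idx w < length xs" "xs ! idx w = w" "j < idx w \<Longrightarrow> xs ! j \<noteq> w"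
proof -
  obtain i where "i < length xs \<and> xs ! i = w" using assms by (metis in_set_conv_nth)
  then have "idx w < length xs \<and> xs ! idx w = w" unfolding idx_def by (rule LeastI)
  then show "idx w < length xs" "xs ! idx w = w" by auto
  then show "j < idx w \<Longrightarrow> xs ! j \<noteq> w" unfolding idx_def using not_less_Least by fastforce
qed

lemma length_xs: "length xs < N"
  using N length_le_enc_words[of xs] by simp

lemma length_enc_drop: "length (enc_words (drop k xs)) \<le> N"
proof -
  have "enc_words xs = enc_words (take k xs) @ enc_words (drop k xs)"
    by (metis append_take_drop_id enc_words_simps(3))
  then show ?thesis using N by simp
qed

text \<open>\<open>idx w - k\<close> is the number of mismatches still ahead; one more iteration
  finds the match.\<close>

lemma find_loop:
  assumes "w \<in> set xs" "k \<le> idx w"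
    "\<sigma> rFL = []" "\<sigma> rJ = []" "\<sigma> rCY = []" "\<sigma> rFD = []" "\<sigma> rA = enc_words (drop k xs)" "\<sigma> rI = enc_nat k"
    "\<sigma> rITEM = enc_word w @ [4]"
  shows "\<exists>a x. (exec N find_step ^^ (Suc (idx w - k))) \<sigma> = \<sigma>(rFD := [1], rA := a, rI := enc_nat (idx w), rX := x)"
  using assms
proof (induction "idx w - k" arbitrary: k \<sigma>)
  case 0
  then have k: "k = idx w" by simp
  have d: "drop k xs = w # drop (Suc k) xs" using idx[OF 0(2)] k by (metis Cons_nth_drop_Suc)
  have "exec N (move_item rA rX) (\<sigma>(rX := [])) = (\<sigma>(rX := []))(rA := enc_words (drop (Suc k) xs), rX := [] @ enc_word w @ [4])"
    using 0 d length_enc_drop[of k] by (subst exec_move_first[of _ _ _ w "drop (Suc k) xs"]) auto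
  then have "exec N find_step \<sigma> = \<sigma>(rX := enc_word w @ [4], rA := enc_words (drop (Suc k) xs), rFD := [1])"
    using 0 by (simp add: find_step_def fun_eq_iff)
  then show ?case using 0 k by (intro exI[of _ "enc_words (drop (Suc k) xs)"] exI[of _ "enc_word w @ [4]"]) (auto simp: fun_eq_iff)
next
  case (Suc m)
  have k: "k < idx w" using Suc.hyps(2) by simp
  have kl: "k < length xs" using k idx(1)[OF Suc.prems(1)] by simp
  define v where "v = xs ! k"
  have vw: "v \<noteq> w" using idx(3)[OF Suc.prems(1) k] by (simp add: v_def)
  have d: "drop k xs = v # drop (Suc k) xs" using kl by (simp add: v_def Cons_nth_drop_Suc)
  have 1: "exec N (move_item rA rX) (\<sigma>(rX := [])) = (\<sigma>(rX := []))(rA := enc_words (drop (Suc k) xs), rX := [] @ enc_word v @ [4])"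
    using Suc.prems d length_enc_drop[of k] by (subst exec_move_first[of _ _ _ v "drop (Suc k) xs"]) auto
  let ?\<tau> = "(\<sigma>(rX := []))(rA := enc_words (drop (Suc k) xs), rX := [] @ enc_word v @ [4])"
  let ?\<sigma> = "\<sigma>(rX := enc_word v @ [4], rA := enc_words (drop (Suc k) xs), rI := enc_nat (Suc k))"
  have 2: "exec N incr ?\<tau> = ?\<sigma>"
    using Suc.prems kl length_xs by (subst exec_incr[of _ k]) (auto simp: fun_eq_iff)
  have 3: "enc_word v \<noteq> enc_word w" using vw enc_word_inj by blast
  have "exec N find_step \<sigma> = (if test (CEq rX rITEM) ?\<tau> then exec N (push rFD 1) ?\<tau> else exec N incr ?\<tau>)"
    unfolding find_step_def exec.simps(1-3) do_prim.simps 1 using Suc.prems by simp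
  also have "\<dots> = ?\<sigma>" using 2 3 Suc.prems by simp
  finally have s: "exec N find_step \<sigma> = ?\<sigma>" .
  have "\<exists>a x. (exec N find_step ^^ (Suc (idx w - Suc k))) ?\<sigma> = ?\<sigma>(rFD := [1], rA := a, rI := enc_nat (idx w), rX := x)"
    using Suc.hyps(2) Suc.prems k by (intro Suc.hyps(1)) auto
  then obtain a x where ax: "(exec N find_step ^^ (Suc (idx w - Suc k))) ?\<sigma> = ?\<sigma>(rFD := [1], rA := a, rI := enc_nat (idx w), rX := x)" by blast
  have "Suc (idx w - k) = Suc (Suc (idx w - Suc k))" using k by simp
  then have "(exec N find_step ^^ Suc (idx w - k)) \<sigma> = (exec N find_step ^^ (Suc (idx w - Suc k))) ?\<sigma>"
    using s by (simp only: funpow_Suc_right comp_apply)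
  then show ?case unfolding ax by (intro exI[of _ a] exI[of _ x]) (auto simp: fun_eq_iff)
qed

lemma exec_out_one:
  assumes "w \<in> set xs" "\<sigma> rBEST = enc_words (w # ws)" "length (\<sigma> rBEST) \<le> N"  "\<sigma> rIN = enc_words xs"
    "\<sigma> rFL = []" "\<sigma> rJ = []" "\<sigma> rCY = []" "\<sigma> rV = []"
  shows "exec N out_one \<sigma> 0 = \<sigma> 0 @ enc_nat (idx w) @ [3]" "exec N out_one \<sigma> rBEST = enc_words ws"
    "\<forall>r\<in>{rIN, rFL, rJ, rCY, rV}. exec N out_one \<sigma> r = \<sigma> r"
proof -
  have 1: "exec N (move_item rBEST rITEM) (\<sigma>(rITEM := [])) = (\<sigma>(rITEM := []))(rBEST := enc_words ws, rITEM := [] @ enc_word w @ [4])"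
    using assms by (subst exec_move_first[of _ _ _ w ws]) auto
  let ?\<sigma> = "\<sigma>(rITEM := enc_word w @ [4], rBEST := enc_words ws, rA := enc_words xs, rI := [], rFD := [])"
  have "\<exists>a x. (exec N find_step ^^ (Suc (idx w - 0))) ?\<sigma> = ?\<sigma>(rFD := [1], rA := a, rI := enc_nat (idx w), rX := x)"
    using assms by (intro find_loop) auto
  then obtain a x where ax: "(exec N find_step ^^ Suc (idx w)) ?\<sigma> = ?\<sigma>(rFD := [1], rA := a, rI := enc_nat (idx w), rX := x)" by auto
  let ?\<tau> = "?\<sigma>(rFD := [1], rA := a, rI := enc_nat (idx w), rX := x)"
  have 2: "(exec N find_step ^^ N) ?\<sigma> = ?\<tau>"
  proof (rule funpow_fixpoint[OF ax])
    show "Suc (idx w) \<le> N" using idx(1)[OF assms(1)] length_xs by simp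
  qed (simp add: find_step_def)
  have "length (enc_nat (idx w)) \<le> N" using length_enc_nat[of "idx w"] idx(1)[OF assms(1)] length_xs by simp
  moreover have "set (enc_nat (idx w)) \<subseteq> {1..4}" using enc_nat_symbols[of "idx w"] by auto
  ultimately have 3: "exec N (append_reg rI 0) ?\<tau> = ?\<tau>(0 := \<sigma> 0 @ enc_nat (idx w))"
    using assms by (subst exec_append_reg) auto
  have e: "(\<sigma>(rITEM := [], rBEST := enc_words ws, rITEM := [] @ enc_word w @ [4]))(rA := (\<sigma>(rITEM := [], rBEST := enc_words ws, rITEM := [] @ enc_word w @ [4])) rIN, rI := [], rFD := []) = ?\<sigma>"
    using assms by (auto simp: fun_eq_iff)
  have "exec N out_one \<sigma> = ?\<tau>(0 := \<sigma> 0 @ enc_nat (idx w) @ [3])"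
    unfolding out_one_def exec.simps(1,2,4) do_prim.simps 1 e 2 3 by simp
  then show "exec N out_one \<sigma> 0 = \<sigma> 0 @ enc_nat (idx w) @ [3]" "exec N out_one \<sigma> rBEST = enc_words ws"
    "\<forall>r\<in>{rIN, rFL, rJ, rCY, rV}. exec N out_one \<sigma> r = \<sigma> r" by auto
qed

lemma output_loop:
  assumes "set zs \<subseteq> set xs" "\<sigma> rBEST = enc_words zs" "length (\<sigma> rBEST) \<le> N" "\<sigma> rIN = enc_words xs"
    "\<sigma> rFL = []" "\<sigma> rJ = []" "\<sigma> rCY = []" "\<sigma> rV = []"
  shows "\<exists>\<sigma>'. (exec N (Ite (CHd rBEST 0) skip out_one) ^^ length zs) \<sigma> = \<sigma>' \<and> \<sigma>' rBEST = [] \<and>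
     \<sigma>' 0 = \<sigma> 0 @ enc_word (map idx zs) \<and> \<sigma>' rIN = enc_words xs"
  using assms
proof (induction zs arbitrary: \<sigma>)
  case (Cons w ws)
  let ?\<sigma> = "exec N out_one \<sigma>"
  have w: "w \<in> set xs" using Cons.prems(1) by simp
  note o = exec_out_one[OF w Cons.prems(2-8)]
  have "\<not> test (CHd rBEST 0) \<sigma>" using test_empty[of \<sigma> rBEST] enc_words_nz[of "w # ws"] Cons.prems(2) by simp
  then have s: "exec N (Ite (CHd rBEST 0) skip out_one) \<sigma> = ?\<sigma>" by (simp del: test.simps)
  have "\<exists>\<sigma>'. (exec N (Ite (CHd rBEST 0) skip out_one) ^^ length ws) ?\<sigma> = \<sigma>' \<and> \<sigma>' rBEST = [] \<and>
     \<sigma>' 0 = ?\<sigma> 0 @ enc_word (map idx ws) \<and> \<sigma>' rIN = enc_words xs"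
    using Cons.prems o by (intro Cons.IH) auto
  then show ?case using s o(1) by (simp add: funpow_swap1 del: exec.simps)
qed auto

lemma exec_output_prog:
  assumes "set zs = set xs" "\<sigma> rBEST = enc_words zs" "length (\<sigma> rBEST) \<le> N" "\<sigma> rIN = enc_words xs"
    "\<sigma> rFL = []" "\<sigma> rV = []"
  shows "exec N output_prog \<sigma> 0 = enc_words (if xs = [] then [] else [map idx zs])"
proof -
  let ?b = "Ite (CHd rBEST 0) skip out_one"
  let ?\<sigma> = "\<sigma>(0 := [], rJ := [], rCY := [])"
  have "\<exists>\<sigma>'. (exec N ?b ^^ length zs) ?\<sigma> = \<sigma>' \<and> \<sigma>' rBEST = [] \<and>
     \<sigma>' 0 = ?\<sigma> 0 @ enc_word (map idx zs) \<and> \<sigma>' rIN = enc_words xs"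
    using assms by (intro output_loop) auto
  then obtain \<sigma>' where s: "(exec N ?b ^^ length zs) ?\<sigma> = \<sigma>'" "\<sigma>' rBEST = []"
     "\<sigma>' 0 = enc_word (map idx zs)" "\<sigma>' rIN = enc_words xs" by auto
  have "(exec N ?b ^^ N) ?\<sigma> = \<sigma>'"
  proof (rule funpow_fixpoint[OF s(1)])
    show "length zs \<le> N" using length_le_enc_words[of zs] assms(2,3) by simp
  qed (simp add: s)
  then have "exec N output_prog \<sigma> = exec N (Ite (CHd rIN 0) skip (push 0 4)) \<sigma>'"
    unfolding output_prog_def by (simp del: exec.simps(3) test.simps)
  moreover have "exec N (Ite (CHd rIN 0) skip (push 0 4)) \<sigma>' 0 = enc_words (if xs = [] then [] else [map idx zs])"
    using s assms(1) test_empty[of \<sigma>' rIN] enc_words_nz[of xs] by (auto simp del: test.simps)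
  ultimately show ?thesis by simp
qed

lemma exec_to_front:
  assumes i: "inv \<sigma> ys"
  shows "\<exists>k zs. rotate k ys = [] # zs \<and> exec N to_front \<sigma> = \<sigma>(rBEST := enc_words zs)"
proof -
  let ?b = "Ite (CHd rBEST 4) skip (move_item rBEST rBEST)"
  have m: "mset ys = mset ([] # xs)" using i by (simp add: inv_def)
  then have "[] \<in> set ys" by (metis list.set_intros(1) set_mset_mset)
  then obtain ys1 ys2 where ys: "ys = ys1 @ [] # ys2" "[] \<notin> set ys1" using split_list_first by metis
  have it: "(exec N ?b ^^ length us) \<sigma> = \<sigma>(rBEST := enc_words (vs @ us))"
    if "\<sigma> rBEST = enc_words (us @ vs)" "[] \<notin> set us" "length (\<sigma> rBEST) \<le> N" "\<sigma> rFL = []" for us vs \<sigma>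
    using that
  proof (induction us arbitrary: \<sigma> vs)
    case Nil
    then show ?case by (simp add: fun_eq_iff)
  next
    case (Cons u us)
    let ?\<sigma> = "\<sigma>(rBEST := enc_words (us @ vs @ [u]))"
    have "\<not> test (CHd rBEST 4) \<sigma>"
    proof -
      obtain a v where av: "enc_word u = a # v" using Cons.prems(2) by (cases "enc_word u") auto
      then have "a \<noteq> 4" using enc_word_symbols[of u] by auto
      then show ?thesis using Cons.prems(1) av by simp
    qed
    then have "exec N ?b \<sigma> = exec N (move_item rBEST rBEST) \<sigma>" by (simp del: test.simps)
    also have "\<dots> = ?\<sigma>" using Cons.prems by (subst exec_rotate_item[of _ _ "(u # us) @ vs"]) auto
    finally have "(exec N ?b ^^ length (u # us)) \<sigma> = (exec N ?b ^^ length us) ?\<sigma>"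
      by (simp add: funpow_swap1 del: exec.simps test.simps)
    also have "\<dots> = ?\<sigma>(rBEST := enc_words ((vs @ [u]) @ us))" using Cons.prems by (intro Cons.IH) auto
    also have "\<dots> = \<sigma>(rBEST := enc_words (vs @ u # us))" by simp
    finally show ?case .
  qed
  have b: "length (\<sigma> rBEST) \<le> N" "length ys1 \<le> N"
    using i part_bounds[of ys "[]"] m by (auto simp: inv_def ys)
  let ?\<tau> = "\<sigma>(rBEST := enc_words (([] # ys2) @ ys1))"
  have "(exec N ?b ^^ N) \<sigma> = ?\<tau>"
  proof (rule funpow_fixpoint)
    show "(exec N ?b ^^ length ys1) \<sigma> = ?\<tau>" using i b ys by (intro it) (auto simp: inv_def)
  qed (use b in auto)
  then have "exec N to_front \<sigma> = \<sigma>(rBEST := enc_words (ys2 @ ys1))"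
    by (simp add: to_front_def del: exec.simps(3) test.simps)
  moreover have "rotate (length ys1) ys = [] # ys2 @ ys1" by (simp add: ys rotate_append)
  ultimately show ?thesis by blast
qed

lemma exec_init_prog: "inv (exec N init_prog (start_store (enc_words xs))) (xs @ [[]])"
proof -
  let ?w = "enc_words xs @ [4]"
  let ?\<sigma> = "(start_store (enc_words xs))(rIN := enc_words xs, rBEST := ?w, rW := ?w)"
  have "exec N score_prog ?\<sigma> = ?\<sigma>(rSC := replicate (sco (xs @ [[]])) 1)"
    using N by (subst exec_score_prog[of _ "xs @ [[]]"]) (auto simp: start_store_def)
  moreover have "exec N init_prog (start_store (enc_words xs)) = exec N (copy rSC rSB) (exec N score_prog ?\<sigma>)"
    by (simp add: init_prog_def start_store_def)
  ultimately show ?thesis by (simp add: inv_def start_store_def)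
qed

theorem exec_solver:
  "\<exists>zs. mset zs = mset xs \<and> (\<forall>ys. mset ys = mset ([] # xs) \<longrightarrow> sco ys \<le> sco ([] # zs)) \<and>
    exec N solver (start_store (enc_words xs)) 0 = enc_words (if xs = [] then [] else [map idx zs])"
proof -
  let ?\<sigma> = "exec N init_prog (start_store (enc_words xs))"
  obtain ys where ys: "inv (exec N (repeat improve) ?\<sigma>) ys" "\<forall>zs. mset zs = mset ys \<longrightarrow> sco zs \<le> sco ys"
    using exec_search[OF exec_init_prog] by blast
  let ?\<tau> = "exec N (repeat improve) ?\<sigma>"
  obtain k zs where zs: "rotate k ys = [] # zs" "exec N to_front ?\<tau> = ?\<tau>(rBEST := enc_words zs)"
    using exec_to_front[OF ys(1)] by blast
  have m: "mset ys = mset ([] # xs)" using ys(1) by (simp add: inv_def)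
  have mr: "mset ([] # zs) = mset ([] # xs)" using m mset_rotate[of k ys] by (simp add: zs(1))
  then have mz: "mset zs = mset xs" by simp
  then have sz: "set zs = set xs" by (metis set_mset_mset)
  have sc: "sco ([] # zs) = sco ys" using score_rotate[of src tgt k ys] by (simp add: zs(1))
  have "exec N output_prog (?\<tau>(rBEST := enc_words zs)) 0 = enc_words (if xs = [] then [] else [map idx zs])"
    using ys(1) part_bounds[of "[] # zs" "[]"] mr by (intro exec_output_prog[OF sz]) (auto simp: inv_def)
  then have "exec N solver (start_store (enc_words xs)) 0 = enc_words (if xs = [] then [] else [map idx zs])"
    unfolding solver_def exec.simps(2) zs(2) .
  moreover have "\<forall>vs. mset vs = mset ([] # xs) \<longrightarrow> sco vs \<le> sco ([] # zs)" using ys(2) m sc by metis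
  ultimately show ?thesis using mz by blast
qed

end

section \<open>Number of phrases and optimal schedules\<close>

lemma rle_Nil [simp]: "rle_phrases [] = 0"
  by (simp add: rle_phrases_def)

lemma rle_Cons: "rle_phrases (x # w) = rle_phrases w + of_bool (w = [] \<or> hd w \<noteq> x)"
  by (cases w) (auto simp: rle_phrases_def)

lemma rle_append:
  "rle_phrases (u @ v) + of_bool (u \<noteq> [] \<and> v \<noteq> [] \<and> last u = hd v) = rle_phrases u + rle_phrases v"
proof (induction u)
  case (Cons x u)
  then show ?case by (cases u) (auto simp: rle_Cons)
qed simp

lemma tgt_eq_src: "tgt u = src v \<longleftrightarrow> u \<noteq> [] \<and> v \<noteq> [] \<and> last u = hd v"
  by (auto simp: tgt_def src_def)

abbreviation merges :: "nat list list \<Rightarrow> nat" where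
  "merges ws \<equiv> cnt (\<lambda>(a, b). tgt a = src b) (steps ws)"

lemma merges_Cons: "merges (w # v # ws) = of_bool (tgt w = src v) + merges (v # ws)"
  by (simp add: steps_def)

text \<open>Only an inequality, since words separated by empty words may fuse in the concatenation
  without being counted in \<open>merges\<close>.\<close>

lemma batch_cost_merges_le: "batch_cost ws + merges ws \<le> sum_list (map rle_phrases ws)"
proof (induction ws)
  case Nil
  then show ?case by (simp add: batch_cost_def steps_def)
next
  case (Cons w ws)
  show ?case
  proof (cases ws)
    case Nil
    then show ?thesis by (simp add: batch_cost_def steps_def)
  next
    case (Cons v vs)
    have "of_bool (tgt w = src v) \<le> (of_bool (w \<noteq> [] \<and> concat ws \<noteq> [] \<and> last w = hd (concat ws)) :: nat)"
      by (auto simp: tgt_eq_src Cons)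
    moreover have "batch_cost (w # ws) = rle_phrases (w @ concat ws)" "batch_cost ws = rle_phrases (concat ws)"
      "merges (w # ws) = of_bool (tgt w = src v) + merges ws"
      by (simp_all add: batch_cost_def Cons merges_Cons)
    moreover have "sum_list (map rle_phrases (w # ws)) = rle_phrases w + sum_list (map rle_phrases ws)" by simp
    ultimately show ?thesis using Cons.IH rle_append[of w "concat ws"] by linarith
  qed
qed

text \<open>Without empty words, neighbours in the list are neighbours in the concatenation, so
  merges are exactly the fused runs.\<close>

lemma batch_cost_merges: "[] \<notin> set ws \<Longrightarrow> batch_cost ws + merges ws = sum_list (map rle_phrases ws)"
proof (induction ws)
  case Nil
  then show ?case by (simp add: batch_cost_def steps_def)
next
  case (Cons w ws)
  then have IH: "batch_cost ws + merges ws = sum_list (map rle_phrases ws)" by simp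
  show ?case
  proof (cases ws)
    case Nil
    then show ?thesis by (simp add: batch_cost_def steps_def)
  next
    case (Cons v vs)
    have "of_bool (tgt w = src v) = (of_bool (w \<noteq> [] \<and> concat ws \<noteq> [] \<and> last w = hd (concat ws)) :: nat)"
      using Cons.prems by (auto simp: tgt_eq_src Cons)
    moreover have "batch_cost (w # ws) = rle_phrases (w @ concat ws)" "batch_cost ws = rle_phrases (concat ws)"
      "merges (w # ws) = of_bool (tgt w = src v) + merges ws"
      by (simp_all add: batch_cost_def Cons merges_Cons)
    moreover have "sum_list (map rle_phrases (w # ws)) = rle_phrases w + sum_list (map rle_phrases ws)" by simp
    ultimately show ?thesis using IH rle_append[of w "concat ws"] by linarith
  qed
qed

lemma batch_cost_concat_le: "batch_cost (concat Bs) \<le> sum_list (map batch_cost Bs)"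
proof (induction Bs)
  case (Cons B Bs)
  then show ?case using rle_append[of "concat B" "concat (concat Bs)"] by (simp add: batch_cost_def)
qed (simp add: batch_cost_def)

text \<open>A competing schedule is concatenated to one batch and freed of empty words, which does
  not increase its cost. The resulting list \<open>L\<close> has cost exactly total phrases minus
  merges, and its merges are bounded by \<open>opt\<close>.\<close>

lemma optimal_schedule_single:
  fixes xs zs :: "nat list list"
  assumes d: "distinct xs" and ne: "xs \<noteq> []" and m: "mset zs = mset xs"
    and opt: "\<And>ys. mset ys = mset ([] # xs) \<Longrightarrow> sco ys \<le> sco ([] # zs)"
  shows "optimal_schedule (set xs) {zs}"
proof -
  have sz: "set zs = set xs" using m by (metis set_mset_mset)
  have dz: "distinct zs" using m d by (metis mset_eq_imp_distinct_iff)
  have zne: "zs \<noteq> []" using m ne by auto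
  have "is_schedule (set xs) {zs}" using sz dz zne by (auto simp: is_schedule_def is_batch_def)
  moreover have "schedule_cost {zs} \<le> schedule_cost S" if S: "is_schedule (set xs) S" for S
  proof -
    \<comment> \<open>Finiteness is essential: a sum over an infinite set would be \<open>0\<close>,
      and the batches are to be listed and concatenated.\<close>
    have "S \<subseteq> {B. set B \<subseteq> set xs \<and> distinct B}" using S by (auto simp: is_schedule_def is_batch_def)
    then have "finite S" by (rule finite_subset) (simp add: finite_subset_distinct)
    then obtain Bs where Bs: "set Bs = S" "distinct Bs" using finite_distinct_list by blast
    have "distinct (concat Bs)"
      using S Bs by (intro distinct_concat) (auto simp: is_schedule_def is_batch_def)
    moreover have "set (concat Bs) = set xs" using S Bs by (auto simp: is_schedule_def)
    ultimately have mB: "mset (concat Bs) = mset xs" using d set_eq_iff_mset_eq_distinct by blast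
    define L D where "L = filter (\<lambda>w. w \<noteq> []) (concat Bs)" and "D = filter (\<lambda>w. w = []) (concat Bs)"
    have mLD: "mset L + mset D = mset xs"
      unfolding L_def D_def mB[symmetric] by (simp add: mset_filter flip: multiset_partition)
    then have "sco (L @ D @ [[]]) \<le> sco ([] # zs)" by (intro opt) simp
    \<comment> \<open>The empty words are parked beside the sentinel, so no merge inside
      \<open>L\<close> is lost.\<close>
    moreover have "merges L \<le> sco (L @ D @ [[]])"
    proof (cases "L = []")
      case False
      then show ?thesis by (simp add: score_def junctions_append)
    qed (simp add: steps_def)
    moreover have "sco ([] # zs) = merges zs"
    proof -
      have "junctions ([] # zs) = ([], hd zs) # steps zs @ [(last zs, [])]"
        using junctions_append[of "[[]]" zs] zne by (simp add: steps_def)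
      then show ?thesis by (simp add: score_def tgt_eq_src)
    qed
    moreover have "sum_list (map rle_phrases L) = sum_list (map rle_phrases zs)"
    proof -
      have "sum_list (map rle_phrases D) = 0" by (simp add: D_def sum_list_eq_0_iff)
      moreover have "sum_list (map rle_phrases zs) = (\<Sum>w\<in>#mset zs. rle_phrases w)" 
        by (metis mset_map sum_mset_sum_list)
      moreover have "sum_list (map rle_phrases L) + sum_list (map rle_phrases D) = (\<Sum>w\<in>#mset L + mset D. rle_phrases w)"
        by (simp add: sum_mset_sum_list flip: mset_map)
      ultimately show ?thesis unfolding mLD m by linarith
    qed
    moreover have "batch_cost L + merges L = sum_list (map rle_phrases L)"
      by (rule batch_cost_merges) (simp add: L_def)
    ultimately have "batch_cost zs \<le> batch_cost L" using batch_cost_merges_le[of zs] by linarith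
    also have "batch_cost L = batch_cost (concat Bs)"
    proof -
      have "concat (filter (\<lambda>w. w \<noteq> []) ws) = concat ws" for ws :: "nat list list" by (induction ws) auto
      then show ?thesis by (simp add: batch_cost_def L_def)
    qed
    also have "\<dots> \<le> sum_list (map batch_cost Bs)" by (rule batch_cost_concat_le)
    also have "\<dots> = schedule_cost S" using Bs by (simp add: schedule_cost_def sum_list_distinct_conv_sum_set)
    finally show ?thesis by (simp add: schedule_cost_def)
  qed
  ultimately show ?thesis by (simp add: optimal_schedule_def)
qed

theorem theorem2:
  shows "\<exists>M. wf_tm M \<and> solves_in_poly_time M"
proof -
  obtain M A d where M: "wf_tm M" and run: "\<And>w. set w \<subseteq> {1..4} \<Longrightarrow> \<exists>t tp h. t \<le> A * (length w + 1) ^ d \<and>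
     tm_run M t (init_config w) = (1, tp, h) \<and> tape_output tp (exec (length w + 2) solver (start_store w) 0)"
    using poly_time_tm_of_program[OF wf_solver] by auto
  have "\<exists>t \<le> A * (length (enc_words xs) + 1) ^ d. case tm_run M t (init_config (enc_words xs)) of (q, tape, h) \<Rightarrow>
      q = 1 \<and> (\<exists>S. tape_output tape (enc_words S) \<and> (\<forall>b\<in>set S. \<forall>i\<in>set b. i < length xs) \<and>
        optimal_schedule (set xs) ((\<lambda>b. map (\<lambda>i. xs ! i) b) ` set S))"
    if dx: "distinct xs" for xs
  proof -
    \<comment> \<open>The clock register of \<open>start_store\<close> has exactly this length, the
      smallest one that the locale admits.\<close>
    interpret instance_clock "length (enc_words xs) + 2" xs by unfold_locales simp
    obtain zs where zs: "mset zs = mset xs" "\<And>ys. mset ys = mset ([] # xs) \<Longrightarrow> sco ys \<le> sco ([] # zs)"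
      "exec (length (enc_words xs) + 2) solver (start_store (enc_words xs)) 0 = enc_words (if xs = [] then [] else [map idx zs])"
      using exec_solver by blast
    obtain t tp h where t: "t \<le> A * (length (enc_words xs) + 1) ^ d"
      "tm_run M t (init_config (enc_words xs)) = (1, tp, h)"
      "tape_output tp (exec (length (enc_words xs) + 2) solver (start_store (enc_words xs)) 0)"
      using run[OF enc_words_symbols] by blast
    define S where "S = (if xs = [] then [] else [map idx zs])"
    have out: "tape_output tp (enc_words S)" using t(3) zs(3) by (simp add: S_def)
    have sz: "set zs = set xs" using zs(1) by (metis set_mset_mset)
    have bound: "\<forall>b\<in>set S. \<forall>i\<in>set b. i < length xs" using idx(1) sz by (auto simp: S_def)
    have "optimal_schedule (set xs) ((\<lambda>b. map (\<lambda>i. xs ! i) b) ` set S)"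
    proof (cases "xs = []")
      case True
      then show ?thesis by (auto simp: S_def optimal_schedule_def is_schedule_def schedule_cost_def)
    next
      case False
      have "map (\<lambda>i. xs ! i) (map idx zs) = zs" unfolding map_map using idx(2) sz by (intro map_idI) simp
      then have "(\<lambda>b. map (\<lambda>i. xs ! i) b) ` set S = {zs}" using False by (simp add: S_def)
      then show ?thesis using optimal_schedule_single[OF dx False zs(1,2)] by simp
    qed
    then show ?thesis using t out bound by (intro exI[of _ t]) auto
  qed
  then show ?thesis using M unfolding solves_in_poly_time_def by blast
qed

end
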